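(* (Spectral duality for the multi-matrix model.) Let $N\ge N_0$ with $N_0$ as in the context. (a) For each $k\in\{1,\dots,m\}$, $$\tilde D_k^N(x)\,\mathbb A_k^N=\mathbb A_k^N\,D_k^N(x),$$ and consequently $\det(y\mathbf 1-D_k^N(x))=\det(y\mathbf 1-\tilde D_k^N(x))$. (b) The spectral curves for different $k$ are related by $$\det\left(x\mathbf 1-D_{2}^N(y)\right)\propto\det\left(y\mathbf 1+D_1^N(x)\right),$$ $$\det\left(x\mathbf 1-D_{k+1}^N(y)\right)\propto\det\left(y\mathbf 1-V_k'(x)\mathbf 1+D_k^N(x)\right)\qquad(1<k\le m-1),$$ where $\propto$ denotes equality of polynomials in $(x,y)$ up to a nonzero factor independent of $x$ and $y$.
   Context: **Setting.** Fix $m\ge2$ and polynomials $V_k(x)=u_{k,0}+\sum_{l=1}^{d_k+1}\frac{u_{k,l}}lx^l$ ($1\le k\le m$) of degree exactly $d_k+1\ge2$. The integration contours are such that all integrals converge and integration by parts produces no boundary terms. Assume there are monic polynomials $\pi_n,\sigma_n$ of degree $n$ ($n\ge0$) with $$\int\cdots\int\prod_{k=1}^mdx_k\;\prod_{k=1}^me^{-V_k(x_k)}\prod_{k=1}^{m-1}e^{x_kx_{k+1}}\,\pi_n(x_1)\sigma_l(x_m)=h_n\delta_{nl},\qquad h_n\ne0.$$ Define $\psi_{1,n}(x)=\frac1{\sqrt{h_n}}\pi_n(x)e^{-V_1(x)}$, $\psi_{2,n}(x)=\int dy\,\psi_{1,n}(y)e^{xy}$, $\psi_{k+1,n}(x)=\int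 dy\,\psi_{k,n}(y)e^{xy}e^{-V_k(y)}$ ($2\le k\le m-1$); $\phi_{m,n}(x)=\frac1{\sqrt{h_n}}\sigma_n(x)e^{-V_m(x)}$, $\phi_{k-1,n}(x)=e^{-V_{k-1}(x)}\int dy\,\phi_{k,n}(y)e^{xy}$ ($3\le k\le m$), $\phi_{1,n}(x)=\int dy\,\phi_{2,n}(y)e^{xy}$. Then $\int\psi_{k,n}\phi_{k,l}\,dx=\delta_{nl}$. **Recursions.** The semi-infinite matrices $Q_k$ are defined by $x\psi_{k,n}=\sum_l(Q_k)_{n,l}\psi_{k,l}$. With $r_1=1$, $r_k=\prod_{l=1}^{k-1}d_l$, $s_m=1$, $s_k=\prod_{l=k+1}^md_l$, one has $(Q_k)_{n,n+l}=0$ unless $-s_k\le l\le r_k$. Put $\alpha_{k,l}(n)=(Q_k)_{n,n+l}$; the extreme coefficients $\alpha_{k,r_k}(n)$ ($n\ge0$) and $\alpha_{k,-s_k}(n)$ ($n\ge s_k$) are nonzero. For each $k$ (terms with negative index omitted): $x\psi_{k,n}=\sum_{l=-s_k}^{r_k}\alpha_{k,l}(n)\psi_{k,n+l}$, $x\phi_{k,n}=\sum_{l=-s_k}^{r_k}\alpha_{k,l}(n-l)\phi_{k,n-l}$; $\partial_x\psi_{1,n}=-\sum_l\alpha_{2,l}(n)\psi_{1,n+l}$, $\partial_x\phi_{1,n}=\sum_l\alpha_{2,l}(n-l)\phi_{1,n-l}$; and for $k\ge2$, $\partial_x\psi_{k,n}=\sum_l\alpha_{k-1,l}(n)\psi_{k,n+l}$,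 $\partial_x\phi_{k,n}=-\sum_l\alpha_{k-1,l}(n-l)\phi_{k,n-l}$. **Windows and ladder matrices** (size $r_k+s_k$). $\Psi_{k,N}=(\psi_{k,N-s_k},\dots,\psi_{k,N+r_k-1})^t$ and $\Phi_{k,N}=(\phi_{k,N-r_k},\dots,\phi_{k,N+s_k-1})$. $a_{k,N}(x)$ has $1$'s on the first superdiagonal, and last row equal to $\frac1{\alpha_{k,r_k}(N)}\big(x\,\delta_{l,0}-\alpha_{k,l}(N)\big)_{l=-s_k,\dots,r_k-1}$, other entries $0$, so that $a_{k,N}\Psi_{k,N}=\Psi_{k,N+1}$. $\tilde a_{k,N}(x)$ has $1$'s on the first superdiagonal, and first column equal to $\frac1{\alpha_{k,r_k}(N-1-r_k)}\big(x\,\delta_{l,0}-\alpha_{k,l}(N-1-l)\big)^t_{l=r_k-1,r_k-2,\dots,-s_k}$, other entries $0$, so that $\Phi_{k,N}\tilde a_{k,N}=\Phi_{k,N-1}$. **Differential matrices.** Put $\alpha^{k,N}_{j,l}=\mathrm{diag}(\alpha_{j,l}(N-s_k),\dots,\alpha_{j,l}(N+r_k-1))$ and $\tilde\alpha^{k,N}_{j,l}=\mathrm{diag}(\alpha_{j,l}(N-l-r_k),\dots,\alpha_{j,l}(N-l+s_k-1))$. For indices $k,j$ let $$E_{k,j}^N(x)=\alpha^{k,N}_{j,0}+\sum_{l=1}^{r_j}\alpha^{k,N}_{j,l}\,a_{k,N+l-1}\cdots a_{k,N}+\sum_{l=1}^{s_j}\alpha^{k,N}_{j,-l}\,a_{k,N-l}^{-1}\cdots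 a_{k,N-1}^{-1},$$ $$\tilde E_{k,j}^N(x)=\tilde\alpha^{k,N}_{j,0}+\sum_{l=1}^{r_j}\tilde a_{k,N}\tilde a_{k,N-1}\cdots\tilde a_{k,N-l+1}\,\tilde\alpha^{k,N}_{j,l}+\sum_{l=1}^{s_j}\tilde a_{k,N+1}^{-1}\cdots\tilde a_{k,N+l}^{-1}\,\tilde\alpha^{k,N}_{j,-l}.$$ Then $D_1^N=-E_{1,2}^N$, $\tilde D_1^N=-\tilde E_{1,2}^N$, and for $2\le k\le m$, $D_k^N=E_{k,k-1}^N$, $\tilde D_k^N=\tilde E_{k,k-1}^N$. (They satisfy $\partial_x\Psi_{k,N}=D_k^N\Psi_{k,N}$, $\partial_x\Phi_{k,N}=-\Phi_{k,N}\tilde D_k^N$.) **Christoffel–Darboux matrix.** $\mathbb A_k^N$ is the $(r_k+s_k)\times(r_k+s_k)$ matrix, with rows labelled by the indices $p=N-r_k,\dots,N+s_k-1$ of $\Phi_{k,N}$ and columns by the indices $q=N-s_k,\dots,N+r_k-1$ of $\Psi_{k,N}$, with entries: $\alpha_{k,q-p}(p)$ if $p\le N-1$, $q\ge N$ and $q-p\le r_k$; $-\alpha_{k,q-p}(p)$ if $p\ge N$, $q\le N-1$ and $p-q\le s_k$; $0$ otherwise. **Range.** $N_0:=1+\max_{2\le k\le m}\max(s_k+s_{k-1},\,r_k+r_{k-1})$, which ensures all matrices above are defined. *)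

theory Defs
  imports "HOL-Analysis.Analysis" "Jordan_Normal_Form.Gauss_Jordan_Elimination"
    "Jordan_Normal_Form.Determinant"
begin

section \<open>Integration contours\<close>

text \<open>A contour is a finite linear combination (coefficient, curve) of curves in the complex plane,
  each parametrized by the whole real line; curves of finite extent are constant outside a bounded
  interval.\<close>

type_synonym contour = "(complex \<times> (real \<Rightarrow> complex)) list"

definition contour :: "contour \<Rightarrow> bool" where
  "contour \<Gamma> \<longleftrightarrow> (\<forall>(c, \<gamma>)\<in>set \<Gamma>. \<forall>a b. \<gamma> piecewise_C1_differentiable_on {a..b})"

text \<open>A parameter is a pair (number of the curve in the list, time).\<close>

definition contour_param :: "contour \<Rightarrow> (nat \<times> real) measure" where
  "contour_param \<Gamma> = count_space {..<length \<Gamma>} \<Otimes>\<^sub>M lborel"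

definition contour_point :: "contour \<Rightarrow> nat \<times> real \<Rightarrow> complex" where
  "contour_point \<Gamma> = (\<lambda>(i, t). snd (\<Gamma> ! i) t)"

definition contour_speed :: "contour \<Rightarrow> nat \<times> real \<Rightarrow> complex" where
  "contour_speed \<Gamma> = (\<lambda>(i, t). fst (\<Gamma> ! i) * vector_derivative (snd (\<Gamma> ! i)) (at t))"

definition cint :: "contour \<Rightarrow> (complex \<Rightarrow> complex) \<Rightarrow> complex" where
  "cint \<Gamma> f = (\<integral>p. f (contour_point \<Gamma> p) * contour_speed \<Gamma> p \<partial>contour_param \<Gamma>)"

definition cconverges :: "contour \<Rightarrow> (complex \<Rightarrow> complex) \<Rightarrow> bool" where
  "cconverges \<Gamma> f \<longleftrightarrow>
     integrable (contour_param \<Gamma>) (\<lambda>p. f (contour_point \<Gamma> p) * contour_speed \<Gamma> p)"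

text \<open>The boundary term in the integral of the derivative of \<open>F\<close> along \<open>\<Gamma>\<close> is zero.\<close>

definition no_boundary_term :: "contour \<Rightarrow> (complex \<Rightarrow> complex) \<Rightarrow> bool" where
  "no_boundary_term \<Gamma> F \<longleftrightarrow>
     ((\<lambda>T. \<Sum>(c, \<gamma>)\<leftarrow>\<Gamma>. c * (F (\<gamma> T) - F (\<gamma> (- T)))) \<longlongrightarrow> 0) at_top"

definition multi_density ::
    "nat \<Rightarrow> (nat \<Rightarrow> contour) \<Rightarrow> ((nat \<Rightarrow> complex) \<Rightarrow> complex) \<Rightarrow> (nat \<Rightarrow> nat \<times> real) \<Rightarrow> complex" where
  "multi_density m \<Gamma> F p =
     F (\<lambda>k. contour_point (\<Gamma> k) (p k)) * (\<Prod>k=1..m. contour_speed (\<Gamma> k) (p k))"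

definition multi_int :: "nat \<Rightarrow> (nat \<Rightarrow> contour) \<Rightarrow> ((nat \<Rightarrow> complex) \<Rightarrow> complex) \<Rightarrow> complex" where
  "multi_int m \<Gamma> F =
     (\<integral>p. multi_density m \<Gamma> F p \<partial>(\<Pi>\<^sub>M k\<in>{1..m}. contour_param (\<Gamma> k)))"

definition multi_converges :: "nat \<Rightarrow> (nat \<Rightarrow> contour) \<Rightarrow> ((nat \<Rightarrow> complex) \<Rightarrow> complex) \<Rightarrow> bool" where
  "multi_converges m \<Gamma> F \<longleftrightarrow>
     integrable (\<Pi>\<^sub>M k\<in>{1..m}. contour_param (\<Gamma> k)) (multi_density m \<Gamma> F)"


section \<open>Biorthogonal polynomials and their transforms\<close>

definition biorth_integrand ::
    "nat \<Rightarrow> (nat \<Rightarrow> complex poly) \<Rightarrow> complex poly \<Rightarrow> complex poly \<Rightarrow> (nat \<Rightarrow> complex) \<Rightarrow> complex" where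
  "biorth_integrand m V p q x =
     (\<Prod>k=1..m. exp (- poly (V k) (x k))) * (\<Prod>k=1..m - 1. exp (x k * x (k + 1)))
       * poly p (x 1) * poly q (x m)"

text \<open>Index \<open>k\<close> runs over \<open>1..m\<close>; the value at \<open>k = 0\<close> is irrelevant. The factor
  \<open>exp (- V\<^sub>1)\<close> is part of \<open>\<psi>\<^sub>1\<close>, so it does not occur again in the transform
  defining \<open>\<psi>\<^sub>2\<close>.\<close>

primrec psi :: "(nat \<Rightarrow> contour) \<Rightarrow> (nat \<Rightarrow> complex poly) \<Rightarrow> (nat \<Rightarrow> complex poly) \<Rightarrow> (nat \<Rightarrow> complex)
    \<Rightarrow> nat \<Rightarrow> nat \<Rightarrow> complex \<Rightarrow> complex" where
  "psi \<Gamma> V \<pi> h 0 n x = 0"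
| "psi \<Gamma> V \<pi> h (Suc k) n x =
     (if k = 0 then poly (\<pi> n) x * exp (- poly (V 1) x) / csqrt (h n)
      else cint (\<Gamma> k) (\<lambda>y. psi \<Gamma> V \<pi> h k n y * exp (x * y)
                              * (if k = 1 then 1 else exp (- poly (V k) y))))"

function phi :: "nat \<Rightarrow> (nat \<Rightarrow> contour) \<Rightarrow> (nat \<Rightarrow> complex poly) \<Rightarrow> (nat \<Rightarrow> complex poly)
    \<Rightarrow> (nat \<Rightarrow> complex) \<Rightarrow> nat \<Rightarrow> nat \<Rightarrow> complex \<Rightarrow> complex" where
  "phi m \<Gamma> V \<sigma> h k n x =
     (if m \<le> k then poly (\<sigma> n) x * exp (- poly (V m) x) / csqrt (h n)
      else (if k = 1 then 1 else exp (- poly (V k) x))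
             * cint (\<Gamma> (k + 1)) (\<lambda>y. phi m \<Gamma> V \<sigma> h (k + 1) n y * exp (x * y)))"
  by pat_completeness auto
termination
  by (relation "Wellfounded.measure (\<lambda>(m, \<Gamma>, V, \<sigma>, h, k, n, x). m - k)") auto

declare phi.simps [simp del]

text \<open>All integrals of the model, i.e. the biorthogonality integrals, the transforms defining
  \<open>psi\<close> and \<open>phi\<close>, and the pairings of \<open>psi\<close> with \<open>phi\<close>, converge (absolutely).\<close>

definition all_integrals_converge :: "nat \<Rightarrow> (nat \<Rightarrow> contour) \<Rightarrow> (nat \<Rightarrow> complex poly)
    \<Rightarrow> (nat \<Rightarrow> complex poly) \<Rightarrow> (nat \<Rightarrow> complex poly) \<Rightarrow> (nat \<Rightarrow> complex) \<Rightarrow> bool" where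
  "all_integrals_converge m \<Gamma> V \<pi> \<sigma> h \<longleftrightarrow>
     (\<forall>n l. multi_converges m \<Gamma> (biorth_integrand m V (\<pi> n) (\<sigma> l))) \<and>
     (\<forall>k\<in>{1..<m}. \<forall>n x. cconverges (\<Gamma> k)
        (\<lambda>y. psi \<Gamma> V \<pi> h k n y * exp (x * y) * (if k = 1 then 1 else exp (- poly (V k) y)))) \<and>
     (\<forall>k\<in>{2..m}. \<forall>n x. cconverges (\<Gamma> k) (\<lambda>y. phi m \<Gamma> V \<sigma> h k n y * exp (x * y))) \<and>
     (\<forall>k\<in>{1..m}. \<forall>n l. cconverges (\<Gamma> k) (\<lambda>y. psi \<Gamma> V \<pi> h k n y * phi m \<Gamma> V \<sigma> h k l y))"

text \<open>The one-variable integrals above may be integrated by parts without boundary terms.\<close>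

definition no_boundary_terms :: "nat \<Rightarrow> (nat \<Rightarrow> contour) \<Rightarrow> (nat \<Rightarrow> complex poly)
    \<Rightarrow> (nat \<Rightarrow> complex poly) \<Rightarrow> (nat \<Rightarrow> complex poly) \<Rightarrow> (nat \<Rightarrow> complex) \<Rightarrow> bool" where
  "no_boundary_terms m \<Gamma> V \<pi> \<sigma> h \<longleftrightarrow>
     (\<forall>k\<in>{1..<m}. \<forall>n x. no_boundary_term (\<Gamma> k)
        (\<lambda>y. psi \<Gamma> V \<pi> h k n y * exp (x * y) * (if k = 1 then 1 else exp (- poly (V k) y)))) \<and>
     (\<forall>k\<in>{2..m}. \<forall>n x. no_boundary_term (\<Gamma> k) (\<lambda>y. phi m \<Gamma> V \<sigma> h k n y * exp (x * y))) \<and>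
     (\<forall>k\<in>{1..m}. \<forall>n l. no_boundary_term (\<Gamma> k)
        (\<lambda>y. psi \<Gamma> V \<pi> h k n y * phi m \<Gamma> V \<sigma> h k l y))"


section \<open>Multiplication matrices\<close>

text \<open>\<open>A\<close> is the row-finite matrix of multiplication by the variable in the functions
  \<open>f 0, f 1, \<dots>\<close>.\<close>

definition multiplication_matrix ::
    "(nat \<Rightarrow> complex \<Rightarrow> complex) \<Rightarrow> (nat \<Rightarrow> nat \<Rightarrow> complex) \<Rightarrow> bool" where
  "multiplication_matrix f A \<longleftrightarrow>
     (\<forall>n. finite {l. A n l \<noteq> 0}) \<and> (\<forall>n x. x * f n x = (\<Sum>l | A n l \<noteq> 0. A n l * f l x))"

definition up_width :: "(nat \<Rightarrow> complex poly) \<Rightarrow> nat \<Rightarrow> nat" where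
  "up_width V k = (\<Prod>l\<in>{1..<k}. degree (V l) - 1)"

definition down_width :: "nat \<Rightarrow> (nat \<Rightarrow> complex poly) \<Rightarrow> nat \<Rightarrow> nat" where
  "down_width m V k = (\<Prod>l\<in>{k<..m}. degree (V l) - 1)"

text \<open>\<open>band_coeff Q k l n\<close> is \<open>(Q k)\<close> at \<open>(n, n + l)\<close>, and zero if one of the indices is negative.\<close>

definition band_coeff :: "(nat \<Rightarrow> nat \<Rightarrow> nat \<Rightarrow> complex) \<Rightarrow> nat \<Rightarrow> int \<Rightarrow> int \<Rightarrow> complex" where
  "band_coeff Q k l n = (if 0 \<le> n \<and> 0 \<le> n + l then Q k (nat n) (nat (n + l)) else 0)"


section \<open>Matrices on windows\<close>

text \<open>Throughout, \<open>r\<close>, \<open>s\<close> are the band widths and \<open>\<alpha> k l n\<close> the band coefficients. Matrix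
  positions count from 0. The matrices attached to \<open>k\<close> have size \<open>r k + s k\<close>.\<close>

type_synonym bands = "nat \<Rightarrow> int \<Rightarrow> int \<Rightarrow> complex"

definition ladder :: "(nat \<Rightarrow> nat) \<Rightarrow> (nat \<Rightarrow> nat) \<Rightarrow> bands \<Rightarrow> nat \<Rightarrow> int \<Rightarrow> complex \<Rightarrow> complex mat" where
  "ladder r s \<alpha> k N x = mat (r k + s k) (r k + s k) (\<lambda>(i, j).
     if i + 1 < r k + s k then (if j = i + 1 then 1 else 0)
     else let l = int j - int (s k)
          in ((if l = 0 then x else 0) - \<alpha> k l N) / \<alpha> k (int (r k)) N)"

definition dual_ladder :: "(nat \<Rightarrow> nat) \<Rightarrow> (nat \<Rightarrow> nat) \<Rightarrow> bands \<Rightarrow> nat \<Rightarrow> int \<Rightarrow> complex \<Rightarrow> complex mat" where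
  "dual_ladder r s \<alpha> k N x = mat (r k + s k) (r k + s k) (\<lambda>(i, j).
     if j = 0 then
       let l = int (r k) - 1 - int i
       in ((if l = 0 then x else 0) - \<alpha> k l (N - 1 - l)) / \<alpha> k (int (r k)) (N - 1 - int (r k))
     else (if j = i + 1 then 1 else 0))"

definition minv :: "complex mat \<Rightarrow> complex mat" where
  "minv A = the (mat_inverse A)"

text \<open>With \<open>a\<^sub>M\<close> the ladder and \<open>b\<^sub>M\<close> the dual ladder matrix at \<open>M\<close>, the four products with \<open>l\<close>
  factors defined below are \<open>a\<^bsub>N+l-1\<^esub> \<dots> a\<^bsub>N\<^esub>\<close>, then \<open>minv a\<^bsub>N-l\<^esub> \<dots> minv a\<^bsub>N-1\<^esub>\<close>, then
  \<open>b\<^bsub>N\<^esub> \<dots> b\<^bsub>N-l+1\<^esub>\<close>, and \<open>minv b\<^bsub>N+1\<^esub> \<dots> minv b\<^bsub>N+l\<^esub>\<close>.\<close>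

primrec ladder_up :: "(nat \<Rightarrow> nat) \<Rightarrow> (nat \<Rightarrow> nat) \<Rightarrow> bands \<Rightarrow> nat \<Rightarrow> int \<Rightarrow> complex \<Rightarrow> nat \<Rightarrow> complex mat" where
  "ladder_up r s \<alpha> k N x 0 = 1\<^sub>m (r k + s k)"
| "ladder_up r s \<alpha> k N x (Suc l) = ladder r s \<alpha> k (N + int l) x * ladder_up r s \<alpha> k N x l"

primrec ladder_down :: "(nat \<Rightarrow> nat) \<Rightarrow> (nat \<Rightarrow> nat) \<Rightarrow> bands \<Rightarrow> nat \<Rightarrow> int \<Rightarrow> complex \<Rightarrow> nat \<Rightarrow> complex mat" where
  "ladder_down r s \<alpha> k N x 0 = 1\<^sub>m (r k + s k)"
| "ladder_down r s \<alpha> k N x (Suc l) =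
     minv (ladder r s \<alpha> k (N - int (Suc l)) x) * ladder_down r s \<alpha> k N x l"

primrec dual_ladder_up :: "(nat \<Rightarrow> nat) \<Rightarrow> (nat \<Rightarrow> nat) \<Rightarrow> bands \<Rightarrow> nat \<Rightarrow> int \<Rightarrow> complex \<Rightarrow> nat \<Rightarrow> complex mat" where
  "dual_ladder_up r s \<alpha> k N x 0 = 1\<^sub>m (r k + s k)"
| "dual_ladder_up r s \<alpha> k N x (Suc l) =
     dual_ladder_up r s \<alpha> k N x l * dual_ladder r s \<alpha> k (N - int l) x"

primrec dual_ladder_down :: "(nat \<Rightarrow> nat) \<Rightarrow> (nat \<Rightarrow> nat) \<Rightarrow> bands \<Rightarrow> nat \<Rightarrow> int \<Rightarrow> complex \<Rightarrow> nat \<Rightarrow> complex mat" where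
  "dual_ladder_down r s \<alpha> k N x 0 = 1\<^sub>m (r k + s k)"
| "dual_ladder_down r s \<alpha> k N x (Suc l) =
     dual_ladder_down r s \<alpha> k N x l * minv (dual_ladder r s \<alpha> k (N + int (Suc l)) x)"

definition diag_band :: "(nat \<Rightarrow> nat) \<Rightarrow> (nat \<Rightarrow> nat) \<Rightarrow> bands \<Rightarrow> nat \<Rightarrow> int \<Rightarrow> nat \<Rightarrow> int \<Rightarrow> complex mat" where
  "diag_band r s \<alpha> k N j l = mat (r k + s k) (r k + s k) (\<lambda>(i, i').
     if i = i' then \<alpha> j l (N - int (s k) + int i) else 0)"

definition dual_diag_band :: "(nat \<Rightarrow> nat) \<Rightarrow> (nat \<Rightarrow> nat) \<Rightarrow> bands \<Rightarrow> nat \<Rightarrow> int \<Rightarrow> nat \<Rightarrow> int \<Rightarrow> complex mat" where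
  "dual_diag_band r s \<alpha> k N j l = mat (r k + s k) (r k + s k) (\<lambda>(i, i').
     if i = i' then \<alpha> j l (N - l - int (r k) + int i) else 0)"

definition msum :: "nat \<Rightarrow> (nat \<Rightarrow> complex mat) \<Rightarrow> nat set \<Rightarrow> complex mat" where
  "msum n f L = mat n n (\<lambda>ij. \<Sum>l\<in>L. f l $$ ij)"

definition E_mat :: "(nat \<Rightarrow> nat) \<Rightarrow> (nat \<Rightarrow> nat) \<Rightarrow> bands \<Rightarrow> nat \<Rightarrow> nat \<Rightarrow> int \<Rightarrow> complex \<Rightarrow> complex mat" where
  "E_mat r s \<alpha> k j N x =
     diag_band r s \<alpha> k N j 0
     + msum (r k + s k) (\<lambda>l. diag_band r s \<alpha> k N j (int l) * ladder_up r s \<alpha> k N x l) {1..r j}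
     + msum (r k + s k) (\<lambda>l. diag_band r s \<alpha> k N j (- int l) * ladder_down r s \<alpha> k N x l) {1..s j}"

definition dual_E_mat :: "(nat \<Rightarrow> nat) \<Rightarrow> (nat \<Rightarrow> nat) \<Rightarrow> bands \<Rightarrow> nat \<Rightarrow> nat \<Rightarrow> int \<Rightarrow> complex \<Rightarrow> complex mat" where
  "dual_E_mat r s \<alpha> k j N x =
     dual_diag_band r s \<alpha> k N j 0
     + msum (r k + s k)
         (\<lambda>l. dual_ladder_up r s \<alpha> k N x l * dual_diag_band r s \<alpha> k N j (int l)) {1..r j}
     + msum (r k + s k)
         (\<lambda>l. dual_ladder_down r s \<alpha> k N x l * dual_diag_band r s \<alpha> k N j (- int l)) {1..s j}"

definition D_mat :: "(nat \<Rightarrow> nat) \<Rightarrow> (nat \<Rightarrow> nat) \<Rightarrow> bands \<Rightarrow> nat \<Rightarrow> int \<Rightarrow> complex \<Rightarrow> complex mat" where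
  "D_mat r s \<alpha> k N x = (if k = 1 then - E_mat r s \<alpha> 1 2 N x else E_mat r s \<alpha> k (k - 1) N x)"

definition dual_D_mat :: "(nat \<Rightarrow> nat) \<Rightarrow> (nat \<Rightarrow> nat) \<Rightarrow> bands \<Rightarrow> nat \<Rightarrow> int \<Rightarrow> complex \<Rightarrow> complex mat" where
  "dual_D_mat r s \<alpha> k N x =
     (if k = 1 then - dual_E_mat r s \<alpha> 1 2 N x else dual_E_mat r s \<alpha> k (k - 1) N x)"

definition CD_mat :: "(nat \<Rightarrow> nat) \<Rightarrow> (nat \<Rightarrow> nat) \<Rightarrow> bands \<Rightarrow> nat \<Rightarrow> int \<Rightarrow> complex mat" where
  "CD_mat r s \<alpha> k N = mat (r k + s k) (r k + s k) (\<lambda>(i, j).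
     let p = N - int (r k) + int i; q = N - int (s k) + int j in
     if p \<le> N - 1 \<and> q \<ge> N \<and> q - p \<le> int (r k) then \<alpha> k (q - p) p
     else if p \<ge> N \<and> q \<le> N - 1 \<and> p - q \<le> int (s k) then - \<alpha> k (q - p) p
     else 0)"

end

theory Submission
  imports Defs
begin

text \<open>On polynomials \<open>p\<close>, let \<open>X\<^sub>0\<close> be the derivative, \<open>X\<^sub>1\<close> multiplication by the variable and
  \<open>X\<^bsub>k+1\<^esub> = V\<^sub>k'(X\<^sub>k) - X\<^bsub>k-1\<^esub>\<close>. If \<open>\<Psi>\<^sub>k p\<close> denotes \<open>p exp (- V\<^sub>1)\<close> transformed \<open>k - 1\<close> times, then
  integration by parts and differentiation under the integral sign give
  \<open>x \<cdot> \<Psi>\<^sub>k p = \<Psi>\<^sub>k (X\<^sub>k p)\<close>; so \<open>Q\<^sub>k\<close> is the matrix of \<open>X\<^sub>k\<close> in the basis \<open>\<pi>\<^sub>n\<close>, and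
  \<open>[X\<^bsub>k-1\<^esub>, X\<^sub>k] = 1\<close> holds by construction. Degrees bound the upper band; the adjoint operators
  with respect to the pairing \<open>\<integral> \<Psi>\<^sub>m(p) q exp (- V\<^sub>m)\<close>, which Fubini identifies with the given
  biorthogonality, bound the lower band.

  The differential matrices act on windows of local solutions of \<open>Q\<^sub>k f = x f\<close> by \<open>f \<mapsto> Q\<^sub>j f\<close> with
  \<open>j = k \<plusminus> 1\<close>. Part (a) is then a Jacobi identity for \<open>Q\<^sub>j\<close>, \<open>Q\<^sub>k\<close> and the projection onto the
  indices below \<open>N\<close>. For part (b), the rows of \<open>x - Q\<^sub>k\<close> at the window of \<open>j\<close> and the rows of
  \<open>y - Q\<^sub>j\<close> at the window of \<open>k\<close> form a square matrix; eliminating by either group of rows gives both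
  characteristic polynomials, up to products of extreme coefficients.\<close>

text \<open>The window matrices are not compared on the functions \<psi> themselves: nothing says
  that windows of \<psi> span, whereas local solutions take any prescribed window, because the
  recurrence can be continued both ways wherever its extreme coefficients do not vanish. Matrix
  identities are checked on solutions with unit windows, and \<open>N\<close> only has to keep the
  continued rows in that region. The joint determinant compares \<open>E_mat\<close> for (k, k + 1)
  with \<open>E_mat\<close> for (k + 1, k), but \<open>D_mat\<close> at k is built from k - 1. On
  solutions of Q_k the relation Q_{k+1} = V_k'(Q_k) - Q_{k-1} exchanges the two and produces the
  term V_k'(x). On the analytic side the hypotheses speak of basis polynomials only. They extend by
  linearity, and convergence for every exponent x supplies the domination needed to differentiate
  under the integral. The given Q_k is known only through its action on the \<psi>; it is the matrix
  of X_k because a polynomial whose k-th transform vanishes pairs to zero with all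
  polynomials.\<close>

unbundle no vec_syntax
hide_const (open) Module.smult

section \<open>Ladder matrices and local solutions\<close>

definition window :: "(nat \<Rightarrow> nat) \<Rightarrow> (nat \<Rightarrow> nat) \<Rightarrow> nat \<Rightarrow> int \<Rightarrow> (int \<Rightarrow> complex) \<Rightarrow> complex vec" where
  "window r s k N f = vec (r k + s k) (\<lambda>i. f (N - int (s k) + int i))"

definition band_mult :: "(nat \<Rightarrow> nat) \<Rightarrow> (nat \<Rightarrow> nat) \<Rightarrow> bands \<Rightarrow> nat \<Rightarrow> (int \<Rightarrow> complex) \<Rightarrow> int \<Rightarrow> complex" where
  "band_mult r s \<alpha> k f n = (\<Sum>l\<in>{- int (s k)..int (r k)}. \<alpha> k l n * f (n + l))"

text \<open>The equation is imposed on the rows in \<open>I\<close> only and \<open>f\<close> lives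
  on all of \<open>int\<close>, so a solution is a formal recurrence sequence and need not come from
  functions of \<open>x\<close>.\<close>

definition solves :: "(nat \<Rightarrow> nat) \<Rightarrow> (nat \<Rightarrow> nat) \<Rightarrow> bands \<Rightarrow> nat \<Rightarrow> complex \<Rightarrow> int set \<Rightarrow> (int \<Rightarrow> complex) \<Rightarrow> bool" where
  "solves r s \<alpha> k x I f \<longleftrightarrow> (\<forall>n\<in>I. band_mult r s \<alpha> k f n = x * f n)"

text \<open>On these rows the recurrence can be solved for its highest and for its lowest term. This
  allows continuation in both directions and makes the ladder matrices invertible.\<close>

definition regular :: "(nat \<Rightarrow> nat) \<Rightarrow> (nat \<Rightarrow> nat) \<Rightarrow> bands \<Rightarrow> nat \<Rightarrow> int set \<Rightarrow> bool" where
  "regular r s \<alpha> k I \<longleftrightarrow> 0 < r k \<and> 0 < s k \<and>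
     (\<forall>n\<in>I. \<alpha> k (int (r k)) n \<noteq> 0 \<and> \<alpha> k (- int (s k)) n \<noteq> 0)"

lemma dim_window [simp]: "dim_vec (window r s k N f) = r k + s k"
  by (simp add: window_def)

lemma window_carrier [simp]: "window r s k N f \<in> carrier_vec (r k + s k)"
  by (simp add: window_def)

lemma window_cong:
  "(\<And>n. n \<in> {N - int (s k)..<N + int (r k)} \<Longrightarrow> f n = g n) \<Longrightarrow> window r s k N f = window r s k N g"
  by (auto simp: window_def intro!: eq_vecI)

lemma mult_mat_vec_nth:
  assumes "A \<in> carrier_mat n m" "v \<in> carrier_vec m" "i < n"
  shows "(A *\<^sub>v v) $ i = (\<Sum>j<m. A $$ (i, j) * v $ j)"
  using assms by (auto simp: scalar_prod_def atLeast0LessThan intro!: sum.cong)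

lemma sum_band_shift:
  fixes g :: "int \<Rightarrow> 'a :: comm_monoid_add"
  shows "(\<Sum>l\<in>{- int s..<int r}. g l) = (\<Sum>j<r + s. g (int j - int s))"
  by (rule sum.reindex_bij_witness[of _ "\<lambda>j. int j - int s" "\<lambda>l. nat (l + int s)"]) auto

lemma atLeastAtMost_split_top: "{- int s..int r} = insert (int r) {- int s..<int r}"
  by auto

lemma atLeastAtMost_split_bot: "{- int s..int r} = insert (- int s) {- int s<..int r}"
  by auto

section \<open>Ladder matrices as shifts of windows of solutions\<close>

lemma ladder_carrier [simp]: "ladder r s \<alpha> k N x \<in> carrier_mat (r k + s k) (r k + s k)"
  and dim_ladder [simp]: "dim_row (ladder r s \<alpha> k N x) = r k + s k"
    "dim_col (ladder r s \<alpha> k N x) = r k + s k"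
  by (simp_all add: ladder_def)

lemma ladder_mult_vec_shift:
  assumes "v \<in> carrier_vec (r k + s k)" "i + 1 < r k + s k"
  shows "(ladder r s \<alpha> k N x *\<^sub>v v) $ i = v $ (i + 1)"
proof -
  have "(ladder r s \<alpha> k N x *\<^sub>v v) $ i
      = (\<Sum>j\<in>{0..<r k + s k}. (if j = i + 1 then 1 else 0) * v $ j)"
    using assms by (auto simp: mult_mat_vec_def scalar_prod_def ladder_def intro!: sum.cong)
  also have "\<dots> = v $ (i + 1)"
    using assms by (subst sum.remove[of _ "i + 1"]) auto
  finally show ?thesis .
qed

lemma ladder_mult_vec_last:
  assumes "v \<in> carrier_vec (r k + s k)" "i + 1 = r k + s k"
  shows "(ladder r s \<alpha> k N x *\<^sub>v v) $ i
     = (\<Sum>j<r k + s k. ((if j = s k then x else 0) - \<alpha> k (int j - int (s k)) N) * v $ j)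
         / \<alpha> k (int (r k)) N"
proof -
  have "(ladder r s \<alpha> k N x *\<^sub>v v) $ i
      = (\<Sum>j\<in>{0..<r k + s k}. ((if j = s k then x else 0) - \<alpha> k (int j - int (s k)) N)
            / \<alpha> k (int (r k)) N * v $ j)"
    using assms by (auto simp: mult_mat_vec_def scalar_prod_def ladder_def Let_def intro!: sum.cong)
  then show ?thesis
    by (simp add: sum_divide_distrib atLeast0LessThan)
qed

lemma ladder_window:
  assumes nz: "0 < r k" "\<alpha> k (int (r k)) N \<noteq> 0" and sol: "band_mult r s \<alpha> k f N = x * f N"
  shows "ladder r s \<alpha> k N x *\<^sub>v window r s k N f = window r s k (N + 1) f"
proof (rule eq_vecI)
  fix i assume "i < dim_vec (window r s k (N + 1) f)"
  then have i: "i < r k + s k" by simp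
  show "(ladder r s \<alpha> k N x *\<^sub>v window r s k N f) $ i = window r s k (N + 1) f $ i"
  proof (cases "i + 1 < r k + s k")
    case True
    then show ?thesis
      by (subst ladder_mult_vec_shift) (simp_all add: window_def algebra_simps)
  next
    case False
    with i have i1: "i + 1 = r k + s k" by simp
    have "(\<Sum>j<r k + s k. ((if j = s k then x else 0) - \<alpha> k (int j - int (s k)) N) * window r s k N f $ j)
       = (\<Sum>j<r k + s k. (if j = s k then x * f N else 0)
            - \<alpha> k (int j - int (s k)) N * f (N + (int j - int (s k))))"
      by (intro sum.cong refl) (simp add: window_def algebra_simps)
    also have "\<dots> = x * f N - (\<Sum>l\<in>{- int (s k)..<int (r k)}. \<alpha> k l N * f (N + l))"
      using nz by (simp add: sum_subtractf sum_band_shift)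
    also have "\<dots> = \<alpha> k (int (r k)) N * f (N + int (r k))"
      using sol unfolding band_mult_def atLeastAtMost_split_top by (simp add: algebra_simps)
    also have "f (N + int (r k)) = window r s k (N + 1) f $ i"
    proof -
      have "N + int (r k) = N + 1 - int (s k) + int i" using i1 by linarith
      then show ?thesis using i unfolding window_def by (simp only: index_vec)
    qed
    finally show ?thesis
      using nz by (subst ladder_mult_vec_last) (use i1 in auto)
  qed
qed auto

lemma minv_inverse:
  assumes A: "A \<in> carrier_mat n n" and d: "det A \<noteq> 0"
  shows "minv A \<in> carrier_mat n n" "A * minv A = 1\<^sub>m n" "minv A * A = 1\<^sub>m n"
proof -
  obtain B where "mat_inverse A = Some B"
    using mat_inverse(1)[OF A, of "()"] det_non_zero_imp_unit[OF A d, of "()"] by (cases "mat_inverse A") auto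
  with mat_inverse(2)[OF A this]
  show "minv A \<in> carrier_mat n n" "A * minv A = 1\<^sub>m n" "minv A * A = 1\<^sub>m n"
    by (auto simp: minv_def)
qed

text \<open>On a kernel vector the superdiagonal kills every entry except the first; the last row
  then reduces to the lowest coefficient times the first entry, so the vector is zero.\<close>

lemma det_ladder:
  assumes "0 < r k" "0 < s k" "\<alpha> k (int (r k)) N \<noteq> 0" "\<alpha> k (- int (s k)) N \<noteq> 0"
  shows "det (ladder r s \<alpha> k N x) \<noteq> 0"
proof
  assume "det (ladder r s \<alpha> k N x) = 0"
  then obtain v where v: "v \<in> carrier_vec (r k + s k)" "v \<noteq> 0\<^sub>v (r k + s k)"
      "ladder r s \<alpha> k N x *\<^sub>v v = 0\<^sub>v (r k + s k)"
    using det_0_iff_vec_prod_zero[OF ladder_carrier] by blast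
  have pos: "v $ j = 0" if "0 < j" "j < r k + s k" for j
    using ladder_mult_vec_shift[where r = r and s = s and k = k and i = "j - 1", OF v(1)] that v(3)
    by (metis Suc_eq_plus1 Suc_diff_1 add_lessD1 index_zero_vec(1) less_imp_diff_less)
  have "(ladder r s \<alpha> k N x *\<^sub>v v) $ (r k + s k - 1)
     = (\<Sum>j<r k + s k. ((if j = s k then x else 0) - \<alpha> k (int j - int (s k)) N) * v $ j)
         / \<alpha> k (int (r k)) N"
    using assms by (intro ladder_mult_vec_last v) auto
  \<comment> \<open>Only column 0 is left, and \<open>0 < s k\<close> keeps it apart from the column
    \<open>s k\<close> that carries \<open>x\<close>; so the matrix is nonsingular for every
    \<open>x\<close>.\<close>
  also have "(\<Sum>j<r k + s k. ((if j = s k then x else 0) - \<alpha> k (int j - int (s k)) N) * v $ j)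
      = - \<alpha> k (- int (s k)) N * v $ 0"
    using assms by (subst sum.remove[of _ 0]) (auto simp: pos)
  finally have "v $ 0 = 0" using v(3) assms by auto
  then have "v = 0\<^sub>v (r k + s k)"
    using v(1) pos by (intro eq_vecI) (auto, metis gr0I)
  with v(2) show False by simp
qed

lemma minv_ladder_window:
  assumes "regular r s \<alpha> k {N}" "band_mult r s \<alpha> k f N = x * f N"
  shows "minv (ladder r s \<alpha> k N x) *\<^sub>v window r s k (N + 1) f = window r s k N f"
proof -
  let ?A = "ladder r s \<alpha> k N x"
  have d: "det ?A \<noteq> 0" using assms by (intro det_ladder) (auto simp: regular_def)
  have "minv ?A *\<^sub>v window r s k (N + 1) f = minv ?A *\<^sub>v (?A *\<^sub>v window r s k N f)"
    using assms by (subst ladder_window) (auto simp: regular_def)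
  also have "\<dots> = (minv ?A * ?A) *\<^sub>v window r s k N f"
    using assoc_mult_mat_vec[of "minv ?A" "r k + s k" "r k + s k" ?A "r k + s k" "window r s k N f"]
      minv_inverse(1)[OF ladder_carrier d] by simp
  also have "\<dots> = window r s k N f"
    using minv_inverse(3)[OF ladder_carrier d] by simp
  finally show ?thesis .
qed

lemma ladder_up_carrier [simp]: "ladder_up r s \<alpha> k N x l \<in> carrier_mat (r k + s k) (r k + s k)"
  by (induction l) (auto intro: mult_carrier_mat[OF ladder_carrier])

lemma ladder_down_carrier:
  assumes "regular r s \<alpha> k {N - int l..<N}"
  shows "ladder_down r s \<alpha> k N x l \<in> carrier_mat (r k + s k) (r k + s k)"
  using assms
proof (induction l)
  case (Suc l)
  have "ladder_down r s \<alpha> k N x l \<in> carrier_mat (r k + s k) (r k + s k)"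
    by (rule Suc.IH) (use Suc.prems in \<open>auto simp: regular_def\<close>)
  moreover have "det (ladder r s \<alpha> k (N - int (Suc l)) x) \<noteq> 0"
    by (rule det_ladder) (use Suc.prems in \<open>auto simp: regular_def\<close>)
  from minv_inverse(1)[OF ladder_carrier this]
  have "minv (ladder r s \<alpha> k (N - int (Suc l)) x) \<in> carrier_mat (r k + s k) (r k + s k)" .
  ultimately show ?case by (simp del: of_nat_Suc)
qed auto

lemma ladder_up_window:
  assumes "regular r s \<alpha> k {N..<N + int l}" "solves r s \<alpha> k x {N..<N + int l} f"
  shows "ladder_up r s \<alpha> k N x l *\<^sub>v window r s k N f = window r s k (N + int l) f"
  using assms
proof (induction l)
  case (Suc l)
  have IH: "ladder_up r s \<alpha> k N x l *\<^sub>v window r s k N f = window r s k (N + int l) f"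
    by (rule Suc.IH) (use Suc.prems in \<open>auto simp: regular_def solves_def\<close>)
  have "ladder_up r s \<alpha> k N x (Suc l) *\<^sub>v window r s k N f
     = ladder r s \<alpha> k (N + int l) x *\<^sub>v (ladder_up r s \<alpha> k N x l *\<^sub>v window r s k N f)"
    by (simp add: assoc_mult_mat_vec[OF ladder_carrier ladder_up_carrier])
  also have "\<dots> = window r s k (N + int l + 1) f"
    unfolding IH by (rule ladder_window) (use Suc.prems in \<open>auto simp: regular_def solves_def\<close>)
  finally show ?case by (simp add: algebra_simps)
qed auto

lemma ladder_down_window:
  assumes "regular r s \<alpha> k {N - int l..<N}" "solves r s \<alpha> k x {N - int l..<N} f"
  shows "ladder_down r s \<alpha> k N x l *\<^sub>v window r s k N f = window r s k (N - int l) f"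
  using assms
proof (induction l)
  case (Suc l)
  let ?A = "ladder r s \<alpha> k (N - int (Suc l)) x"
  have reg: "regular r s \<alpha> k {N - int l..<N}"
    using Suc.prems by (auto simp: regular_def)
  have IH: "ladder_down r s \<alpha> k N x l *\<^sub>v window r s k N f = window r s k (N - int l) f"
    by (rule Suc.IH) (use Suc.prems in \<open>auto simp: regular_def solves_def\<close>)
  have d: "det ?A \<noteq> 0"
    by (rule det_ladder) (use Suc.prems in \<open>auto simp: regular_def\<close>)
  have "ladder_down r s \<alpha> k N x (Suc l) *\<^sub>v window r s k N f
     = minv ?A *\<^sub>v (ladder_down r s \<alpha> k N x l *\<^sub>v window r s k N f)"
    unfolding ladder_down.simps
    using assoc_mult_mat_vec[of "minv ?A" "r k + s k" "r k + s k" "ladder_down r s \<alpha> k N x l" "r k + s k"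
        "window r s k N f"] minv_inverse(1)[OF ladder_carrier d] ladder_down_carrier[OF reg]
    by (simp del: of_nat_Suc)
  also have "\<dots> = minv ?A *\<^sub>v window r s k (N - int (Suc l) + 1) f"
    unfolding IH by simp
  also have "\<dots> = window r s k (N - int (Suc l)) f"
    by (rule minv_ladder_window) (use Suc.prems in \<open>auto simp: regular_def solves_def\<close>)
  finally show ?case .
qed auto

section \<open>The matrices \<open>E_mat\<close> as the action of a second band operator on
  windows\<close>

lemma diag_band_carrier [simp]: "diag_band r s \<alpha> k N j l \<in> carrier_mat (r k + s k) (r k + s k)"
  by (simp add: diag_band_def)

lemma diag_band_window:
  "diag_band r s \<alpha> k N j l *\<^sub>v window r s k (N + l) f = window r s k N (\<lambda>n. \<alpha> j l n * f (n + l))"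
proof (rule eq_vecI)
  fix i assume "i < dim_vec (window r s k N (\<lambda>n. \<alpha> j l n * f (n + l)))"
  then have i: "i < r k + s k" by simp
  have "(diag_band r s \<alpha> k N j l *\<^sub>v window r s k (N + l) f) $ i
      = (\<Sum>i'<r k + s k. diag_band r s \<alpha> k N j l $$ (i, i') * window r s k (N + l) f $ i')"
    using i by (intro mult_mat_vec_nth) auto
  also have "\<dots>
     = (\<Sum>i'<r k + s k. if i' = i then window r s k N (\<lambda>n. \<alpha> j l n * f (n + l)) $ i else 0)"
    using i by (intro sum.cong refl) (auto simp: diag_band_def window_def algebra_simps)
  also have "\<dots> = window r s k N (\<lambda>n. \<alpha> j l n * f (n + l)) $ i"
    using i by simp
  finally show "(diag_band r s \<alpha> k N j l *\<^sub>v window r s k (N + l) f) $ i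
     = window r s k N (\<lambda>n. \<alpha> j l n * f (n + l)) $ i" .
qed (simp add: diag_band_def)

lemma msum_carrier [simp]: "msum n F L \<in> carrier_mat n n"
  by (simp add: msum_def)

lemma msum_mult_window:
  assumes "\<And>l. l \<in> L \<Longrightarrow> F l \<in> carrier_mat (r k + s k) (r k + s k)"
    and "\<And>l. l \<in> L \<Longrightarrow> F l *\<^sub>v w = window r s k N (g l)" and w: "w \<in> carrier_vec (r k + s k)"
  shows "msum (r k + s k) F L *\<^sub>v w = window r s k N (\<lambda>n. \<Sum>l\<in>L. g l n)"
proof (rule eq_vecI)
  fix i assume "i < dim_vec (window r s k N (\<lambda>n. \<Sum>l\<in>L. g l n))"
  then have i: "i < r k + s k" by simp
  have "(msum (r k + s k) F L *\<^sub>v w) $ i = (\<Sum>j\<in>{0..<r k + s k}. (\<Sum>l\<in>L. F l $$ (i, j)) * w $ j)"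
    using i w by (auto simp: mult_mat_vec_def scalar_prod_def msum_def intro!: sum.cong)
  also have "\<dots> = (\<Sum>l\<in>L. \<Sum>j\<in>{0..<r k + s k}. F l $$ (i, j) * w $ j)"
    by (subst sum.swap) (simp add: sum_distrib_right)
  also have "\<dots> = (\<Sum>l\<in>L. (F l *\<^sub>v w) $ i)"
    by (intro sum.cong refl) (subst mult_mat_vec_nth[OF assms(1) w i], auto simp: atLeast0LessThan)
  also have "\<dots> = (\<Sum>l\<in>L. window r s k N (g l) $ i)"
    using assms(2) by (intro sum.cong refl) simp
  finally show "(msum (r k + s k) F L *\<^sub>v w) $ i = window r s k N (\<lambda>n. \<Sum>l\<in>L. g l n) $ i"
    using i by (simp add: window_def)
qed (simp add: msum_def)

lemma E_mat_carrier [simp]: "E_mat r s \<alpha> k j N x \<in> carrier_mat (r k + s k) (r k + s k)"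
  and dim_E_mat [simp]: "dim_row (E_mat r s \<alpha> k j N x) = r k + s k"
    "dim_col (E_mat r s \<alpha> k j N x) = r k + s k"
  by (simp_all add: E_mat_def msum_def)

text \<open>A product of \<open>l\<close> ladder matrices moves the window by \<open>l\<close>, and
  the diagonal factor supplies the coefficients of that band; summing over the bands gives the
  action of operator \<open>j\<close>. The rows asked of \<open>f\<close> are exactly those crossed
  when the window moves up by \<open>r j\<close> and down by \<open>s j\<close>.\<close>

lemma E_mat_window:
  assumes reg: "regular r s \<alpha> k {N - int (s j)..<N + int (r j)}"
    and sol: "solves r s \<alpha> k x {N - int (s j)..<N + int (r j)} f"
  shows "E_mat r s \<alpha> k j N x *\<^sub>v window r s k N f = window r s k N (band_mult r s \<alpha> j f)"
proof -
  let ?w = "window r s k N f"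
  have up: "diag_band r s \<alpha> k N j (int l) * ladder_up r s \<alpha> k N x l *\<^sub>v ?w
      = window r s k N (\<lambda>n. \<alpha> j (int l) n * f (n + int l))" if "l \<in> {1..r j}" for l
  proof -
    have "ladder_up r s \<alpha> k N x l *\<^sub>v ?w = window r s k (N + int l) f"
      by (rule ladder_up_window) (use reg sol that in \<open>auto simp: regular_def solves_def\<close>)
    then show ?thesis
      by (simp add: assoc_mult_mat_vec[OF diag_band_carrier ladder_up_carrier] diag_band_window)
  qed
  have down_c: "ladder_down r s \<alpha> k N x l \<in> carrier_mat (r k + s k) (r k + s k)" if "l \<in> {1..s j}" for l
    by (rule ladder_down_carrier) (use reg that in \<open>auto simp: regular_def\<close>)
  have down: "diag_band r s \<alpha> k N j (- int l) * ladder_down r s \<alpha> k N x l *\<^sub>v ?w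
      = window r s k N (\<lambda>n. \<alpha> j (- int l) n * f (n + - int l))" if "l \<in> {1..s j}" for l
  proof -
    have "ladder_down r s \<alpha> k N x l *\<^sub>v ?w = window r s k (N + - int l) f"
      by (subst ladder_down_window) (use reg sol that in \<open>auto simp: regular_def solves_def\<close>)
    then show ?thesis
      using down_c[OF that]
      by (simp add: assoc_mult_mat_vec[OF diag_band_carrier] diag_band_window del: add_uminus_conv_diff)
  qed
  have split: "{- int (s j)..int (r j)} = insert 0 (int ` {1..r j} \<union> (\<lambda>l. - int l) ` {1..s j})"
    (is "?L = ?R")
  proof
    show "?L \<subseteq> ?R"
    proof
      fix l assume l: "l \<in> ?L"
      show "l \<in> ?R"
      proof (cases "l > 0")
        case True
        then have "l = int (nat l)" "nat l \<in> {1..r j}" using l by auto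
        then show ?thesis by blast
      next
        case False
        show ?thesis
        proof (cases "l = 0")
          case False
          then have "l = - int (nat (- l))" "nat (- l) \<in> {1..s j}" using l \<open>\<not> l > 0\<close> by auto
          then show ?thesis by blast
        qed simp
      qed
    qed
  qed auto
  have disj: "int ` {Suc 0..r j} \<inter> (\<lambda>l. - int l) ` {Suc 0..s j} = {}"
    by auto
  have "E_mat r s \<alpha> k j N x *\<^sub>v ?w
     = diag_band r s \<alpha> k N j 0 *\<^sub>v ?w
       + msum (r k + s k) (\<lambda>l. diag_band r s \<alpha> k N j (int l) * ladder_up r s \<alpha> k N x l) {1..r j} *\<^sub>v ?w
       + msum (r k + s k) (\<lambda>l. diag_band r s \<alpha> k N j (- int l) * ladder_down r s \<alpha> k N x l) {1..s j} *\<^sub>v ?w"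
    unfolding E_mat_def
    by (simp add: add_mult_distrib_mat_vec[where nr = "r k + s k" and nc = "r k + s k"])
  also have "\<dots> = window r s k N (\<lambda>n. \<alpha> j 0 n * f n)
       + window r s k N (\<lambda>n. \<Sum>l\<in>{1..r j}. \<alpha> j (int l) n * f (n + int l))
       + window r s k N (\<lambda>n. \<Sum>l\<in>{1..s j}. \<alpha> j (- int l) n * f (n + - int l))"
    using diag_band_window[of r s \<alpha> k N j 0 f]
    by (intro arg_cong2[where f = "(+)"] msum_mult_window up down)
       (auto intro!: mult_carrier_mat[OF diag_band_carrier] down_c)
  also have "\<dots> = window r s k N (band_mult r s \<alpha> j f)"
    unfolding band_mult_def split
    by (intro eq_vecI)
       (auto simp: window_def sum.union_disjoint[OF finite_imageI finite_imageI disj] sum.reindex inj_on_def image_iff)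
  finally show ?thesis .
qed

text \<open>A window is a full set of initial data for a recurrence of order
  \<open>r k + s k\<close>. Since it can be any vector, an identity between matrices acting on
  windows may be tested on solutions with unit windows.\<close>

lemma local_solution_exists:
  assumes v: "v \<in> carrier_vec (r k + s k)" and reg: "regular r s \<alpha> k {N - int p..<N + int q}"
  shows "\<exists>f. window r s k N f = v \<and> solves r s \<alpha> k x {N - int p..<N + int q} f"
proof -
  have up: "\<exists>f. window r s k N f = v \<and> solves r s \<alpha> k x {N..<N + int t} f" if "t \<le> q" for t
    using that
  proof (induction t)
    case 0
    show ?case
      by (rule exI[of _ "\<lambda>n. v $ nat (n - N + int (s k))"])
         (use v in \<open>auto simp: window_def solves_def intro!: eq_vecI\<close>)
  next
    case (Suc t)
    then obtain f where f: "window r s k N f = v" "solves r s \<alpha> k x {N..<N + int t} f" by auto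
    let ?M = "N + int t"
    define c where "c = (x * f ?M - (\<Sum>l\<in>{- int (s k)..<int (r k)}. \<alpha> k l ?M * f (?M + l)))
                         / \<alpha> k (int (r k)) ?M"
    \<comment> \<open>The changed index lies above the window and above every index used by the rows
      before \<open>?M\<close>, so the earlier equations survive.\<close>
    define g where "g = f (?M + int (r k) := c)"
    have nz: "\<alpha> k (int (r k)) ?M \<noteq> 0" "0 < r k"
      using reg Suc.prems by (auto simp: regular_def)
    have "band_mult r s \<alpha> k g n = x * g n" if n: "n \<in> {N..<N + int (Suc t)}" for n
    proof (cases "n = ?M")
      case True
      have "(\<Sum>l\<in>{- int (s k)..<int (r k)}. \<alpha> k l ?M * g (?M + l))
          = (\<Sum>l\<in>{- int (s k)..<int (r k)}. \<alpha> k l ?M * f (?M + l))"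
        by (intro sum.cong) (auto simp: g_def)
      then show ?thesis
        using nz True unfolding band_mult_def atLeastAtMost_split_top
        by (simp add: g_def c_def)
    next
      case False
      then have "band_mult r s \<alpha> k g n = band_mult r s \<alpha> k f n" "g n = f n"
        using n nz by (auto simp: band_mult_def g_def intro!: sum.cong)
      then show ?thesis using f(2) n False by (auto simp: solves_def)
    qed
    moreover have "window r s k N g = v"
      unfolding f(1)[symmetric] by (rule window_cong) (auto simp: g_def)
    ultimately show ?case by (auto simp: solves_def)
  qed
  have "\<exists>f. window r s k N f = v \<and> solves r s \<alpha> k x {N - int t..<N + int q} f" if "t \<le> p" for t
    using that
  proof (induction t)
    case 0
    then show ?case using up[of q] by simp
  next
    case (Suc t)
    then obtain f where f: "window r s k N f = v" "solves r s \<alpha> k x {N - int t..<N + int q} f" by auto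
    let ?M = "N - int (Suc t)"
    define c where "c = (x * f ?M - (\<Sum>l\<in>{- int (s k)<..int (r k)}. \<alpha> k l ?M * f (?M + l)))
                         / \<alpha> k (- int (s k)) ?M"
    define g where "g = f (?M - int (s k) := c)"
    have nz: "\<alpha> k (- int (s k)) ?M \<noteq> 0" "0 < s k"
      using reg Suc.prems by (auto simp: regular_def)
    have "band_mult r s \<alpha> k g n = x * g n" if n: "n \<in> {N - int (Suc t)..<N + int q}" for n
    proof (cases "n = ?M")
      case True
      have "(\<Sum>l\<in>{- int (s k)<..int (r k)}. \<alpha> k l ?M * g (?M + l))
          = (\<Sum>l\<in>{- int (s k)<..int (r k)}. \<alpha> k l ?M * f (?M + l))"
        by (intro sum.cong) (auto simp: g_def)
      then show ?thesis
        using nz True unfolding band_mult_def atLeastAtMost_split_bot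
        by (simp add: g_def c_def del: of_nat_Suc)
    next
      case False
      then have "band_mult r s \<alpha> k g n = band_mult r s \<alpha> k f n" "g n = f n"
        using n nz by (auto simp: band_mult_def g_def intro!: sum.cong)
      then show ?thesis using f(2) n False by (auto simp: solves_def)
    qed
    moreover have "window r s k N g = v"
      unfolding f(1)[symmetric] by (rule window_cong) (auto simp: g_def)
    ultimately show ?case by (auto simp: solves_def)
  qed
  from this[of p] show ?thesis by simp
qed

section \<open>The joint determinant of two band operators\<close>

text \<open>The factor is the sign of the permutation between the two enumerations. It is quantified
  before \<open>g\<close>, which makes it independent of the spectral parameters once
  \<open>g\<close> is specialised.\<close>

lemma det_relabel_rows:
  assumes "bij_betw \<rho> {0..<n} R" "bij_betw \<rho>' {0..<n} R"
  shows "\<exists>\<epsilon> :: complex. \<epsilon> \<noteq> 0 \<and> (\<forall>g :: 'r \<Rightarrow> nat \<Rightarrow> complex.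
           det (mat n n (\<lambda>(i, j). g (\<rho> i) j)) = \<epsilon> * det (mat n n (\<lambda>(i, j). g (\<rho>' i) j)))"
proof -
  define p where "p = (\<lambda>i. if i < n then inv_into {0..<n} \<rho>' (\<rho> i) else i)"
  have "bij_betw (inv_into {0..<n} \<rho>' \<circ> \<rho>) {0..<n} {0..<n}"
    by (rule bij_betw_trans[OF assms(1) bij_betw_inv_into[OF assms(2)]])
  then have "bij_betw p {0..<n} {0..<n}"
    by (rule iffD1[OF bij_betw_cong, rotated]) (simp add: p_def)
  then have perm: "p permutes {0..<n}"
    by (rule bij_imp_permutes) (auto simp: p_def)
  have rho: "\<rho>' (p i) = \<rho> i" "p i < n" if "i < n" for i
  proof -
    have "\<rho> i \<in> R" using assms(1) that by (auto simp: bij_betw_def)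
    then show "\<rho>' (p i) = \<rho> i"
      using bij_betw_inv_into_right[OF assms(2)] that by (simp add: p_def)
    show "p i < n" using permutes_in_image[OF perm, of i] that by simp
  qed
  show ?thesis
  proof (intro exI[of _ "signof p"] conjI allI)
    show "signof p \<noteq> (0 :: complex)" by (simp add: sign_def)
    fix g :: "'r \<Rightarrow> nat \<Rightarrow> complex"
    let ?A = "mat n n (\<lambda>(i, j). g (\<rho>' i) j)"
    have "mat n n (\<lambda>(i, j). g (\<rho> i) j) = mat n n (\<lambda>(i, j). ?A $$ (p i, j))"
      using rho by (intro eq_matI) auto
    then show "det (mat n n (\<lambda>(i, j). g (\<rho> i) j)) = signof p * det ?A"
      using det_permute_rows[OF _ perm, of ?A] by simp
  qed
qed

lemma det_relabel:
  assumes "bij_betw \<rho> {0..<n} R" "bij_betw \<rho>' {0..<n} R"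
    and "bij_betw \<kappa> {0..<n} C" "bij_betw \<kappa>' {0..<n} C"
  shows "\<exists>\<epsilon> :: complex. \<epsilon> \<noteq> 0 \<and> (\<forall>g :: 'r \<Rightarrow> 'c \<Rightarrow> complex.
           det (mat n n (\<lambda>(i, j). g (\<rho> i) (\<kappa> j))) = \<epsilon> * det (mat n n (\<lambda>(i, j). g (\<rho>' i) (\<kappa>' j))))"
proof -
  obtain \<epsilon>1 :: complex where e1: "\<epsilon>1 \<noteq> 0" and
    r: "\<And>g :: 'r \<Rightarrow> nat \<Rightarrow> complex. det (mat n n (\<lambda>(i, j). g (\<rho> i) j)) = \<epsilon>1 * det (mat n n (\<lambda>(i, j). g (\<rho>' i) j))"
    using det_relabel_rows[OF assms(1,2)] by metis
  obtain \<epsilon>2 :: complex where e2: "\<epsilon>2 \<noteq> 0" and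
    c: "\<And>g :: 'c \<Rightarrow> nat \<Rightarrow> complex. det (mat n n (\<lambda>(i, j). g (\<kappa> i) j)) = \<epsilon>2 * det (mat n n (\<lambda>(i, j). g (\<kappa>' i) j))"
    using det_relabel_rows[OF assms(3,4)] by metis
  \<comment> \<open>Relabelling columns is relabelling the rows of the transpose.\<close>
  have t: "det (mat n n (\<lambda>(i, j). f i j)) = det (mat n n (\<lambda>(i, j). f j i))" for f :: "nat \<Rightarrow> nat \<Rightarrow> complex"
  proof -
    have "mat n n (\<lambda>(i, j). f j i) = transpose_mat (mat n n (\<lambda>(i, j). f i j))"
      by (intro eq_matI) auto
    then show ?thesis using det_transpose[of "mat n n (\<lambda>(i, j). f i j)" n] by simp
  qed
  have "det (mat n n (\<lambda>(i, j). g (\<rho> i) (\<kappa> j))) = (\<epsilon>1 * \<epsilon>2) * det (mat n n (\<lambda>(i, j). g (\<rho>' i) (\<kappa>' j)))"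
    for g :: "'r \<Rightarrow> 'c \<Rightarrow> complex"
    using r[of "\<lambda>a j. g a (\<kappa> j)"] c[of "\<lambda>b i. g (\<rho>' i) b"]
      t[of "\<lambda>i j. g (\<rho>' i) (\<kappa> j)"] t[of "\<lambda>i j. g (\<rho>' i) (\<kappa>' j)"] by simp
  with e1 e2 show ?thesis by (intro exI[of _ "\<epsilon>1 * \<epsilon>2"]) auto
qed

text \<open>The guard is there because \<open>\<alpha>\<close> is arbitrary at this stage and may be
  nonzero beyond the band.\<close>

definition band_entry :: "(nat \<Rightarrow> nat) \<Rightarrow> (nat \<Rightarrow> nat) \<Rightarrow> bands \<Rightarrow> nat \<Rightarrow> int \<Rightarrow> int \<Rightarrow> complex" where
  "band_entry r s \<alpha> k n c = (if - int (s k) \<le> c - n \<and> c - n \<le> int (r k) then \<alpha> k (c - n) n else 0)"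

lemma sum_band_entry:
  assumes "finite C" "{n - int (s k)..n + int (r k)} \<subseteq> C"
  shows "(\<Sum>c\<in>C. band_entry r s \<alpha> k n c * f c) = band_mult r s \<alpha> k f n"
proof -
  have "(\<Sum>c\<in>C. band_entry r s \<alpha> k n c * f c)
      = (\<Sum>c\<in>{n - int (s k)..n + int (r k)}. \<alpha> k (c - n) n * f c)"
    using assms by (intro sum.mono_neutral_cong_right) (auto simp: band_entry_def)
  also have "\<dots> = band_mult r s \<alpha> k f n"
    unfolding band_mult_def
    by (rule sum.reindex_bij_witness[of _ "\<lambda>l. n + l" "\<lambda>c. c - n"]) auto
  finally show ?thesis .
qed

definition char_entry :: "(nat \<Rightarrow> nat) \<Rightarrow> (nat \<Rightarrow> nat) \<Rightarrow> bands \<Rightarrow> nat \<Rightarrow> complex \<Rightarrow> int \<Rightarrow> int \<Rightarrow> complex" where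
  "char_entry r s \<alpha> k z n c = (if c = n then z else 0) - band_entry r s \<alpha> k n c"

lemma sum_char_entry:
  assumes "finite C" "{n - int (s k)..n + int (r k)} \<subseteq> C"
  shows "(\<Sum>c\<in>C. char_entry r s \<alpha> k z n c * f c) = z * f n - band_mult r s \<alpha> k f n"
proof -
  have n: "n \<in> C" using assms(2) by auto
  have "(\<Sum>c\<in>C. (if c = n then z else 0) * f c) = z * f n"
    using n assms(1) by (simp add: if_distrib[of "\<lambda>t. t * _"] cong: if_cong)
  then show ?thesis
    using sum_band_entry[where r = r and s = s and k = k, OF assms] by (simp add: char_entry_def left_diff_distrib sum_subtractf)
qed

text \<open>Row labels are pairs (band operator, row index). The columns are ordered such that those in
  the window of \<open>k\<close> come last.\<close>

definition joint_row :: "(nat \<Rightarrow> nat) \<Rightarrow> (nat \<Rightarrow> nat) \<Rightarrow> nat \<Rightarrow> nat \<Rightarrow> int \<Rightarrow> nat \<Rightarrow> nat \<times> int" where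
  "joint_row r s k j N i = (if i < s j + r j then (k, N - int (s j) + int i)
     else (j, N - int (s k) + int (i - (s j + r j))))"

definition joint_col :: "(nat \<Rightarrow> nat) \<Rightarrow> (nat \<Rightarrow> nat) \<Rightarrow> nat \<Rightarrow> nat \<Rightarrow> int \<Rightarrow> nat \<Rightarrow> int" where
  "joint_col r s k j N i = (if i < s j then N - int (s j) - int (s k) + int i
     else if i < s j + r j then N + int (r k) + int (i - s j)
     else N - int (s k) + int (i - (s j + r j)))"

text \<open>A Sylvester matrix with variable coefficients: \<open>r j + s j\<close> shifted rows of
  one band operator and \<open>r k + s k\<close> of the other, each operator with its own parameter
  \<open>z \<kappa>\<close>. Its determinant plays the part of the resultant of
  \<open>z k - Q\<^sub>k\<close> and \<open>z j - Q\<^sub>j\<close>.\<close>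

definition joint_mat :: "(nat \<Rightarrow> nat) \<Rightarrow> (nat \<Rightarrow> nat) \<Rightarrow> bands \<Rightarrow> nat \<Rightarrow> nat \<Rightarrow> int \<Rightarrow> (nat \<Rightarrow> complex) \<Rightarrow> complex mat" where
  "joint_mat r s \<alpha> k j N z = mat (s j + r j + (r k + s k)) (s j + r j + (r k + s k)) (\<lambda>(i, c).
     (\<lambda>(\<kappa>, n). char_entry r s \<alpha> \<kappa> (z \<kappa>) n) (joint_row r s k j N i) (joint_col r s k j N c))"

lemma bij_betw_joint_row:
  assumes "k \<noteq> j"
  shows "bij_betw (joint_row r s k j N) {0..<s j + r j + (r k + s k)}
     ({k} \<times> {N - int (s j)..<N + int (r j)} \<union> {j} \<times> {N - int (s k)..<N + int (r k)})"
  by (rule bij_betw_byWitness[where f' = "\<lambda>(\<kappa>, n). if \<kappa> = k then nat (n - N + int (s j))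
        else s j + r j + nat (n - N + int (s k))"])
     (use assms in \<open>auto simp: joint_row_def\<close>)

lemma bij_betw_joint_col:
  "bij_betw (joint_col r s k j N) {0..<s j + r j + (r k + s k)}
     {N - int (s j) - int (s k)..<N + int (r j) + int (r k)}"
  by (rule bij_betw_byWitness[where f' = "\<lambda>n. if n < N - int (s k) then nat (n - N + int (s j) + int (s k))
        else if n < N + int (r k) then s j + r j + nat (n - N + int (s k))
        else s j + nat (n - N - int (r k))"])
     (auto simp: joint_col_def)

text \<open>Exchanging the roles of the two operators leaves the sets of row and column labels
  unchanged; only their order differs.\<close>

lemma det_joint_mat_swap:
  assumes "k \<noteq> j"
  shows "\<exists>\<epsilon>. \<epsilon> \<noteq> 0 \<and> (\<forall>z. det (joint_mat r s \<alpha> k j N z) = \<epsilon> * det (joint_mat r s \<alpha> j k N z))"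
proof -
  let ?n = "s j + r j + (r k + s k)"
  have n: "s k + r k + (r j + s j) = ?n" by simp
  have 1: "bij_betw (joint_row r s j k N) {0..<?n}
     ({k} \<times> {N - int (s j)..<N + int (r j)} \<union> {j} \<times> {N - int (s k)..<N + int (r k)})"
    using bij_betw_joint_row[of j k r s N] assms unfolding n by (simp add: Un_commute)
  have 2: "bij_betw (joint_col r s j k N) {0..<?n}
     {N - int (s j) - int (s k)..<N + int (r j) + int (r k)}"
    using bij_betw_joint_col[of r s j k N] unfolding n by (simp add: algebra_simps)
  from det_relabel[OF bij_betw_joint_row[OF assms] 1 bij_betw_joint_col 2] obtain \<epsilon> :: complex where
    "\<epsilon> \<noteq> 0" and *: "\<And>g :: nat \<times> int \<Rightarrow> int \<Rightarrow> complex.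
       det (mat ?n ?n (\<lambda>(i, c). g (joint_row r s k j N i) (joint_col r s k j N c)))
     = \<epsilon> * det (mat ?n ?n (\<lambda>(i, c). g (joint_row r s j k N i) (joint_col r s j k N c)))"
    by metis
  moreover have "det (joint_mat r s \<alpha> k j N z) = \<epsilon> * det (joint_mat r s \<alpha> j k N z)" for z
    unfolding joint_mat_def n by (rule *)
  ultimately show ?thesis by blast
qed

text \<open>The first diagonal block is upper and the second lower triangular. This shape arises
  when the lower edge of a band runs along the diagonal of the first block and the upper edge along
  that of the second, so the determinant is a product of extreme coefficients.\<close>

lemma det_block_triangular:
  fixes F :: "nat \<Rightarrow> nat \<Rightarrow> complex"
  assumes "\<And>i c. i < a \<Longrightarrow> c < a \<Longrightarrow> c < i \<Longrightarrow> F i c = 0"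
    and "\<And>i c. i < b \<Longrightarrow> c < b \<Longrightarrow> i < c \<Longrightarrow> F (a + i) (a + c) = 0"
    and "\<And>i c. i < a \<Longrightarrow> c < b \<Longrightarrow> F i (a + c) = 0"
  shows "det (mat (a + b) (a + b) (\<lambda>(i, c). F i c)) = (\<Prod>i<a + b. F i i)"
proof -
  let ?P = "mat a a (\<lambda>(i, c). F i c)"
  let ?R = "mat b b (\<lambda>(i, c). F (a + i) (a + c))"
  let ?S = "mat b a (\<lambda>(i, c). F (a + i) c)"
  have "mat (a + b) (a + b) (\<lambda>(i, c). F i c) = four_block_mat ?P (0\<^sub>m a b) ?S ?R"
    using assms(3) by (intro eq_matI) (auto, metis less_diff_conv2 linorder_not_less add.commute le_add_diff_inverse)
  then have "det (mat (a + b) (a + b) (\<lambda>(i, c). F i c)) = det ?P * det ?R"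
    using det_four_block_mat_upper_right_zero[of ?P a "0\<^sub>m a b" b ?S ?R] by simp
  also have "det ?P = prod_list (diag_mat ?P)"
    by (rule det_upper_triangular[where n = a]) (auto simp: assms(1))
  also have "\<dots> = (\<Prod>i<a. F i i)"
    by (simp add: diag_mat_def prod.list_conv_set_nth atLeast0LessThan)
  also have "det ?R = prod_list (diag_mat ?R)"
    by (rule det_lower_triangular[where n = b]) (auto simp: assms(2))
  also have "\<dots> = (\<Prod>i<b. F (a + i) (a + i))"
    by (simp add: diag_mat_def prod.list_conv_set_nth atLeast0LessThan)
  also have "(\<Prod>i<a. F i i) * (\<Prod>i<b. F (a + i) (a + i)) = (\<Prod>i<a + b. F i i)"
    by (induction b) (simp_all add: mult.assoc)
  finally show ?thesis .
qed

lemma sum_lessThan_add: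
  fixes F :: "nat \<Rightarrow> 'a :: comm_monoid_add"
  shows "(\<Sum>c<a + b. F c) = (\<Sum>c<a. F c) + (\<Sum>c<b. F (a + c))"
  by (induction b) (simp_all add: add.assoc)

text \<open>Column operations: to each window column is added the combination of outer columns
  prescribed by the solution of operator \<open>k\<close> with that unit window. The rows of
  \<open>k\<close> vanish on solutions, so their window part becomes 0, while the window part of the
  rows of \<open>j\<close> becomes \<open>z j\<close> minus \<open>E_mat\<close>.\<close>

lemma det_joint_mat:
  assumes "k \<noteq> j" and reg: "regular r s \<alpha> k {N - int (s j)..<N + int (r j)}"
  shows "\<exists>c. c \<noteq> 0 \<and> (\<forall>z. det (joint_mat r s \<alpha> k j N z)
           = c * det (z j \<cdot>\<^sub>m 1\<^sub>m (r k + s k) - E_mat r s \<alpha> k j N (z k)))"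
proof -
  let ?row = "joint_row r s k j N" and ?col = "joint_col r s k j N"
  let ?n1 = "s j + r j" and ?n2 = "r k + s k"
  \<comment> \<open>The diagonal of the outer block: the first \<open>s j\<close> rows meet their
    lowest coefficient, the other \<open>r j\<close> rows their highest. No parameter enters, since
    \<open>0 < r k\<close> and \<open>0 < s k\<close> keep the band edges off the diagonal of the
    operator.\<close>
  define c where "c = (\<Prod>i<s j + r j. if i < s j then - \<alpha> k (- int (s k)) (N - int (s j) + int i)
                                      else - \<alpha> k (int (r k)) (N - int (s j) + int i))"
  have "c \<noteq> 0"
    using reg by (auto simp: c_def regular_def)
  moreover have "det (joint_mat r s \<alpha> k j N z)
      = c * det (z j \<cdot>\<^sub>m 1\<^sub>m ?n2 - E_mat r s \<alpha> k j N (z k))" for z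
  proof -
    define g where "g = (\<lambda>i c. (\<lambda>(\<kappa>, n). char_entry r s \<alpha> \<kappa> (z \<kappa>) n) (?row i) (?col c))"
    define B where "B = mat ?n1 ?n1 (\<lambda>(i, c). g i c)"
    define C where "C = mat ?n1 ?n2 (\<lambda>(i, c). g i (?n1 + c))"
    define F where "F = mat ?n2 ?n1 (\<lambda>(i, c). g (?n1 + i) c)"
    define H where "H = mat ?n2 ?n2 (\<lambda>(i, c). g (?n1 + i) (?n1 + c))"
    have "\<forall>e. \<exists>f. window r s k N f = unit_vec ?n2 e
             \<and> solves r s \<alpha> k (z k) {N - int (s j)..<N + int (r j)} f"
      using local_solution_exists[OF unit_vec_carrier reg] by blast
    then obtain f where f: "\<And>e. window r s k N (f e) = unit_vec ?n2 e"
      and sol: "\<And>e. solves r s \<alpha> k (z k) {N - int (s j)..<N + int (r j)} (f e)"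
      by metis
    \<comment> \<open>The values of the solutions outside the window. Their values inside it form
      the identity matrix by \<open>delta\<close>, so \<open>T\<close> stacked on the identity has
      the solutions as columns.\<close>
    define T where "T = mat ?n1 ?n2 (\<lambda>(c, e). f e (?col c))"
    have cols: "B \<in> carrier_mat ?n1 ?n1" "C \<in> carrier_mat ?n1 ?n2" "F \<in> carrier_mat ?n2 ?n1"
        "H \<in> carrier_mat ?n2 ?n2" "T \<in> carrier_mat ?n1 ?n2"
      by (auto simp: B_def C_def F_def H_def T_def)
    have delta: "f e (?col (?n1 + c)) = (if c = e then 1 else 0)" if "c < ?n2" "e < ?n2" for c e
    proof -
      have "f e (?col (?n1 + c)) = window r s k N (f e) $ c"
        using that by (simp add: joint_col_def window_def)
      then show ?thesis using that by (simp add: f)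
    qed
    have sum_cols: "(\<Sum>c<?n1. g i c * f e (?col c)) + g i (?n1 + e)
        = (\<Sum>c\<in>{N - int (s j) - int (s k)..<N + int (r j) + int (r k)}.
             (\<lambda>(\<kappa>, n). char_entry r s \<alpha> \<kappa> (z \<kappa>) n) (?row i) c * f e c)" if "e < ?n2" for i e
    proof -
      have "(\<Sum>c\<in>{N - int (s j) - int (s k)..<N + int (r j) + int (r k)}.
             (\<lambda>(\<kappa>, n). char_entry r s \<alpha> \<kappa> (z \<kappa>) n) (?row i) c * f e c)
          = (\<Sum>c\<in>{0..<?n1 + ?n2}. g i c * f e (?col c))"
        unfolding g_def by (rule sum.reindex_bij_betw[OF bij_betw_joint_col, symmetric])
      also have "\<dots> = (\<Sum>c<?n1. g i c * f e (?col c)) + (\<Sum>c<?n2. g i (?n1 + c) * f e (?col (?n1 + c)))"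
        by (simp only: atLeast0LessThan sum_lessThan_add)
      also have "(\<Sum>c<?n2. g i (?n1 + c) * f e (?col (?n1 + c))) = (\<Sum>c<?n2. if c = e then g i (?n1 + e) else 0)"
        using that by (intro sum.cong refl) (simp add: delta)
      finally show ?thesis using that by simp
    qed
    have BTC: "B * T + C = 0\<^sub>m ?n1 ?n2"
    proof (rule eq_matI)
      fix i e assume "i < dim_row (0\<^sub>m ?n1 ?n2)" "e < dim_col (0\<^sub>m ?n1 ?n2 :: complex mat)"
      then have i: "i < ?n1" and e: "e < ?n2" by auto
      let ?M = "N - int (s j) + int i"
      have "(B * T + C) $$ (i, e) = (\<Sum>c<?n1. g i c * f e (?col c)) + g i (?n1 + e)"
        using i e by (simp add: B_def T_def C_def scalar_prod_def atLeast0LessThan)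
      also have "\<dots> = (\<Sum>c\<in>{N - int (s j) - int (s k)..<N + int (r j) + int (r k)}.
             char_entry r s \<alpha> k (z k) ?M c * f e c)"
        unfolding sum_cols[OF e] using i by (simp add: joint_row_def)
      also have "\<dots> = z k * f e ?M - band_mult r s \<alpha> k (f e) ?M"
        using i by (intro sum_char_entry) auto
      also have "\<dots> = 0" using sol[of e] i by (auto simp: solves_def)
      finally show "(B * T + C) $$ (i, e) = 0\<^sub>m ?n1 ?n2 $$ (i, e)" using i e by simp
    qed (use cols in auto)
    have FTH: "F * T + H = z j \<cdot>\<^sub>m 1\<^sub>m ?n2 - E_mat r s \<alpha> k j N (z k)" (is "_ = ?X")
    proof (rule eq_matI)
      fix i e assume "i < dim_row ?X" "e < dim_col ?X"
      then have i: "i < ?n2" and e: "e < ?n2" by auto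
      let ?M = "N - int (s k) + int i"
      have "(F * T + H) $$ (i, e) = (\<Sum>c<?n1. g (?n1 + i) c * f e (?col c)) + g (?n1 + i) (?n1 + e)"
        using i e by (simp add: F_def T_def H_def scalar_prod_def atLeast0LessThan)
      also have "\<dots> = (\<Sum>c\<in>{N - int (s j) - int (s k)..<N + int (r j) + int (r k)}.
             char_entry r s \<alpha> j (z j) ?M c * f e c)"
        unfolding sum_cols[OF e] using i by (simp add: joint_row_def)
      also have "\<dots> = z j * f e ?M - band_mult r s \<alpha> j (f e) ?M"
        using i by (intro sum_char_entry) auto
      also have "f e ?M = (if i = e then 1 else 0)"
        using delta[OF i e] by (simp add: joint_col_def)
      also have "band_mult r s \<alpha> j (f e) ?M = (E_mat r s \<alpha> k j N (z k) *\<^sub>v unit_vec ?n2 e) $ i"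
        using i by (simp add: E_mat_window[OF reg sol, of e, unfolded f] window_def)
      also have "\<dots> = (\<Sum>c<?n2. if c = e then E_mat r s \<alpha> k j N (z k) $$ (i, e) else 0)"
        using i e by (subst mult_mat_vec_nth[OF E_mat_carrier]) (auto simp: if_distrib[of "\<lambda>t. _ * t"] cong: if_cong)
      also have "\<dots> = E_mat r s \<alpha> k j N (z k) $$ (i, e)"
        using e by simp
      finally show "(F * T + H) $$ (i, e) = ?X $$ (i, e)"
        using i e by simp
    qed (use cols in auto)
    have "joint_mat r s \<alpha> k j N z = four_block_mat B C F H"
      unfolding joint_mat_def B_def C_def F_def H_def g_def[symmetric]
      by (intro eq_matI) (auto simp: g_def)
    moreover have "four_block_mat B C F H * four_block_mat (1\<^sub>m ?n1) T (0\<^sub>m ?n2 ?n1) (1\<^sub>m ?n2)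
        = four_block_mat B (0\<^sub>m ?n1 ?n2) F ?X"
      using cols
      by (subst mult_four_block_mat[OF cols(1-4) one_carrier_mat cols(5) zero_carrier_mat one_carrier_mat])
         (auto simp: BTC FTH)
    moreover have "det (four_block_mat B C F H * four_block_mat (1\<^sub>m ?n1) T (0\<^sub>m ?n2 ?n1) (1\<^sub>m ?n2))
        = det (four_block_mat B C F H)"
      using cols by (subst det_mult[where n = "?n1 + ?n2"])
        (auto simp: det_four_block_mat_lower_left_zero[where n = ?n1 and m = ?n2])
    moreover have "det (four_block_mat B (0\<^sub>m ?n1 ?n2) F ?X) = det B * det ?X"
      using cols by (intro det_four_block_mat_upper_right_zero) auto
    moreover have "det B = c"
    proof -
      have "det B = (\<Prod>i<s j + r j. g i i)"
        unfolding B_def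
        by (rule det_block_triangular) (auto simp: g_def joint_row_def joint_col_def char_entry_def band_entry_def)
      also have "\<dots> = c"
        unfolding c_def using reg
        by (intro prod.cong refl) (auto simp: g_def joint_row_def joint_col_def char_entry_def band_entry_def regular_def)
      finally show ?thesis .
    qed
    ultimately show ?thesis by simp
  qed
  ultimately show ?thesis by blast
qed

lemma det_E_mat_proportional:
  assumes "k \<noteq> j" "regular r s \<alpha> k {N - int (s j)..<N + int (r j)}"
    "regular r s \<alpha> j {N - int (s k)..<N + int (r k)}"
  shows "\<exists>c. c \<noteq> 0 \<and> (\<forall>x y. det (x \<cdot>\<^sub>m 1\<^sub>m (r j + s j) - E_mat r s \<alpha> j k N y)
           = c * det (y \<cdot>\<^sub>m 1\<^sub>m (r k + s k) - E_mat r s \<alpha> k j N x))"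
proof -
  obtain a where a: "a \<noteq> 0" "\<And>z. det (joint_mat r s \<alpha> k j N z)
           = a * det (z j \<cdot>\<^sub>m 1\<^sub>m (r k + s k) - E_mat r s \<alpha> k j N (z k))"
    using det_joint_mat[OF assms(1,2)] by blast
  obtain b where b: "b \<noteq> 0" "\<And>z. det (joint_mat r s \<alpha> j k N z)
           = b * det (z k \<cdot>\<^sub>m 1\<^sub>m (r j + s j) - E_mat r s \<alpha> j k N (z j))"
    using det_joint_mat[OF assms(1)[symmetric] assms(3)] by blast
  obtain \<epsilon> where e: "\<epsilon> \<noteq> 0" "\<And>z. det (joint_mat r s \<alpha> k j N z) = \<epsilon> * det (joint_mat r s \<alpha> j k N z)"
    using det_joint_mat_swap[OF assms(1)] by blast
  have "det (x \<cdot>\<^sub>m 1\<^sub>m (r j + s j) - E_mat r s \<alpha> j k N y)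
      = a / (\<epsilon> * b) * det (y \<cdot>\<^sub>m 1\<^sub>m (r k + s k) - E_mat r s \<alpha> k j N x)" for x y
  proof -
    define z where "z = (\<lambda>\<kappa>. if \<kappa> = k then x else y)"
    have "z k = x" "z j = y" using assms(1) by (auto simp: z_def)
    with a(2)[of z] b(2)[of z] e(2)[of z] a(1) b(1) e(1) show ?thesis
      by (simp add: field_simps)
  qed
  with a(1) b(1) e(1) show ?thesis by (intro exI[of _ "a / (\<epsilon> * b)"]) auto
qed

section \<open>Reflection of the dual objects\<close>

text \<open>Reversing the index \<open>n \<mapsto> - n\<close> and transposing a band matrix preserves the band widths, and turns
  a dual ladder matrix into the anti-transpose of a ladder matrix.\<close>

definition reflect :: "bands \<Rightarrow> bands" where
  "reflect \<alpha> = (\<lambda>k l n. \<alpha> k l (- n - l))"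

definition anti_transpose :: "nat \<Rightarrow> complex mat \<Rightarrow> complex mat" where
  "anti_transpose n A = mat n n (\<lambda>(i, j). A $$ (n - 1 - j, n - 1 - i))"

lemma anti_transpose_carrier [simp]: "anti_transpose n A \<in> carrier_mat n n"
  by (simp add: anti_transpose_def)

lemma anti_transpose_one: "anti_transpose n (1\<^sub>m n) = 1\<^sub>m n"
  by (intro eq_matI) (auto simp: anti_transpose_def)

lemma anti_transpose_add:
  "A \<in> carrier_mat n n \<Longrightarrow> B \<in> carrier_mat n n \<Longrightarrow>
     anti_transpose n (A + B) = anti_transpose n A + anti_transpose n B"
  by (intro eq_matI) (auto simp: anti_transpose_def)

lemma anti_transpose_mult:
  assumes "A \<in> carrier_mat n n" "B \<in> carrier_mat n n"
  shows "anti_transpose n (A * B) = anti_transpose n B * anti_transpose n A"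
proof (rule eq_matI)
  fix i j assume "i < dim_row (anti_transpose n B * anti_transpose n A)"
    "j < dim_col (anti_transpose n B * anti_transpose n A)"
  then have ij: "i < n" "j < n" by (auto simp: anti_transpose_def)
  have "anti_transpose n (A * B) $$ (i, j) = (\<Sum>c<n. A $$ (n - 1 - j, c) * B $$ (c, n - 1 - i))"
    using ij assms by (auto simp: anti_transpose_def scalar_prod_def atLeast0LessThan)
  also have "\<dots> = (\<Sum>c<n. A $$ (n - 1 - j, n - 1 - c) * B $$ (n - 1 - c, n - 1 - i))"
    by (rule sum.reindex_bij_witness[of _ "\<lambda>c. n - 1 - c" "\<lambda>c. n - 1 - c"]) auto
  also have "\<dots> = (anti_transpose n B * anti_transpose n A) $$ (i, j)"
    using ij by (auto simp: anti_transpose_def scalar_prod_def atLeast0LessThan mult.commute intro!: sum.cong)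
  finally show "anti_transpose n (A * B) $$ (i, j) = (anti_transpose n B * anti_transpose n A) $$ (i, j)" .
qed (auto simp: anti_transpose_def)

lemma anti_transpose_minv:
  assumes A: "A \<in> carrier_mat n n" and d: "det A \<noteq> 0"
  shows "minv (anti_transpose n A) = anti_transpose n (minv A)"
proof -
  let ?F = "anti_transpose n A" and ?G = "anti_transpose n (minv A)"
  note inv = minv_inverse[OF A d]
  have FG: "?F * ?G = 1\<^sub>m n"
    using anti_transpose_mult[OF inv(1) A] by (simp add: inv anti_transpose_one)
  have "det ?F * det ?G = 1"
    using det_mult[of ?F n ?G] FG by simp
  then have dF: "det ?F \<noteq> 0" by auto
  note finv = minv_inverse[OF anti_transpose_carrier dF]
  have "minv ?F = minv ?F * (?F * ?G)"
    using finv(1) by (simp add: FG)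
  also have "\<dots> = (minv ?F * ?F) * ?G"
    by (rule assoc_mult_mat[symmetric, OF finv(1)]) (rule anti_transpose_carrier)+
  also have "\<dots> = ?G"
    using left_mult_one_mat[OF anti_transpose_carrier] by (simp add: finv(3))
  finally show ?thesis .
qed

text \<open>Negation sends the dual window \<open>N - r k, ..., N + s k - 1\<close> to the window at
  \<open>1 - N\<close>, in reverse order; hence the base point \<open>1 - N\<close>. The reversal
  together with the change from right to left multiplication is the anti-transpose.\<close>

lemma dual_ladder_eq_anti_transpose:
  "dual_ladder r s \<alpha> k N x = anti_transpose (r k + s k) (ladder r s (reflect \<alpha>) k (1 - N) x)"
proof (rule eq_matI)
  fix i j assume "i < dim_row (anti_transpose (r k + s k) (ladder r s (reflect \<alpha>) k (1 - N) x))"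
    "j < dim_col (anti_transpose (r k + s k) (ladder r s (reflect \<alpha>) k (1 - N) x))"
  then have ij: "i < r k + s k" "j < r k + s k" by (auto simp: anti_transpose_def)
  then have *: "int (r k + s k - 1 - i) - int (s k) = int (r k) - 1 - int i" by linarith
  have **: "- (1 - N) - l = N - 1 - l" for l :: int by simp
  show "dual_ladder r s \<alpha> k N x $$ (i, j)
     = anti_transpose (r k + s k) (ladder r s (reflect \<alpha>) k (1 - N) x) $$ (i, j)"
  proof (cases "j = 0")
    case True
    have "anti_transpose (r k + s k) (ladder r s (reflect \<alpha>) k (1 - N) x) $$ (i, j)
       = ((if int (r k + s k - 1 - i) - int (s k) = 0 then x else 0)
            - reflect \<alpha> k (int (r k + s k - 1 - i) - int (s k)) (1 - N)) / reflect \<alpha> k (int (r k)) (1 - N)"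
      using ij True by (simp add: anti_transpose_def ladder_def Let_def)
    also have "\<dots> = ((if int (r k) - 1 - int i = 0 then x else 0)
        - \<alpha> k (int (r k) - 1 - int i) (N - 1 - (int (r k) - 1 - int i))) / \<alpha> k (int (r k)) (N - 1 - int (r k))"
      by (simp only: * reflect_def **)
    also have "\<dots> = dual_ladder r s \<alpha> k N x $$ (i, j)"
      using ij True by (simp add: dual_ladder_def Let_def)
    finally show ?thesis ..
  next
    case False
    then have "r k + s k - 1 - j + 1 < r k + s k"
       "(r k + s k - 1 - i = r k + s k - 1 - j + 1) = (j = i + 1)"
      using ij by auto
    then show ?thesis
      using ij False by (simp add: dual_ladder_def anti_transpose_def ladder_def)
  qed
qed (simp_all add: dual_ladder_def anti_transpose_def)

lemma dual_diag_band_eq_anti_transpose: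
  "dual_diag_band r s \<alpha> k N j l = anti_transpose (r k + s k) (diag_band r s (reflect \<alpha>) k (1 - N) j l)"
proof (rule eq_matI)
  fix i i' assume "i < dim_row (anti_transpose (r k + s k) (diag_band r s (reflect \<alpha>) k (1 - N) j l))"
    "i' < dim_col (anti_transpose (r k + s k) (diag_band r s (reflect \<alpha>) k (1 - N) j l))"
  then have ij: "i < r k + s k" "i' < r k + s k" by (auto simp: anti_transpose_def)
  have *: "- (1 - N - int (s k) + int (r k + s k - 1 - i)) - l = N - l - int (r k) + int i"
    using ij by linarith
  have 1: "reflect \<alpha> j l (1 - N - int (s k) + int (r k + s k - 1 - i)) = \<alpha> j l (N - l - int (r k) + int i)"
    by (simp only: reflect_def *)
  have 2: "anti_transpose (r k + s k) (diag_band r s (reflect \<alpha>) k (1 - N) j l) $$ (i, i')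
      = (if i = i' then reflect \<alpha> j l (1 - N - int (s k) + int (r k + s k - 1 - i)) else 0)"
    using ij by (auto simp: anti_transpose_def diag_band_def)
  show "dual_diag_band r s \<alpha> k N j l $$ (i, i')
     = anti_transpose (r k + s k) (diag_band r s (reflect \<alpha>) k (1 - N) j l) $$ (i, i')"
    unfolding 1 2 using ij by (simp add: dual_diag_band_def)
qed (simp_all add: dual_diag_band_def anti_transpose_def)

lemma dual_ladder_up_eq_anti_transpose:
  "dual_ladder_up r s \<alpha> k N x l = anti_transpose (r k + s k) (ladder_up r s (reflect \<alpha>) k (1 - N) x l)"
proof (induction l)
  case (Suc l)
  have *: "1 - (N - int l) = 1 - N + int l" by simp
  show ?case
    by (simp add: * anti_transpose_mult[OF ladder_carrier ladder_up_carrier] Suc dual_ladder_eq_anti_transpose)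
qed (simp add: anti_transpose_one)

lemma dual_ladder_down_eq_anti_transpose:
  assumes "regular r s (reflect \<alpha>) k {1 - N - int l..<1 - N}"
  shows "dual_ladder_down r s \<alpha> k N x l = anti_transpose (r k + s k) (ladder_down r s (reflect \<alpha>) k (1 - N) x l)"
  using assms
proof (induction l)
  case (Suc l)
  let ?A = "ladder r s (reflect \<alpha>) k (1 - N - int (Suc l)) x"
  have eq: "1 - N - int (Suc l) = 1 - (N + int (Suc l))" by simp
  have reg: "regular r s (reflect \<alpha>) k {1 - N - int l..<1 - N}"
    using Suc.prems by (auto simp: regular_def)
  have d: "det ?A \<noteq> 0"
    by (rule det_ladder) (use Suc.prems in \<open>auto simp: regular_def\<close>)
  have "dual_ladder_down r s \<alpha> k N x (Suc l)
     = anti_transpose (r k + s k) (ladder_down r s (reflect \<alpha>) k (1 - N) x l)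
       * minv (anti_transpose (r k + s k) ?A)"
    using Suc.IH[OF reg] by (simp only: dual_ladder_down.simps dual_ladder_eq_anti_transpose eq)
  also have "\<dots> = anti_transpose (r k + s k) (ladder_down r s (reflect \<alpha>) k (1 - N) x (Suc l))"
    unfolding anti_transpose_minv[OF ladder_carrier d] ladder_down.simps
    by (rule anti_transpose_mult[symmetric, OF minv_inverse(1)[OF ladder_carrier d] ladder_down_carrier[OF reg]])
  finally show ?case .
qed (simp add: anti_transpose_one)

lemma anti_transpose_msum:
  "anti_transpose n (msum n F L) = msum n (\<lambda>l. anti_transpose n (F l)) L"
  by (intro eq_matI) (auto simp: anti_transpose_def msum_def)

lemma msum_cong: "(\<And>l. l \<in> L \<Longrightarrow> F l = G l) \<Longrightarrow> msum n F L = msum n G L"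
  by (simp add: msum_def cong: sum.cong)

lemma dual_E_mat_eq_anti_transpose:
  assumes reg: "regular r s (reflect \<alpha>) k {1 - N - int (s j)..<1 - N}"
  shows "dual_E_mat r s \<alpha> k j N x = anti_transpose (r k + s k) (E_mat r s (reflect \<alpha>) k j (1 - N) x)"
proof -
  let ?n = "r k + s k"
  have down: "regular r s (reflect \<alpha>) k {1 - N - int l..<1 - N}" if "l \<in> {1..s j}" for l
    using reg that by (auto simp: regular_def)
  have "msum ?n (\<lambda>l. dual_ladder_up r s \<alpha> k N x l * dual_diag_band r s \<alpha> k N j (int l)) {1..r j}
      = anti_transpose ?n (msum ?n (\<lambda>l. diag_band r s (reflect \<alpha>) k (1 - N) j (int l)
          * ladder_up r s (reflect \<alpha>) k (1 - N) x l) {1..r j})"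
    unfolding anti_transpose_msum
    by (intro msum_cong) (simp add: anti_transpose_mult[OF diag_band_carrier ladder_up_carrier]
        dual_ladder_up_eq_anti_transpose dual_diag_band_eq_anti_transpose)
  moreover have "msum ?n (\<lambda>l. dual_ladder_down r s \<alpha> k N x l * dual_diag_band r s \<alpha> k N j (- int l)) {1..s j}
      = anti_transpose ?n (msum ?n (\<lambda>l. diag_band r s (reflect \<alpha>) k (1 - N) j (- int l)
          * ladder_down r s (reflect \<alpha>) k (1 - N) x l) {1..s j})"
    unfolding anti_transpose_msum
    by (intro msum_cong) (simp add: anti_transpose_mult[where n = ?n] ladder_down_carrier[OF down]
        dual_ladder_down_eq_anti_transpose[OF down] dual_diag_band_eq_anti_transpose)
  ultimately show ?thesis
    unfolding dual_E_mat_def E_mat_def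
    by (simp add: anti_transpose_add dual_diag_band_eq_anti_transpose)
qed

text \<open>The row vector \<open>g\<close> times the band matrix, as in the recursion for \<phi>:
  the coefficients are taken at the shifted index because a column is summed.\<close>

definition band_comult :: "(nat \<Rightarrow> nat) \<Rightarrow> (nat \<Rightarrow> nat) \<Rightarrow> bands \<Rightarrow> nat \<Rightarrow> (int \<Rightarrow> complex) \<Rightarrow> int \<Rightarrow> complex" where
  "band_comult r s \<alpha> k g n = (\<Sum>l\<in>{- int (s k)..int (r k)}. \<alpha> k l (n - l) * g (n - l))"

lemma band_mult_reflect:
  "band_mult r s (reflect \<alpha>) k (\<lambda>n. g (- n)) (- n) = band_comult r s \<alpha> k g n"
  by (simp add: band_mult_def band_comult_def reflect_def)

lemma sum_band_entry_left:
  assumes "finite C" "{n - int (r k)..n + int (s k)} \<subseteq> C"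
  shows "(\<Sum>c\<in>C. g c * band_entry r s \<alpha> k c n) = band_comult r s \<alpha> k g n"
proof -
  have "(\<Sum>c\<in>C. g c * band_entry r s \<alpha> k c n)
      = (\<Sum>c\<in>{n - int (r k)..n + int (s k)}. \<alpha> k (n - c) c * g c)"
    using assms by (intro sum.mono_neutral_cong_right) (auto simp: band_entry_def)
  also have "\<dots> = band_comult r s \<alpha> k g n"
    unfolding band_comult_def
    by (rule sum.reindex_bij_witness[of _ "\<lambda>l. n - l" "\<lambda>c. n - c"]) auto
  finally show ?thesis .
qed

definition cosolves :: "(nat \<Rightarrow> nat) \<Rightarrow> (nat \<Rightarrow> nat) \<Rightarrow> bands \<Rightarrow> nat \<Rightarrow> complex \<Rightarrow> int set \<Rightarrow> (int \<Rightarrow> complex) \<Rightarrow> bool" where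
  "cosolves r s \<alpha> k x I g \<longleftrightarrow> (\<forall>n\<in>I. band_comult r s \<alpha> k g n = x * g n)"

text \<open>Column version of \<open>regular\<close>: the extreme entries of column \<open>n\<close>
  stand in the rows \<open>n - r k\<close> and \<open>n + s k\<close>.\<close>

definition coregular :: "(nat \<Rightarrow> nat) \<Rightarrow> (nat \<Rightarrow> nat) \<Rightarrow> bands \<Rightarrow> nat \<Rightarrow> int set \<Rightarrow> bool" where
  "coregular r s \<alpha> k I \<longleftrightarrow> 0 < r k \<and> 0 < s k \<and>
     (\<forall>n\<in>I. \<alpha> k (int (r k)) (n - int (r k)) \<noteq> 0 \<and> \<alpha> k (- int (s k)) (n + int (s k)) \<noteq> 0)"

lemma regular_reflect:
  assumes "coregular r s \<alpha> k {N - int (r j)..<N + int (s j)}"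
  shows "regular r s (reflect \<alpha>) k {1 - N - int (s j)..<1 - N + int (r j)}"
proof -
  have "reflect \<alpha> k (int (r k)) n \<noteq> 0 \<and> reflect \<alpha> k (- int (s k)) n \<noteq> 0"
    if "n \<in> {1 - N - int (s j)..<1 - N + int (r j)}" for n
  proof -
    have "- n \<in> {N - int (r j)..<N + int (s j)}" using that by auto
    with assms have "\<alpha> k (int (r k)) (- n - int (r k)) \<noteq> 0 \<and> \<alpha> k (- int (s k)) (- n + int (s k)) \<noteq> 0"
      unfolding coregular_def by blast
    then show ?thesis by (simp add: reflect_def)
  qed
  with assms show ?thesis by (auto simp: regular_def coregular_def)
qed

text \<open>Continuation of left solutions, obtained from that of right solutions by reflection. A
  unit window selects a row of \<open>dual_E_mat\<close>, because the dual matrices act on row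
  vectors from the right.\<close>

lemma dual_solution_exists:
  assumes co: "coregular r s \<alpha> k {N - int (r j)..<N + int (s j)}" and i: "i < r k + s k"
  obtains g where "\<And>i'. i' < r k + s k \<Longrightarrow> g (N - int (r k) + int i') = (if i' = i then 1 else 0)"
    and "cosolves r s \<alpha> k x {N - int (r j)..<N + int (s j)} g"
    and "\<And>i'. i' < r k + s k \<Longrightarrow> band_comult r s \<alpha> j g (N - int (r k) + int i')
           = dual_E_mat r s \<alpha> k j N x $$ (i, i')"
proof -
  let ?n = "r k + s k"
  note reg = regular_reflect[OF co]
  \<comment> \<open>The reflected window is listed backwards, so dual position \<open>i\<close>
    corresponds to \<open>?n - 1 - i\<close>.\<close>
  obtain f where f: "window r s k (1 - N) f = unit_vec ?n (?n - 1 - i)"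
      "solves r s (reflect \<alpha>) k x {1 - N - int (s j)..<1 - N + int (r j)} f"
    using local_solution_exists[OF unit_vec_carrier reg] by blast
  define g where "g = (\<lambda>n. f (- n))"
  have f_g: "f = (\<lambda>n. g (- n))" by (simp add: g_def)
  have lt: "?n - 1 - i' < ?n" for i' using i by linarith
  have idx: "1 - N - int (s k) + int (?n - 1 - i') = - (N - int (r k) + int i')" if "i' < ?n" for i'
    using that by linarith
  have 1: "g (N - int (r k) + int i') = (if i' = i then 1 else 0)" if "i' < ?n" for i'
  proof -
    have "g (N - int (r k) + int i') = window r s k (1 - N) f $ (?n - 1 - i')"
      by (simp only: g_def window_def index_vec[OF lt] idx[OF that])
    also have "\<dots> = (if i' = i then 1 else 0)"
      unfolding f(1) using that i by auto
    finally show ?thesis .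
  qed
  have 2: "cosolves r s \<alpha> k x {N - int (r j)..<N + int (s j)} g"
    unfolding cosolves_def
  proof
    fix n assume "n \<in> {N - int (r j)..<N + int (s j)}"
    then have "- n \<in> {1 - N - int (s j)..<1 - N + int (r j)}" by auto
    with f(2) have "band_mult r s (reflect \<alpha>) k f (- n) = x * f (- n)"
      by (auto simp: solves_def)
    then show "band_comult r s \<alpha> k g n = x * g n"
      unfolding f_g band_mult_reflect by simp
  qed
  have 3: "band_comult r s \<alpha> j g (N - int (r k) + int i') = dual_E_mat r s \<alpha> k j N x $$ (i, i')"
    if i': "i' < ?n" for i'
  proof -
    let ?E = "E_mat r s (reflect \<alpha>) k j (1 - N) x"
    have "band_comult r s \<alpha> j g (N - int (r k) + int i')
        = band_mult r s (reflect \<alpha>) j f (- (N - int (r k) + int i'))"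
      unfolding f_g band_mult_reflect ..
    also have "\<dots> = window r s k (1 - N) (band_mult r s (reflect \<alpha>) j f) $ (?n - 1 - i')"
      by (simp only: window_def index_vec[OF lt] idx[OF i'])
    also have "\<dots> = (?E *\<^sub>v unit_vec ?n (?n - 1 - i)) $ (?n - 1 - i')"
      by (simp only: E_mat_window[OF reg f(2)] f(1)[symmetric])
    also have "\<dots> = (\<Sum>c<?n. if c = ?n - 1 - i then ?E $$ (?n - 1 - i', ?n - 1 - i) else 0)"
      using i i' by (subst mult_mat_vec_nth[OF E_mat_carrier]) (auto simp: if_distrib[of "\<lambda>t. _ * t"] cong: if_cong)
    also have "\<dots> = ?E $$ (?n - 1 - i', ?n - 1 - i)"
      using i by simp
    also have "\<dots> = dual_E_mat r s \<alpha> k j N x $$ (i, i')"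
      using i i' reg by (subst dual_E_mat_eq_anti_transpose) (auto simp: anti_transpose_def regular_def)
    finally show ?thesis .
  qed
  show ?thesis by (rule that[OF 1 2 3])
qed

lemma primal_solution_exists:
  assumes reg: "regular r s \<alpha> k {N - int (s j)..<N + int (r j)}" and i: "i < r k + s k"
  obtains f where "\<And>i'. i' < r k + s k \<Longrightarrow> f (N - int (s k) + int i') = (if i' = i then 1 else 0)"
    and "solves r s \<alpha> k x {N - int (s j)..<N + int (r j)} f"
    and "\<And>i'. i' < r k + s k \<Longrightarrow> band_mult r s \<alpha> j f (N - int (s k) + int i')
           = E_mat r s \<alpha> k j N x $$ (i', i)"
proof -
  let ?n = "r k + s k"
  obtain f where f: "window r s k N f = unit_vec ?n i"
      "solves r s \<alpha> k x {N - int (s j)..<N + int (r j)} f"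
    using local_solution_exists[OF unit_vec_carrier reg] by blast
  have 1: "f (N - int (s k) + int i') = (if i' = i then 1 else 0)" if "i' < ?n" for i'
  proof -
    have "f (N - int (s k) + int i') = window r s k N f $ i'"
      using that by (simp add: window_def)
    then show ?thesis using that i by (simp add: f(1))
  qed
  have 3: "band_mult r s \<alpha> j f (N - int (s k) + int i') = E_mat r s \<alpha> k j N x $$ (i', i)"
    if i': "i' < ?n" for i'
  proof -
    have "band_mult r s \<alpha> j f (N - int (s k) + int i') = window r s k N (band_mult r s \<alpha> j f) $ i'"
      using i' by (simp add: window_def)
    also have "\<dots> = (E_mat r s \<alpha> k j N x *\<^sub>v unit_vec ?n i) $ i'"
      by (simp only: E_mat_window[OF reg f(2)] f(1)[symmetric])
    also have "\<dots> = (\<Sum>c<?n. if c = i then E_mat r s \<alpha> k j N x $$ (i', i) else 0)"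
      using i i' by (subst mult_mat_vec_nth[OF E_mat_carrier]) (auto simp: if_distrib[of "\<lambda>t. _ * t"] cong: if_cong)
    also have "\<dots> = E_mat r s \<alpha> k j N x $$ (i', i)"
      using i by simp
    finally show ?thesis .
  qed
  show ?thesis by (rule that[OF 1 f(2) 3])
qed


section \<open>Spectral duality\<close>

text \<open>The difference of indicators comes from commuting a band matrix with the projection onto
  indices below \<open>N\<close>; it yields both signs and the two vanishing blocks of
  \<open>CD_mat\<close> at once.\<close>

definition cd_entry :: "(nat \<Rightarrow> nat) \<Rightarrow> (nat \<Rightarrow> nat) \<Rightarrow> bands \<Rightarrow> nat \<Rightarrow> int \<Rightarrow> int \<Rightarrow> int \<Rightarrow> complex" where
  "cd_entry r s \<alpha> k N p q = (of_bool (p < N) - of_bool (q < N)) * band_entry r s \<alpha> k p q"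

lemma CD_mat_carrier [simp]: "CD_mat r s \<alpha> k N \<in> carrier_mat (r k + s k) (r k + s k)"
  and dim_CD_mat [simp]: "dim_row (CD_mat r s \<alpha> k N) = r k + s k"
    "dim_col (CD_mat r s \<alpha> k N) = r k + s k"
  by (simp_all add: CD_mat_def)

lemma dual_E_mat_carrier [simp]: "dual_E_mat r s \<alpha> k j N x \<in> carrier_mat (r k + s k) (r k + s k)"
  and dim_dual_E_mat [simp]: "dim_row (dual_E_mat r s \<alpha> k j N x) = r k + s k"
    "dim_col (dual_E_mat r s \<alpha> k j N x) = r k + s k"
  by (simp_all add: dual_E_mat_def msum_def)

lemma CD_mat_entry:
  assumes "i < r k + s k" "j < r k + s k"
  shows "CD_mat r s \<alpha> k N $$ (i, j) = cd_entry r s \<alpha> k N (N - int (r k) + int i) (N - int (s k) + int j)"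
  using assms by (auto simp: CD_mat_def cd_entry_def band_entry_def Let_def)

lemma cd_entry_outside:
  assumes "p \<notin> {N - int (r k)..<N + int (s k)} \<or> q \<notin> {N - int (s k)..<N + int (r k)}"
  shows "cd_entry r s \<alpha> k N p q = 0"
  using assms by (auto simp: cd_entry_def band_entry_def)

lemma sum_int_window:
  fixes F :: "int \<Rightarrow> complex"
  assumes "finite J" "{M..<M + int n} \<subseteq> J" "\<And>p. p \<notin> {M..<M + int n} \<Longrightarrow> F p = 0"
  shows "(\<Sum>p\<in>J. F p) = (\<Sum>i<n. F (M + int i))"
proof -
  have "(\<Sum>p\<in>J. F p) = (\<Sum>p\<in>{M..<M + int n}. F p)"
    using assms by (intro sum.mono_neutral_right) auto
  also have "\<dots> = (\<Sum>i<n. F (M + int i))"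
    by (rule sum.reindex_bij_witness[of _ "\<lambda>i. M + int i" "\<lambda>p. nat (p - M)"]) auto
  finally show ?thesis .
qed

lemma CD_mat_bilinear:
  assumes J: "finite J" "{N - int (r k)..<N + int (s k)} \<subseteq> J" "{N - int (s k)..<N + int (r k)} \<subseteq> J"
  shows "(\<Sum>p\<in>J. \<Sum>q\<in>J. u p * cd_entry r s \<alpha> k N p q * w q)
     = (\<Sum>i<r k + s k. \<Sum>j<r k + s k. u (N - int (r k) + int i) * CD_mat r s \<alpha> k N $$ (i, j)
          * w (N - int (s k) + int j))"
proof -
  have "(\<Sum>p\<in>J. \<Sum>q\<in>J. u p * cd_entry r s \<alpha> k N p q * w q)
      = (\<Sum>i<r k + s k. \<Sum>q\<in>J. u (N - int (r k) + int i) * cd_entry r s \<alpha> k N (N - int (r k) + int i) q * w q)"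
    by (rule sum_int_window) (use J in \<open>auto simp: cd_entry_outside\<close>)
  also have "\<dots> = (\<Sum>i<r k + s k. \<Sum>j<r k + s k. u (N - int (r k) + int i)
        * cd_entry r s \<alpha> k N (N - int (r k) + int i) (N - int (s k) + int j) * w (N - int (s k) + int j))"
    by (intro sum.cong refl sum_int_window) (use J in \<open>auto simp: cd_entry_outside\<close>)
  also have "\<dots> = (\<Sum>i<r k + s k. \<Sum>j<r k + s k. u (N - int (r k) + int i) * CD_mat r s \<alpha> k N $$ (i, j)
          * w (N - int (s k) + int j))"
    by (intro sum.cong refl) (simp add: CD_mat_entry)
  finally show ?thesis .
qed

text \<open>With \<open>T\<close>, \<open>Q\<close> the band matrices of \<open>j\<close>, \<open>k\<close> and \<open>\<Pi>\<close> the projection onto the indices below \<open>N\<close>,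
  the Christoffel--Darboux matrix is \<open>[\<Pi>, Q]\<close>, and the Jacobi identity gives
  \<open>[T, [\<Pi>, Q]] = [[T, \<Pi>], Q]\<close> since \<open>[T, Q]\<close> is a scalar. Sandwiched between a left and a right
  eigenvector of \<open>Q\<close>, the right-hand side vanishes; \<open>[T, \<Pi>]\<close> is supported near \<open>N\<close>, so local
  eigenvectors suffice.\<close>

lemma sandwiched_cd_commutes:
  fixes g f :: "int \<Rightarrow> complex" and r s :: "nat \<Rightarrow> nat" and k j :: nat and N :: int
  defines "w \<equiv> int (r k + s k + (r j + s j))"
  defines "J \<equiv> {N - 2 * w..N + 2 * w}"
  assumes supp: "\<And>n. n \<notin> {N - w..N + w} \<Longrightarrow> g n = 0" "\<And>n. n \<notin> {N - w..N + w} \<Longrightarrow> f n = 0"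
    and sol: "solves r s \<alpha> k x {N - int (s j)..<N + int (r j)} f"
    and cosol: "cosolves r s \<alpha> k x {N - int (r j)..<N + int (s j)} g"
    and comm: "\<And>a b. a \<noteq> b \<Longrightarrow> a \<in> {N - w..N + w} \<Longrightarrow> b \<in> {N - w..N + w} \<Longrightarrow>
       (\<Sum>p\<in>J. band_entry r s \<alpha> j a p * band_entry r s \<alpha> k p b)
         = (\<Sum>p\<in>J. band_entry r s \<alpha> k a p * band_entry r s \<alpha> j p b)"
  shows "(\<Sum>p\<in>J. \<Sum>q\<in>J. band_comult r s \<alpha> j g p * cd_entry r s \<alpha> k N p q * f q)
       = (\<Sum>p\<in>J. \<Sum>q\<in>J. g p * cd_entry r s \<alpha> k N p q * band_mult r s \<alpha> j f q)"
proof -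
  define t q where "t = band_entry r s \<alpha> j" and "q = band_entry r s \<alpha> k"
  define \<chi> :: "int \<Rightarrow> complex" where "\<chi> = (\<lambda>p. of_bool (p < N))"
  define A where "A = cd_entry r s \<alpha> k N"
  \<comment> \<open>The commutator of operator \<open>j\<close> with the projection.\<close>
  define X where "X = (\<lambda>a b. t a b * (\<chi> b - \<chi> a))"
  have fin: "finite J" by (simp add: J_def)
  have A: "A p b = (\<chi> p - \<chi> b) * q p b" for p b by (simp add: A_def \<chi>_def q_def cd_entry_def)
  have A_near: "p \<in> {N - w..N + w} \<and> b \<in> {N - w..N + w}" if "A p b \<noteq> 0" for p b
    using that by (auto simp: A_def w_def cd_entry_def band_entry_def of_bool_def split: if_splits)
  have L: "(\<Sum>p\<in>J. \<Sum>b\<in>J. band_comult r s \<alpha> j g p * A p b * f b)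
      = (\<Sum>p\<in>J. \<Sum>b\<in>J. \<Sum>a\<in>J. g a * t a p * A p b * f b)"
  proof (intro sum.cong refl)
    fix p b
    show "band_comult r s \<alpha> j g p * A p b * f b = (\<Sum>a\<in>J. g a * t a p * A p b * f b)"
    proof (cases "A p b = 0")
      case False
      then have "p \<in> {N - w..N + w}" using A_near by blast
      then have "{p - int (r j)..p + int (s j)} \<subseteq> J" by (auto simp: J_def w_def)
      note eq = sum_band_entry_left[where r = r and s = s and k = j and \<alpha> = \<alpha> and g = g, OF fin this]
      show ?thesis by (simp only: t_def sum_distrib_right eq[symmetric])
    qed simp
  qed
  have R: "(\<Sum>a\<in>J. \<Sum>p\<in>J. g a * A a p * band_mult r s \<alpha> j f p)
      = (\<Sum>a\<in>J. \<Sum>p\<in>J. \<Sum>b\<in>J. g a * A a p * t p b * f b)"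
  proof (intro sum.cong refl)
    fix a p
    show "g a * A a p * band_mult r s \<alpha> j f p = (\<Sum>b\<in>J. g a * A a p * t p b * f b)"
    proof (cases "A a p = 0")
      case False
      then have "p \<in> {N - w..N + w}" using A_near by blast
      then have "{p - int (s j)..p + int (r j)} \<subseteq> J" by (auto simp: J_def w_def)
      note eq = sum_band_entry[where r = r and s = s and k = j and \<alpha> = \<alpha> and f = f, OF fin this]
      show ?thesis by (simp only: t_def sum_distrib_left eq[symmetric] mult.assoc)
    qed simp
  qed
  \<comment> \<open>\<open>X\<close> links only indices on opposite sides of \<open>N\<close> within
    the band of \<open>j\<close>, so its column index stays where \<open>f\<close> solves the
    recurrence. In \<open>X2\<close> its row index likewise stays where \<open>g\<close>
    does.\<close>
  have X1: "(\<Sum>b\<in>J. g a * X a p * q p b * f b) = x * (g a * X a p * f p)" for a p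
  proof (cases "X a p = 0")
    case False
    then have p: "p \<in> {N - int (s j)..<N + int (r j)}"
      by (auto simp: X_def t_def \<chi>_def band_entry_def of_bool_def split: if_splits)
    then have "{p - int (s k)..p + int (r k)} \<subseteq> J" by (auto simp: J_def w_def)
    from sum_band_entry[where r = r and s = s and k = k and \<alpha> = \<alpha> and f = f, OF fin this]
    have "(\<Sum>b\<in>J. q p b * f b) = x * f p"
      using sol p by (simp add: q_def solves_def)
    then show ?thesis
      by (simp add: mult.assoc sum_distrib_left[symmetric])
  qed simp
  have X2: "(\<Sum>a\<in>J. g a * q a p * X p b * f b) = x * (g p * X p b * f b)" for p b
  proof (cases "X p b = 0")
    case False
    then have p: "p \<in> {N - int (r j)..<N + int (s j)}"
      by (auto simp: X_def t_def \<chi>_def band_entry_def of_bool_def split: if_splits)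
    then have "{p - int (r k)..p + int (s k)} \<subseteq> J" by (auto simp: J_def w_def)
    from sum_band_entry_left[where r = r and s = s and k = k and \<alpha> = \<alpha> and g = g, OF fin this]
    have "(\<Sum>a\<in>J. g a * q a p) = x * g p"
      using cosol p by (simp add: q_def cosolves_def)
    then show ?thesis
      by (simp add: sum_distrib_right[symmetric])
  qed simp
  \<comment> \<open>A scalar commutator suffices here: the factor \<open>\<chi> a - \<chi> b\<close>
    removes the diagonal, and off the diagonal the operators commute.\<close>
  have Z: "(\<Sum>p\<in>J. g a * f b * (\<chi> a - \<chi> b) * (t a p * q p b - q a p * t p b)) = 0" for a b
  proof (cases "g a = 0 \<or> f b = 0 \<or> a = b")
    case False
    then have "a \<in> {N - w..N + w}" "b \<in> {N - w..N + w}" using supp by blast+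
    with comm[of a b] False show ?thesis
      by (simp add: sum_distrib_left[symmetric] sum_subtractf t_def q_def)
  qed auto
  have "(\<Sum>p\<in>J. \<Sum>b\<in>J. \<Sum>a\<in>J. g a * t a p * A p b * f b)
      = (\<Sum>a\<in>J. \<Sum>p\<in>J. \<Sum>b\<in>J. g a * t a p * A p b * f b)"
    by (subst (2) sum.swap, subst (3) sum.swap) (rule refl)
  \<comment> \<open>The Jacobi identity, verified for each triple of indices. On the right the first
    two sums both equal \<open>x\<close> times the same form of \<open>X\<close> and cancel; the
    third vanishes by \<open>Z\<close>.\<close>
  moreover have "(\<Sum>a\<in>J. \<Sum>p\<in>J. \<Sum>b\<in>J. g a * t a p * A p b * f b)
       - (\<Sum>a\<in>J. \<Sum>p\<in>J. \<Sum>b\<in>J. g a * A a p * t p b * f b)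
     = (\<Sum>a\<in>J. \<Sum>p\<in>J. \<Sum>b\<in>J. g a * X a p * q p b * f b)
       - (\<Sum>a\<in>J. \<Sum>p\<in>J. \<Sum>b\<in>J. g a * q a p * X p b * f b)
       + (\<Sum>a\<in>J. \<Sum>p\<in>J. \<Sum>b\<in>J. g a * f b * (\<chi> a - \<chi> b) * (t a p * q p b - q a p * t p b))"
    unfolding sum_subtractf[symmetric] sum.distrib[symmetric]
    by (intro sum.cong refl) (simp add: A X_def algebra_simps)
  moreover have "(\<Sum>a\<in>J. \<Sum>p\<in>J. \<Sum>b\<in>J. g a * X a p * q p b * f b)
      = (\<Sum>a\<in>J. \<Sum>p\<in>J. x * (g a * X a p * f p))"
    by (simp only: X1)
  moreover have "(\<Sum>a\<in>J. \<Sum>p\<in>J. \<Sum>b\<in>J. g a * q a p * X p b * f b)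
      = (\<Sum>p\<in>J. \<Sum>b\<in>J. \<Sum>a\<in>J. g a * q a p * X p b * f b)"
    by (subst sum.swap, subst (2) sum.swap) (rule refl)
  moreover have "\<dots> = (\<Sum>p\<in>J. \<Sum>b\<in>J. x * (g p * X p b * f b))"
    by (simp only: X2)
  moreover have "(\<Sum>a\<in>J. \<Sum>p\<in>J. \<Sum>b\<in>J. g a * f b * (\<chi> a - \<chi> b) * (t a p * q p b - q a p * t p b))
      = (\<Sum>a\<in>J. \<Sum>b\<in>J. \<Sum>p\<in>J. g a * f b * (\<chi> a - \<chi> b) * (t a p * q p b - q a p * t p b))"
    by (intro sum.cong refl sum.swap)
  moreover have "\<dots> = 0" by (simp only: Z sum.neutral_const)
  ultimately show ?thesis
    unfolding A_def[symmetric] L R by simp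
qed

text \<open>Entry \<open>(i, e)\<close> results from sandwiching the commutator between the left
  solution with unit window at \<open>i\<close> and the right solution with unit window at
  \<open>e\<close>.\<close>

lemma dual_E_mat_CD_mat:
  assumes reg: "regular r s \<alpha> k {N - int (s j)..<N + int (r j)}"
    and coreg: "coregular r s \<alpha> k {N - int (r j)..<N + int (s j)}"
    and comm: "\<And>a b J. a \<noteq> b \<Longrightarrow> finite J
       \<Longrightarrow> {a - int (r k + s k + (r j + s j))..a + int (r k + s k + (r j + s j))} \<subseteq> J \<Longrightarrow>
       (\<Sum>p\<in>J. band_entry r s \<alpha> j a p * band_entry r s \<alpha> k p b)
         = (\<Sum>p\<in>J. band_entry r s \<alpha> k a p * band_entry r s \<alpha> j p b)"
  shows "dual_E_mat r s \<alpha> k j N x * CD_mat r s \<alpha> k N = CD_mat r s \<alpha> k N * E_mat r s \<alpha> k j N x"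
proof -
  let ?n = "r k + s k" and ?A = "CD_mat r s \<alpha> k N"
  let ?E = "E_mat r s \<alpha> k j N x" and ?D = "dual_E_mat r s \<alpha> k j N x"
  define w where "w = int (r k + s k + (r j + s j))"
  show ?thesis
  proof (rule eq_matI)
    fix i e assume "i < dim_row (?A * ?E)" "e < dim_col (?A * ?E)"
    then have i: "i < ?n" and e: "e < ?n" by auto
    obtain g0 where g0: "\<And>i'. i' < ?n \<Longrightarrow> g0 (N - int (r k) + int i') = (if i' = i then 1 else 0)"
        "cosolves r s \<alpha> k x {N - int (r j)..<N + int (s j)} g0"
        "\<And>i'. i' < ?n \<Longrightarrow> band_comult r s \<alpha> j g0 (N - int (r k) + int i') = ?D $$ (i, i')"
      using dual_solution_exists[OF coreg i] by metis
    obtain f0 where f0: "\<And>i'. i' < ?n \<Longrightarrow> f0 (N - int (s k) + int i') = (if i' = e then 1 else 0)"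
        "solves r s \<alpha> k x {N - int (s j)..<N + int (r j)} f0"
        "\<And>i'. i' < ?n \<Longrightarrow> band_mult r s \<alpha> j f0 (N - int (s k) + int i') = ?E $$ (i', e)"
      using primal_solution_exists[OF reg e] by metis
    \<comment> \<open>Cutting off gives the finite support that the sandwich requires; the cut is
      far enough out that no value entering the equations near \<open>N\<close> changes.\<close>
    define g where "g = (\<lambda>n. if n \<in> {N - w..N + w} then g0 n else 0)"
    define f where "f = (\<lambda>n. if n \<in> {N - w..N + w} then f0 n else 0)"
    have mult: "band_mult r s \<alpha> k' f n = band_mult r s \<alpha> k' f0 n"
      if "N - w + int (s k') \<le> n" "n \<le> N + w - int (r k')" for k' n
      unfolding band_mult_def using that by (intro sum.cong refl) (auto simp: f_def)
    have comult: "band_comult r s \<alpha> k' g n = band_comult r s \<alpha> k' g0 n"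
      if "N - w + int (r k') \<le> n" "n \<le> N + w - int (s k')" for k' n
      unfolding band_comult_def using that by (intro sum.cong refl) (auto simp: g_def)
    have sol: "solves r s \<alpha> k x {N - int (s j)..<N + int (r j)} f"
      unfolding solves_def
    proof
      fix n assume n: "n \<in> {N - int (s j)..<N + int (r j)}"
      then have "band_mult r s \<alpha> k f n = band_mult r s \<alpha> k f0 n"
        by (intro mult) (auto simp: w_def)
      moreover have "f n = f0 n" using n by (auto simp: f_def w_def)
      ultimately show "band_mult r s \<alpha> k f n = x * f n" using f0(2) n by (simp add: solves_def)
    qed
    have cosol: "cosolves r s \<alpha> k x {N - int (r j)..<N + int (s j)} g"
      unfolding cosolves_def
    proof
      fix n assume n: "n \<in> {N - int (r j)..<N + int (s j)}"
      then have "band_comult r s \<alpha> k g n = band_comult r s \<alpha> k g0 n"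
        by (intro comult) (auto simp: w_def)
      moreover have "g n = g0 n" using n by (auto simp: g_def w_def)
      ultimately show "band_comult r s \<alpha> k g n = x * g n" using g0(2) n by (simp add: cosolves_def)
    qed
    have *: "(\<Sum>p\<in>{N - 2 * w..N + 2 * w}. \<Sum>q\<in>{N - 2 * w..N + 2 * w}.
             band_comult r s \<alpha> j g p * cd_entry r s \<alpha> k N p q * f q)
        = (\<Sum>p\<in>{N - 2 * w..N + 2 * w}. \<Sum>q\<in>{N - 2 * w..N + 2 * w}.
             g p * cd_entry r s \<alpha> k N p q * band_mult r s \<alpha> j f q)"
      unfolding w_def
      by (rule sandwiched_cd_commutes[OF _ _ sol cosol comm]) (auto simp: g_def f_def w_def)
    have gw: "g (N - int (r k) + int i') = (if i' = i then 1 else 0)"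
         "band_comult r s \<alpha> j g (N - int (r k) + int i') = ?D $$ (i, i')" if "i' < ?n" for i'
    proof -
      show "g (N - int (r k) + int i') = (if i' = i then 1 else 0)"
        using that g0(1)[OF that] by (auto simp: g_def w_def)
      have "band_comult r s \<alpha> j g (N - int (r k) + int i') = band_comult r s \<alpha> j g0 (N - int (r k) + int i')"
        using that by (intro comult) (auto simp: w_def)
      then show "band_comult r s \<alpha> j g (N - int (r k) + int i') = ?D $$ (i, i')"
        using g0(3)[OF that] by simp
    qed
    have fw: "f (N - int (s k) + int i') = (if i' = e then 1 else 0)"
         "band_mult r s \<alpha> j f (N - int (s k) + int i') = ?E $$ (i', e)" if "i' < ?n" for i'
    proof -
      show "f (N - int (s k) + int i') = (if i' = e then 1 else 0)"
        using that f0(1)[OF that] by (auto simp: f_def w_def)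
      have "band_mult r s \<alpha> j f (N - int (s k) + int i') = band_mult r s \<alpha> j f0 (N - int (s k) + int i')"
        using that by (intro mult) (auto simp: w_def)
      then show "band_mult r s \<alpha> j f (N - int (s k) + int i') = ?E $$ (i', e)"
        using f0(3)[OF that] by simp
    qed
    have J: "{N - int (r k)..<N + int (s k)} \<subseteq> {N - 2 * w..N + 2 * w}"
            "{N - int (s k)..<N + int (r k)} \<subseteq> {N - 2 * w..N + 2 * w}"
      by (auto simp: w_def)
    have "(\<Sum>i'<?n. \<Sum>j'<?n. ?D $$ (i, i') * ?A $$ (i', j') * (if j' = e then 1 else 0))
        = (\<Sum>i'<?n. \<Sum>j'<?n. (if i' = i then 1 else 0) * ?A $$ (i', j') * ?E $$ (j', e))"
      using * unfolding CD_mat_bilinear[where r = r and s = s and k = k and N = N, OF finite_atLeastAtMost_int J] by (simp add: gw fw)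
    moreover have "(\<Sum>i'<?n. \<Sum>j'<?n. ?D $$ (i, i') * ?A $$ (i', j') * (if j' = e then 1 else 0))
        = (?D * ?A) $$ (i, e)"
      using e i by (simp add: scalar_prod_def if_distrib[of "\<lambda>t. _ * t"] atLeast0LessThan cong: if_cong)
    moreover have "(\<Sum>i'<?n. \<Sum>j'<?n. (if i' = i then 1 else 0) * ?A $$ (i', j') * ?E $$ (j', e))
        = (?A * ?E) $$ (i, e)"
    proof -
      have "(\<Sum>i'<?n. \<Sum>j'<?n. (if i' = i then 1 else 0) * ?A $$ (i', j') * ?E $$ (j', e))
          = (\<Sum>i'<?n. if i' = i then \<Sum>j'<?n. ?A $$ (i, j') * ?E $$ (j', e) else 0)"
        by (intro sum.cong refl) simp
      then show ?thesis
        using e i by (simp add: scalar_prod_def atLeast0LessThan)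
    qed
    ultimately show "(?D * ?A) $$ (i, e) = (?A * ?E) $$ (i, e)" by simp
  qed auto
qed

section \<open>Invertibility of the Christoffel-Darboux matrix and equality of characteristic
  polynomials\<close>

lemma det_CD_mat:
  assumes "\<And>i. i < r k \<Longrightarrow> \<alpha> k (int (r k)) (N - int (r k) + int i) \<noteq> 0"
    and "\<And>i. i < s k \<Longrightarrow> \<alpha> k (- int (s k)) (N + int i) \<noteq> 0"
  shows "det (CD_mat r s \<alpha> k N) \<noteq> 0"
proof -
  let ?n = "s k + r k"
  \<comment> \<open>The rows with \<open>p \<ge> N\<close> are moved to the front. Then the lower
    band edge runs along the diagonal of the first block and the upper edge along that of the
    second.\<close>
  define \<rho> where "\<rho> = (\<lambda>i. if i < s k then r k + i else i - s k)"
  define G where "G = (\<lambda>i j. cd_entry r s \<alpha> k N (N - int (r k) + int i) (N - int (s k) + int j))"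
  have bij: "bij_betw \<rho> {0..<?n} {0..<?n}"
    by (rule bij_betw_byWitness[where f' = "\<lambda>i. if i < r k then s k + i else i - r k"])
       (auto simp: \<rho>_def)
  have "CD_mat r s \<alpha> k N = mat ?n ?n (\<lambda>(i, j). G i j)"
    by (intro eq_matI) (simp_all add: CD_mat_entry G_def)
  moreover obtain \<epsilon> :: complex where "\<epsilon> \<noteq> 0"
      "det (mat ?n ?n (\<lambda>(i, j). G i j)) = \<epsilon> * det (mat ?n ?n (\<lambda>(i, j). G (\<rho> i) j))"
    using det_relabel_rows[OF bij_betw_id[unfolded id_def] bij] by blast
  moreover have "det (mat ?n ?n (\<lambda>(i, j). G (\<rho> i) j)) = (\<Prod>i<?n. G (\<rho> i) i)"
    by (rule det_block_triangular) (auto simp: G_def \<rho>_def cd_entry_def band_entry_def)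
  moreover have "G (\<rho> i) i \<noteq> 0" if "i < ?n" for i
  proof (cases "i < s k")
    case True
    then show ?thesis
      using assms(2)[OF True] by (simp add: G_def \<rho>_def cd_entry_def band_entry_def)
  next
    case False
    then have "i - s k < r k" using that by auto
    from assms(1)[OF this] False that show ?thesis
      by (auto simp: G_def \<rho>_def cd_entry_def band_entry_def of_nat_diff algebra_simps)
  qed
  ultimately show ?thesis by simp
qed

lemma det_eq_of_intertwined:
  fixes A B C :: "complex mat"
  assumes A: "A \<in> carrier_mat n n" and B: "B \<in> carrier_mat n n" and C: "C \<in> carrier_mat n n"
    and d: "det C \<noteq> 0" and eq: "B * C = C * A"
  shows "det (y \<cdot>\<^sub>m 1\<^sub>m n - A) = det (y \<cdot>\<^sub>m 1\<^sub>m n - B)"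
proof -
  have Y: "y \<cdot>\<^sub>m 1\<^sub>m n \<in> carrier_mat n n" by simp
  have "C * (y \<cdot>\<^sub>m 1\<^sub>m n - A) = C * (y \<cdot>\<^sub>m 1\<^sub>m n) - C * A"
    by (rule mult_minus_distrib_mat[OF C Y A])
  also have "\<dots> = (y \<cdot>\<^sub>m 1\<^sub>m n) * C - B * C"
    using C by (simp add: eq mult_smult_distrib[OF C one_carrier_mat] mult_smult_assoc_mat[OF one_carrier_mat C])
  also have "\<dots> = (y \<cdot>\<^sub>m 1\<^sub>m n - B) * C"
    by (rule minus_mult_distrib_mat[symmetric, OF Y B C])
  finally have "det (C * (y \<cdot>\<^sub>m 1\<^sub>m n - A)) = det ((y \<cdot>\<^sub>m 1\<^sub>m n - B) * C)" by simp
  moreover have "det (C * (y \<cdot>\<^sub>m 1\<^sub>m n - A)) = det C * det (y \<cdot>\<^sub>m 1\<^sub>m n - A)"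
    using A by (intro det_mult[OF C]) auto
  moreover have "det ((y \<cdot>\<^sub>m 1\<^sub>m n - B) * C) = det (y \<cdot>\<^sub>m 1\<^sub>m n - B) * det C"
    using B by (intro det_mult[OF _ C]) auto
  ultimately show ?thesis using d by simp
qed

section \<open>Integration along contours\<close>

lemma contour_curve:
  assumes "contour \<Gamma>" "i < length \<Gamma>"
  shows "snd (\<Gamma> ! i) piecewise_C1_differentiable_on {a..b}"
  using assms by (auto simp: contour_def dest!: nth_mem split: prod.splits) (metis prod.collapse)

lemma sigma_finite_contour_param: "sigma_finite_measure (contour_param \<Gamma>)"
proof -
  interpret C: sigma_finite_measure "count_space {..<length \<Gamma>}"
    by (rule sigma_finite_measure_count_space_finite) simp
  interpret P: pair_sigma_finite "count_space {..<length \<Gamma>}" lborel ..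
  show ?thesis unfolding contour_param_def by (rule P.sigma_finite_measure_axioms)
qed

text \<open>Counting measure has no nonempty null sets, so the integrability that Fubini gives
  almost everywhere holds for each single curve.\<close>

lemma contour_param_integral:
  fixes F :: "nat \<times> real \<Rightarrow> complex"
  assumes "integrable (contour_param \<Gamma>) F"
  shows "\<And>i. i < length \<Gamma> \<Longrightarrow> integrable lborel (\<lambda>t. F (i, t))"
    and "integral\<^sup>L (contour_param \<Gamma>) F = (\<Sum>i<length \<Gamma>. \<integral>t. F (i, t) \<partial>lborel)"
proof -
  interpret C: sigma_finite_measure "count_space {..<length \<Gamma>}"
    by (rule sigma_finite_measure_count_space_finite) simp
  interpret P: pair_sigma_finite "count_space {..<length \<Gamma>}" lborel ..
  note int = assms[unfolded contour_param_def]
  show "\<And>i. i < length \<Gamma> \<Longrightarrow> integrable lborel (\<lambda>t. F (i, t))"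
    using P.AE_integrable_fst'[OF int] by (simp add: AE_count_space)
  show "integral\<^sup>L (contour_param \<Gamma>) F = (\<Sum>i<length \<Gamma>. \<integral>t. F (i, t) \<partial>lborel)"
    unfolding contour_param_def P.integral_fst'[OF int, symmetric]
    by (simp add: lebesgue_integral_count_space_finite)
qed

lemma cint_linear:
  assumes "cconverges \<Gamma> f" "cconverges \<Gamma> g"
  shows "cconverges \<Gamma> (\<lambda>y. f y + g y)" "cint \<Gamma> (\<lambda>y. f y + g y) = cint \<Gamma> f + cint \<Gamma> g"
    "cconverges \<Gamma> (\<lambda>y. a * f y)" "cint \<Gamma> (\<lambda>y. a * f y) = a * cint \<Gamma> f"
  using assms by (simp_all add: cconverges_def cint_def distrib_right mult.assoc)

lemma cint_zero: "cconverges \<Gamma> (\<lambda>y. 0)" "cint \<Gamma> (\<lambda>y. 0) = 0"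
  by (simp_all add: cconverges_def cint_def)

lemma no_boundary_term_linear:
  assumes "no_boundary_term \<Gamma> f" "no_boundary_term \<Gamma> g"
  shows "no_boundary_term \<Gamma> (\<lambda>y. f y + g y)" "no_boundary_term \<Gamma> (\<lambda>y. a * f y)"
proof -
  have "(\<Sum>(c, \<gamma>)\<leftarrow>\<Gamma>. c * ((f (\<gamma> T) + g (\<gamma> T)) - (f (\<gamma> (- T)) + g (\<gamma> (- T)))))
      = (\<Sum>(c, \<gamma>)\<leftarrow>\<Gamma>. c * (f (\<gamma> T) - f (\<gamma> (- T)))) + (\<Sum>(c, \<gamma>)\<leftarrow>\<Gamma>. c * (g (\<gamma> T) - g (\<gamma> (- T))))" for T
    by (induction \<Gamma>) (auto simp: algebra_simps)
  with assms show "no_boundary_term \<Gamma> (\<lambda>y. f y + g y)"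
    unfolding no_boundary_term_def using tendsto_add by fastforce
  have "(\<Sum>(c, \<gamma>)\<leftarrow>\<Gamma>. c * (a * f (\<gamma> T) - a * f (\<gamma> (- T))))
      = a * (\<Sum>(c, \<gamma>)\<leftarrow>\<Gamma>. c * (f (\<gamma> T) - f (\<gamma> (- T))))" for T
    by (induction \<Gamma>) (auto simp: algebra_simps)
  with assms(1) show "no_boundary_term \<Gamma> (\<lambda>y. a * f y)"
    unfolding no_boundary_term_def using tendsto_mult_right_zero by fastforce
qed

lemma no_boundary_term_zero: "no_boundary_term \<Gamma> (\<lambda>y. 0)"
proof -
  have "(\<Sum>(c :: complex, \<gamma> :: real \<Rightarrow> complex)\<leftarrow>\<Gamma>. c * (0 - 0)) = 0"
    by (induction \<Gamma>) auto
  then show ?thesis by (simp add: no_boundary_term_def)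
qed

lemma integral_derivative_along_curve:
  fixes F :: "complex \<Rightarrow> complex"
  assumes \<gamma>: "\<And>a b. \<gamma> piecewise_C1_differentiable_on {a..b :: real}"
    and F: "\<And>z. (F has_field_derivative F' z) (at z)" and "a \<le> b"
  shows "((\<lambda>t. F' (\<gamma> t) * vector_derivative \<gamma> (at t)) has_integral (F (\<gamma> b) - F (\<gamma> a))) {a..b}"
proof -
  obtain S where S: "finite S" "\<gamma> C1_differentiable_on {a..b} - S" and cont: "continuous_on {a..b} \<gamma>"
    using \<gamma>[of a b] by (auto simp: piecewise_C1_differentiable_on_def)
  show ?thesis
  proof (rule fundamental_theorem_of_calculus_interior_strong[OF S(1) \<open>a \<le> b\<close>, where f = "\<lambda>t. F (\<gamma> t)"])
    fix t assume t: "t \<in> {a<..<b} - S"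
    then have "(\<gamma> has_vector_derivative vector_derivative \<gamma> (at t)) (at t)"
      using S(2) by (auto simp: C1_differentiable_on_eq vector_derivative_works)
    from field_vector_diff_chain_at[OF this F]
    show "((\<lambda>t. F (\<gamma> t)) has_vector_derivative F' (\<gamma> t) * vector_derivative \<gamma> (at t)) (at t)"
      by (simp add: o_def mult.commute)
  next
    have "continuous_on UNIV F"
      using F DERIV_isCont continuous_at_imp_continuous_on by blast
    then show "continuous_on {a..b} (\<lambda>t. F (\<gamma> t))"
      by (rule continuous_on_compose2[OF _ cont]) auto
  qed
qed

lemma tendsto_integral_symmetric_interval:
  fixes f :: "real \<Rightarrow> complex"
  assumes f: "integrable lborel f"
  shows "((\<lambda>T. integral {- T..T} f) \<longlongrightarrow> integral\<^sup>L lborel f) at_top"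
proof -
  have "((\<lambda>T. \<integral>t. indicator {- T..T} t *\<^sub>R f t \<partial>lborel) \<longlongrightarrow> integral\<^sup>L lborel f) at_top"
  proof (rule integral_dominated_convergence_at_top[where w = "\<lambda>t. norm (f t)"])
    show "AE t in lborel. ((\<lambda>T. indicator {- T..T} t *\<^sub>R f t) \<longlongrightarrow> f t) at_top"
    proof (rule AE_I2)
      fix t :: real
      have "\<forall>\<^sub>F T in at_top. indicator {- T..T} t *\<^sub>R f t = f t"
        using eventually_ge_at_top[of "\<bar>t\<bar>"] by eventually_elim (auto simp: indicator_def abs_le_iff)
      then show "((\<lambda>T. indicator {- T..T} t *\<^sub>R f t) \<longlongrightarrow> f t) at_top"
        by (rule tendsto_eventually)
    qed
    show "\<forall>\<^sub>F T in at_top. AE t in lborel. norm (indicator {- T..T} t *\<^sub>R f t) \<le> norm (f t)"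
      by (intro always_eventually allI AE_I2) (simp add: indicator_def)
  qed (use f in auto)
  moreover have "(\<integral>t. indicator {- T..T} t *\<^sub>R f t \<partial>lborel) = integral {- T..T} f" for T
  proof -
    have "set_integrable lborel {- T..T} f"
      using f unfolding set_integrable_def by (intro integrable_mult_indicator) auto
    from set_borel_integral_eq_integral(2)[OF this] show ?thesis
      by (simp add: set_lebesgue_integral_def)
  qed
  ultimately show ?thesis by simp
qed

text \<open>Over \<open>{- T..T}\<close> the integral equals the boundary terms, and absolute
  convergence makes it tend to the full integral. The curves are summed before the limit, since the
  boundary terms are only assumed to cancel in total.\<close>

lemma cint_derivative_eq_0:
  assumes \<Gamma>: "contour \<Gamma>" and F: "\<And>z. (F has_field_derivative F' z) (at z)"
    and conv: "cconverges \<Gamma> F'" and bd: "no_boundary_term \<Gamma> F"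
  shows "cint \<Gamma> F' = 0"
proof -
  let ?f = "\<lambda>i t. F' (contour_point \<Gamma> (i, t)) * contour_speed \<Gamma> (i, t)"
  note int = contour_param_integral[OF conv[unfolded cconverges_def]]
  have eq: "integral {- T..T} (?f i)
      = fst (\<Gamma> ! i) * (F (snd (\<Gamma> ! i) T) - F (snd (\<Gamma> ! i) (- T)))"
    if "i < length \<Gamma>" "0 \<le> T" for i T
  proof -
    have "((\<lambda>t. fst (\<Gamma> ! i) * (F' (snd (\<Gamma> ! i) t) * vector_derivative (snd (\<Gamma> ! i)) (at t)))
       has_integral fst (\<Gamma> ! i) * (F (snd (\<Gamma> ! i) T) - F (snd (\<Gamma> ! i) (- T)))) {- T..T}"
      using that by (intro has_integral_mult_right integral_derivative_along_curve F contour_curve[OF \<Gamma>]) auto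
    then have "(?f i has_integral fst (\<Gamma> ! i) * (F (snd (\<Gamma> ! i) T) - F (snd (\<Gamma> ! i) (- T)))) {- T..T}"
      by (rule has_integral_eq[rotated]) (simp add: contour_point_def contour_speed_def)
    then show ?thesis by (rule integral_unique)
  qed
  have "((\<lambda>T. \<Sum>i<length \<Gamma>. integral {- T..T} (?f i)) \<longlongrightarrow> (\<Sum>i<length \<Gamma>. integral\<^sup>L lborel (?f i))) at_top"
    by (intro tendsto_sum tendsto_integral_symmetric_interval int(1)) auto
  also have "(\<Sum>i<length \<Gamma>. integral\<^sup>L lborel (?f i)) = cint \<Gamma> F'"
    by (simp add: cint_def int(2))
  finally have 1: "((\<lambda>T. \<Sum>i<length \<Gamma>. integral {- T..T} (?f i)) \<longlongrightarrow> cint \<Gamma> F') at_top" .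
  have "\<forall>\<^sub>F T in at_top. (\<Sum>i<length \<Gamma>. integral {- T..T} (?f i))
      = (\<Sum>(c, \<gamma>)\<leftarrow>\<Gamma>. c * (F (\<gamma> T) - F (\<gamma> (- T))))"
    using eventually_ge_at_top[of 0]
  proof eventually_elim
    case (elim T)
    have "(\<Sum>(c, \<gamma>)\<leftarrow>\<Gamma>. c * (F (\<gamma> T) - F (\<gamma> (- T))))
        = (\<Sum>i<length \<Gamma>. fst (\<Gamma> ! i) * (F (snd (\<Gamma> ! i) T) - F (snd (\<Gamma> ! i) (- T))))"
      by (simp add: sum_list_sum_nth atLeast0LessThan split_beta)
    also have "\<dots> = (\<Sum>i<length \<Gamma>. integral {- T..T} (?f i))"
      by (intro sum.cong refl) (simp add: eq[OF _ elim])
    finally show ?case ..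
  qed
  from Lim_transform_eventually[OF 1 this] bd
  show ?thesis
    unfolding no_boundary_term_def by (rule tendsto_unique[rotated]) simp
qed


subsection \<open>Differentiation of Laplace-type integrals\<close>

text \<open>Provides a dominating function made of exponentials, whose integrals converge at every
  exponent: for suitable signs, one of the four corners has exponent with real part
  \<open>2 * \<bar>Re y\<bar> + 2 * \<bar>Im y\<bar>\<close>.\<close>

lemma exp_norm_le_sum:
  fixes y :: complex
  shows "exp (2 * norm y) \<le> norm (exp (Complex 2 2 * y)) + norm (exp (Complex 2 (-2) * y))
           + norm (exp (Complex (-2) 2 * y)) + norm (exp (Complex (-2) (-2) * y))"
proof -
  have "2 * norm y \<le> 2 * \<bar>Re y\<bar> + 2 * \<bar>Im y\<bar>"
    using cmod_le[of y] by simp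
  then have "exp (2 * norm y) \<le> exp (2 * \<bar>Re y\<bar> + 2 * \<bar>Im y\<bar>)" by simp
  moreover have "exp (2 * \<bar>Re y\<bar> + 2 * \<bar>Im y\<bar>) \<in> {norm (exp (Complex 2 2 * y)), norm (exp (Complex 2 (-2) * y)),
      norm (exp (Complex (-2) 2 * y)), norm (exp (Complex (-2) (-2) * y))}"
    by (cases "0 \<le> Re y"; cases "0 \<le> Im y") simp_all
  moreover have "0 \<le> norm (exp (Complex a b * y))" for a b by simp
  ultimately show ?thesis
    by (smt (verit, del_insts) insert_iff singletonD)
qed

text \<open>The rate 2 in the exponential combines one \<open>norm y\<close> from the Taylor
  remainder with one from bounding the square of \<open>norm y\<close> by an exponential.\<close>

lemma norm_exp_remainder_le:
  fixes y u :: complex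
  assumes "norm u \<le> 1"
  shows "norm (exp (u * y) - 1 - u * y) \<le> 2 * (norm u)\<^sup>2 * exp (2 * norm y)"
proof -
  have "norm (exp (u * y) - (\<Sum>i\<le>1. (u * y) ^ i / fact i))
      \<le> exp \<bar>Re (u * y)\<bar> * norm (u * y) ^ Suc 1 / fact 1"
    by (rule Taylor_exp)
  then have "norm (exp (u * y) - 1 - u * y) \<le> exp \<bar>Re (u * y)\<bar> * ((norm u)\<^sup>2 * (norm y)\<^sup>2)"
    by (simp add: algebra_simps power2_eq_square norm_mult)
  also have "\<dots> \<le> exp (norm y) * ((norm u)\<^sup>2 * (2 * exp (norm y)))"
  proof (intro mult_mono order.refl)
    have "\<bar>Re (u * y)\<bar> \<le> norm u * norm y" by (metis abs_Re_le_cmod norm_mult)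
    also have "\<dots> \<le> norm y" using assms by (simp add: mult_left_le_one_le)
    finally show "exp \<bar>Re (u * y)\<bar> \<le> exp (norm y)" by simp
    have "1 + norm y + (norm y)\<^sup>2 / 2 \<le> exp (norm y)"
      by (rule exp_lower_Taylor_quadratic) simp
    moreover have "0 \<le> norm y" by simp
    ultimately show "(norm y)\<^sup>2 \<le> 2 * exp (norm y)" by linarith
  qed auto
  also have "\<dots> = 2 * (norm u)\<^sup>2 * exp (2 * norm y)"
    by (simp add: mult_exp_exp algebra_simps)
  finally show ?thesis .
qed

lemma has_field_derivative_of_quadratic_remainder:
  fixes f :: "complex \<Rightarrow> complex"
  assumes "\<And>u. norm u \<le> 1 \<Longrightarrow> norm (f (x + u) - f x - u * d) \<le> C * (norm u)\<^sup>2"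
  shows "(f has_field_derivative d) (at x)"
proof -
  have "((\<lambda>u. (f (x + u) - f x) / u - d) \<longlongrightarrow> 0) (at 0)"
  proof (rule Lim_null_comparison)
    have "\<forall>\<^sub>F u in at 0. u \<noteq> (0 :: complex) \<and> norm u \<le> 1"
      unfolding eventually_at by (intro exI[of _ 1]) (auto simp: dist_norm)
    then show "\<forall>\<^sub>F u in at 0. norm ((f (x + u) - f x) / u - d) \<le> C * norm u"
    proof eventually_elim
      case (elim u)
      then have "norm ((f (x + u) - f x) / u - d) = norm (f (x + u) - f x - u * d) / norm u"
        by (simp add: field_simps flip: norm_divide)
      also have "\<dots> \<le> C * (norm u)\<^sup>2 / norm u"
        using assms[of u] elim by (intro divide_right_mono) auto
      also have "\<dots> = C * norm u" by (simp add: power2_eq_square)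
      finally show ?case .
    qed
    have "((\<lambda>u :: complex. C * norm u) \<longlongrightarrow> C * norm (0 :: complex)) (at 0)"
      by (intro tendsto_intros)
    then show "((\<lambda>u :: complex. C * norm u) \<longlongrightarrow> 0) (at 0)" by simp
  qed
  then show ?thesis
    unfolding DERIV_def by (simp add: LIM_zero_iff)
qed

text \<open>The second-order remainder is at most a constant times the square of
  \<open>norm u\<close>; the constant is twice the integral of \<open>W\<close>, finite by
  convergence at four shifted exponents. The derivative then follows with no exchange of
  limits.\<close>

lemma has_field_derivative_cint_exp:
  assumes conv: "\<And>x. cconverges \<Gamma> (\<lambda>y. g y * exp (x * y))"
    and conv': "\<And>x. cconverges \<Gamma> (\<lambda>y. y * g y * exp (x * y))"
  shows "((\<lambda>x. cint \<Gamma> (\<lambda>y. g y * exp (x * y))) has_field_derivative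
           cint \<Gamma> (\<lambda>y. y * g y * exp (x * y))) (at x)"
proof -
  let ?M = "contour_param \<Gamma>" and ?p = "contour_point \<Gamma>" and ?v = "contour_speed \<Gamma>"
  define w where "w = (\<lambda>z p. norm (g (?p p) * exp ((x + z) * ?p p) * ?v p))"
  define W where "W = (\<lambda>p. w (Complex 2 2) p + w (Complex 2 (-2)) p + w (Complex (-2) 2) p + w (Complex (-2) (-2)) p)"
  have w_int: "integrable ?M (w z)" for z
    using conv[of "x + z"] unfolding cconverges_def w_def by (rule integrable_norm)
  then have W_int: "integrable ?M W" by (simp add: W_def)
  show ?thesis
  proof (rule has_field_derivative_of_quadratic_remainder[where C = "2 * integral\<^sup>L ?M W"])
    fix u :: complex assume u: "norm u \<le> 1"
    let ?r = "\<lambda>p. g (?p p) * exp ((x + u) * ?p p) * ?v p - g (?p p) * exp (x * ?p p) * ?v p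
                   - u * (?p p * g (?p p) * exp (x * ?p p) * ?v p)"
    have ints: "integrable ?M (\<lambda>p. g (?p p) * exp (z * ?p p) * ?v p)"
        "integrable ?M (\<lambda>p. ?p p * g (?p p) * exp (z * ?p p) * ?v p)" for z
      using conv[of z] conv'[of z] by (simp_all add: cconverges_def)
    have bound: "norm (?r p) \<le> 2 * (norm u)\<^sup>2 * W p" for p
    proof -
      let ?y = "?p p"
      have e: "exp ((x + u) * ?y) = exp (x * ?y) * exp (u * ?y)"
        by (simp add: distrib_right exp_add)
      have "?r p = g ?y * exp (x * ?y) * ?v p * (exp (u * ?y) - 1 - u * ?y)"
        unfolding e by (simp add: algebra_simps)
      then have "norm (?r p) = norm (g ?y * exp (x * ?y) * ?v p) * norm (exp (u * ?y) - 1 - u * ?y)"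
        by (simp only: norm_mult)
      also have "\<dots> \<le> norm (g ?y * exp (x * ?y) * ?v p) * (2 * (norm u)\<^sup>2 *
          (norm (exp (Complex 2 2 * ?y)) + norm (exp (Complex 2 (-2) * ?y))
           + norm (exp (Complex (-2) 2 * ?y)) + norm (exp (Complex (-2) (-2) * ?y))))"
        by (intro mult_left_mono order.trans[OF norm_exp_remainder_le[OF u]] exp_norm_le_sum) auto
      also have "\<dots> = 2 * (norm u)\<^sup>2 * W p"
        by (simp add: W_def w_def norm_mult distrib_right exp_add algebra_simps del: norm_exp_eq_Re)
      finally show ?thesis .
    qed
    have eq: "cint \<Gamma> (\<lambda>y. g y * exp ((x + u) * y)) - cint \<Gamma> (\<lambda>y. g y * exp (x * y))
          - u * cint \<Gamma> (\<lambda>y. y * g y * exp (x * y)) = integral\<^sup>L ?M ?r"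
      unfolding cint_def using ints by simp
    have "norm (integral\<^sup>L ?M ?r) \<le> (\<integral>p. norm (?r p) \<partial>?M)"
      by (rule integral_norm_bound)
    also have "\<dots> \<le> (\<integral>p. 2 * (norm u)\<^sup>2 * W p \<partial>?M)"
    proof (rule integral_mono[OF _ _ bound])
      show "integrable ?M (\<lambda>p. norm (?r p))"
        by (intro integrable_norm Bochner_Integration.integrable_diff integrable_mult_right ints)
      show "integrable ?M (\<lambda>p. 2 * (norm u)\<^sup>2 * W p)"
        by (intro integrable_mult_right W_int)
    qed
    also have "\<dots> = 2 * integral\<^sup>L ?M W * (norm u)\<^sup>2" by simp
    finally show "norm (cint \<Gamma> (\<lambda>y. g y * exp ((x + u) * y)) - cint \<Gamma> (\<lambda>y. g y * exp (x * y))
          - u * cint \<Gamma> (\<lambda>y. y * g y * exp (x * y))) \<le> 2 * integral\<^sup>L ?M W * (norm u)\<^sup>2"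
      unfolding eq .
  qed
qed

section \<open>Fubini for product measures\<close>

lemma (in product_sigma_finite) distr_PiM_insert:
  assumes I: "finite I" "i \<notin> I"
  shows "distr (Pi\<^sub>M I M \<Otimes>\<^sub>M M i) (Pi\<^sub>M (insert i I) M) (\<lambda>(x, y). x(i := y)) = Pi\<^sub>M (insert i I) M"
proof (rule measure_eqI)
  interpret I: finite_product_sigma_finite M I by standard fact
  let ?f = "\<lambda>(x, y). x(i := y)"
  have f: "?f \<in> measurable (Pi\<^sub>M I M \<Otimes>\<^sub>M M i) (Pi\<^sub>M (insert i I) M)"
    by (rule measurable_add_dim)
  fix A assume "A \<in> sets (distr (Pi\<^sub>M I M \<Otimes>\<^sub>M M i) (Pi\<^sub>M (insert i I) M) ?f)"
  then have A [measurable]: "A \<in> sets (Pi\<^sub>M (insert i I) M)" by simp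
  have ind: "(\<lambda>z. indicator A (?f z) :: ennreal) \<in> borel_measurable (Pi\<^sub>M I M \<Otimes>\<^sub>M M i)"
    using f A by measurable
  have "emeasure (Pi\<^sub>M (insert i I) M) A = (\<integral>\<^sup>+ z. indicator A z \<partial>Pi\<^sub>M (insert i I) M)"
    by simp
  also have "\<dots> = (\<integral>\<^sup>+ x. (\<integral>\<^sup>+ y. indicator A (x(i := y)) \<partial>M i) \<partial>Pi\<^sub>M I M)"
    by (rule product_nn_integral_insert[OF I]) measurable
  also have "\<dots> = (\<integral>\<^sup>+ z. indicator A (?f z) \<partial>(Pi\<^sub>M I M \<Otimes>\<^sub>M M i))"
    using sigma_finite_measure.nn_integral_fst[OF sigma_finite_measures ind] by simp
  also have "\<dots> = (\<integral>\<^sup>+ z. indicator A z \<partial>distr (Pi\<^sub>M I M \<Otimes>\<^sub>M M i) (Pi\<^sub>M (insert i I) M) ?f)"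
    by (rule nn_integral_distr[OF f, symmetric]) measurable
  finally show "emeasure (distr (Pi\<^sub>M I M \<Otimes>\<^sub>M M i) (Pi\<^sub>M (insert i I) M) ?f) A
      = emeasure (Pi\<^sub>M (insert i I) M) A"
    by simp
qed simp

text \<open>The new coordinate is integrated last, matching the nested transforms, in which the
  highest variable is outermost.\<close>

lemma (in product_sigma_finite) integral_PiM_insert_outer:
  fixes f :: "_ \<Rightarrow> _ :: {banach, second_countable_topology}"
  assumes I: "finite I" "i \<notin> I" and f: "integrable (Pi\<^sub>M (insert i I) M) f"
  shows "AE y in M i. integrable (Pi\<^sub>M I M) (\<lambda>x. f (x(i := y)))"
    and "integrable (M i) (\<lambda>y. \<integral>x. f (x(i := y)) \<partial>Pi\<^sub>M I M)"
    and "integral\<^sup>L (Pi\<^sub>M (insert i I) M) f = (\<integral>y. (\<integral>x. f (x(i := y)) \<partial>Pi\<^sub>M I M) \<partial>M i)"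
proof -
  interpret I: finite_product_sigma_finite M I by standard fact
  interpret P: pair_sigma_finite "Pi\<^sub>M I M" "M i" ..
  let ?f = "\<lambda>(x, y). x(i := y)"
  have meas: "?f \<in> measurable (Pi\<^sub>M I M \<Otimes>\<^sub>M M i) (Pi\<^sub>M (insert i I) M)"
    by (rule measurable_add_dim)
  have "integrable (distr (Pi\<^sub>M I M \<Otimes>\<^sub>M M i) (Pi\<^sub>M (insert i I) M) ?f) f"
    using f by (simp add: distr_PiM_insert[OF I])
  then have int: "integrable (Pi\<^sub>M I M \<Otimes>\<^sub>M M i) (case_prod (\<lambda>x y. f (x(i := y))))"
    using integrable_distr[OF meas, of f] by (simp add: case_prod_beta')
  show "AE y in M i. integrable (Pi\<^sub>M I M) (\<lambda>x. f (x(i := y)))"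
    by (rule P.AE_integrable_snd[OF int])
  show "integrable (M i) (\<lambda>y. \<integral>x. f (x(i := y)) \<partial>Pi\<^sub>M I M)"
    by (rule P.integrable_snd[OF int])
  have "integral\<^sup>L (Pi\<^sub>M (insert i I) M) f
      = integral\<^sup>L (distr (Pi\<^sub>M I M \<Otimes>\<^sub>M M i) (Pi\<^sub>M (insert i I) M) ?f) f"
    by (simp add: distr_PiM_insert[OF I])
  also have "\<dots> = integral\<^sup>L (Pi\<^sub>M I M \<Otimes>\<^sub>M M i) (case_prod (\<lambda>x y. f (x(i := y))))"
    using f by (subst integral_distr[OF meas]) (auto simp: case_prod_beta')
  also have "\<dots> = (\<integral>y. (\<integral>x. f (x(i := y)) \<partial>Pi\<^sub>M I M) \<partial>M i)"
    by (rule P.integral_snd[OF int, symmetric])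
  finally show "integral\<^sup>L (Pi\<^sub>M (insert i I) M) f = (\<integral>y. (\<integral>x. f (x(i := y)) \<partial>Pi\<^sub>M I M) \<partial>M i)" .
qed


section \<open>The operators of multiplication on polynomials\<close>

text \<open>Subtracting a multiple of \<open>b e\<close> lowers the degree, so a family with one
  member of each degree is a basis. The bound \<open>d\<close> keeps the argument inside the span of
  \<open>b 0, ..., b d\<close>.\<close>

lemma poly_basis_induct:
  fixes b :: "nat \<Rightarrow> 'a :: field poly"
  assumes b: "\<And>n. degree (b n) = n" "\<And>n. b n \<noteq> 0"
    and "P 0" and step: "\<And>p a n. P p \<Longrightarrow> n \<le> d \<Longrightarrow> P (p + smult a (b n))" and "degree p \<le> d"
  shows "P p"
proof -
  have "P p" if "e \<le> Suc d" "p = 0 \<or> degree p < e" for e p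
    using that
  proof (induction e arbitrary: p)
    case (Suc e)
    show ?case
    proof (cases "p = 0 \<or> degree p < e")
      case True
      then show ?thesis using Suc by auto
    next
      case False
      then have deg: "degree p = e" "p \<noteq> 0" using Suc.prems by auto
      let ?a = "lead_coeff p / lead_coeff (b e)"
      let ?p = "p - smult ?a (b e)"
      have "coeff (b e) e \<noteq> 0" using b[of e] leading_coeff_0_iff[of "b e"] by simp
      then have "coeff ?p e = 0" using deg b(1)[of e] by simp
      moreover have "degree ?p \<le> e"
        using deg b(1)[of e] by (intro degree_diff_le) (auto intro: order.trans[OF degree_smult_le])
      ultimately have "?p = 0 \<or> degree ?p < e"
        by (metis leading_coeff_0_iff order_le_less)
      then have "P ?p" using Suc by auto
      from step[OF this, of e ?a] Suc.prems show ?thesis by simp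
    qed
  qed (use assms in auto)
  from this[of "Suc d" p] assms(5) show ?thesis by auto
qed

section \<open>Polynomials in an operator and the chain of multiplication operators\<close>

definition linear_op :: "(complex poly \<Rightarrow> complex poly) \<Rightarrow> bool" where
  "linear_op T \<longleftrightarrow> (\<forall>p q a. T (p + smult a q) = T p + smult a (T q))"

lemma linear_opD:
  assumes "linear_op T"
  shows "T (p + smult a q) = T p + smult a (T q)" "T 0 = 0" "T (p + q) = T p + T q"
    "T (smult a p) = smult a (T p)" "T (p - q) = T p - T q"
proof -
  show 1: "T (p + smult a q) = T p + smult a (T q)" for p q a
    using assms by (simp add: linear_op_def)
  show 0: "T 0 = 0" using 1[of 0 1 0] by simp
  show "T (p + q) = T p + T q" using 1[of p 1 q] by simp
  show "T (smult a p) = smult a (T p)" using 1[of 0 a p] 0 by simp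
  show "T (p - q) = T p - T q" using 1[of p "-1" q] by simp
qed

lemma linear_op_sum: "linear_op T \<Longrightarrow> T (\<Sum>i\<in>I. f i) = (\<Sum>i\<in>I. T (f i))"
  by (induction I rule: infinite_finite_induct) (auto simp: linear_opD)

lemma smult_sum_right: "smult a (\<Sum>i\<in>I. f i) = (\<Sum>i\<in>I. smult a (f i))"
  by (induction I rule: infinite_finite_induct) (auto simp: smult_add_right)

definition poly_op :: "complex poly \<Rightarrow> (complex poly \<Rightarrow> complex poly) \<Rightarrow> complex poly \<Rightarrow> complex poly" where
  "poly_op q T p = (\<Sum>i\<le>degree q. smult (coeff q i) ((T ^^ i) p))"

lemma linear_op_funpow: "linear_op T \<Longrightarrow> linear_op (T ^^ i)"
  by (induction i) (auto simp: linear_op_def)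

lemma linear_op_poly_op: "linear_op T \<Longrightarrow> linear_op (poly_op q T)"
  using linear_op_funpow[of T]
  by (auto simp: linear_op_def poly_op_def smult_add_right sum.distrib smult_sum_right mult.commute)

lemma poly_op_commute: "linear_op T \<Longrightarrow> T (poly_op q T p) = poly_op q T (T p)"
  by (simp add: poly_op_def linear_op_sum linear_opD funpow_swap1)

text \<open>The derivative as value at 0 makes the recursion, and hence the commutation relation below,
  uniform in \<open>k\<close>.\<close>

fun mult_op :: "(nat \<Rightarrow> complex poly) \<Rightarrow> nat \<Rightarrow> complex poly \<Rightarrow> complex poly" where
  "mult_op V 0 p = pderiv p"
| "mult_op V (Suc 0) p = pCons 0 p"
| "mult_op V (Suc (Suc k)) p = poly_op (pderiv (V (Suc k))) (mult_op V (Suc k)) p - mult_op V k p"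

lemma linear_op_mult_op: "linear_op (mult_op V k)"
proof (induction k rule: less_induct)
  case (less k)
  consider "k = 0" | "k = 1" | j where "k = Suc (Suc j)"
    by (metis One_nat_def old.nat.exhaust)
  then show ?case
  proof cases
    case 3
    have "linear_op (poly_op (pderiv (V (Suc j))) (mult_op V (Suc j)))" "linear_op (mult_op V j)"
      using less 3 by (auto intro: linear_op_poly_op)
    then show ?thesis
      unfolding 3 by (simp add: linear_op_def smult_diff_right)
  qed (auto simp: linear_op_def pderiv_add pderiv_smult)
qed

text \<open>The potential term is a polynomial in the operator one step below and commutes with it,
  so consecutive commutators coincide; the chain starts from [d/dx, x] = 1.\<close>

lemma mult_op_commutator:
  "mult_op V k (mult_op V (Suc k) p) - mult_op V (Suc k) (mult_op V k p) = p"
proof (induction k)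
  case 0
  then show ?case by (simp add: pderiv_pCons)
next
  case (Suc k)
  have "mult_op V (Suc k) (mult_op V (Suc (Suc k)) p) - mult_op V (Suc (Suc k)) (mult_op V (Suc k) p)
     = mult_op V k (mult_op V (Suc k) p) - mult_op V (Suc k) (mult_op V k p)"
    by (simp add: linear_opD[OF linear_op_mult_op] poly_op_commute[OF linear_op_mult_op])
  then show ?case using Suc by simp
qed

lemma degree_funpow_le:
  fixes T :: "complex poly \<Rightarrow> complex poly"
  assumes "\<And>p. degree (T p) \<le> degree p + a"
  shows "degree ((T ^^ i) p) \<le> degree p + i * a"
proof (induction i)
  case (Suc i)
  then show ?case using assms[of "(T ^^ i) p"] by simp
qed simp

lemma degree_poly_op_le:
  assumes "\<And>p. degree (T p) \<le> degree p + a"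
  shows "degree (poly_op q T p) \<le> degree p + degree q * a"
  unfolding poly_op_def
proof (rule degree_sum_le)
  fix i assume "i \<in> {..degree q}"
  then have "degree ((T ^^ i) p) \<le> degree p + degree q * a"
    using degree_funpow_le[OF assms, of i p] by (meson add_left_mono atMost_iff le_trans mult_le_mono1)
  then show "degree (smult (coeff q i) ((T ^^ i) p)) \<le> degree p + degree q * a"
    using degree_smult_le le_trans by blast
qed simp

lemma up_width_Suc: "0 < k \<Longrightarrow> up_width V (Suc k) = up_width V k * (degree (V k) - 1)"
  by (simp add: up_width_def atLeastLessThanSuc)

text \<open>The potential term multiplies the width by the degree of its derivative. The subtracted
  operator two steps below is no wider, because all factors \<open>degree (V l) - 1\<close> are at
  least 1.\<close>

lemma degree_mult_op:
  assumes "0 < k" "\<And>l. l \<in> {1..<k} \<Longrightarrow> 2 \<le> degree (V l)"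
  shows "degree (mult_op V k p) \<le> degree p + up_width V k"
  using assms
proof (induction k arbitrary: p rule: less_induct)
  case (less k)
  consider "k = 1" | j where "k = Suc (Suc j)"
    using less.prems by (metis One_nat_def less_numeral_extra(3) old.nat.exhaust)
  then show ?case
  proof cases
    case 1
    then show ?thesis by (simp add: up_width_def degree_pCons_le le_trans[OF degree_pCons_le])
  next
    case 2
    have d: "2 \<le> degree (V (Suc j))" using less.prems 2 by simp
    have "degree (poly_op (pderiv (V (Suc j))) (mult_op V (Suc j)) p)
        \<le> degree p + degree (pderiv (V (Suc j))) * up_width V (Suc j)"
      using less 2 by (intro degree_poly_op_le) auto
    also have "\<dots> = degree p + up_width V k"
      using 2 by (simp add: up_width_Suc degree_pderiv)
    finally have A: "degree (poly_op (pderiv (V (Suc j))) (mult_op V (Suc j)) p) \<le> degree p + up_width V k" .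
    have "degree (mult_op V j p) \<le> degree p + up_width V k"
    proof (cases "j = 0")
      case True
      then show ?thesis by (simp add: degree_pderiv)
    next
      case False
      have "degree (mult_op V j p) \<le> degree p + up_width V j"
        using less 2 False by simp
      moreover have "up_width V j \<le> up_width V k"
        using d less.prems(2)[of j] False 2 by (simp add: up_width_Suc) arith
      ultimately show ?thesis by simp
    qed
    with A show ?thesis unfolding 2 by (simp add: degree_diff_le)
  qed
qed


section \<open>Biorthogonality and the multiplication matrices\<close>

locale multi_matrix_model =
  fixes m :: nat and \<Gamma> :: "nat \<Rightarrow> contour" and V \<pi> \<sigma> :: "nat \<Rightarrow> complex poly" and h :: "nat \<Rightarrow> complex"
  assumes m_ge: "2 \<le> m"
    and degree_V: "\<And>k. k \<in> {1..m} \<Longrightarrow> 2 \<le> degree (V k)"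
    and contours: "\<And>k. k \<in> {1..m} \<Longrightarrow> contour (\<Gamma> k)"
    and monic_\<pi>: "\<And>n. degree (\<pi> n) = n \<and> lead_coeff (\<pi> n) = 1"
    and monic_\<sigma>: "\<And>n. degree (\<sigma> n) = n \<and> lead_coeff (\<sigma> n) = 1"
    and h_nonzero: "\<And>n. h n \<noteq> 0"
    and converge: "all_integrals_converge m \<Gamma> V \<pi> \<sigma> h"
    and no_boundary: "no_boundary_terms m \<Gamma> V \<pi> \<sigma> h"
    and biorthogonal: "\<And>n l. multi_int m \<Gamma> (biorth_integrand m V (\<pi> n) (\<sigma> l)) = (if n = l then h n else 0)"
begin

text \<open>With the same root divided out of both families they become dual bases for
  \<open>pairing\<close>, and \<psi> is the transform of \<open>\<pi>'\<close> itself.\<close>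

definition \<pi>' :: "nat \<Rightarrow> complex poly" where "\<pi>' n = smult (1 / csqrt (h n)) (\<pi> n)"

definition \<sigma>' :: "nat \<Rightarrow> complex poly" where "\<sigma>' n = smult (1 / csqrt (h n)) (\<sigma> n)"

lemma csqrt_h: "csqrt (h n) \<noteq> 0" using h_nonzero by simp

lemma basis_\<pi>: "degree (\<pi>' n) = n" "\<pi>' n \<noteq> 0"
  using monic_\<pi>[of n] csqrt_h[of n] by (auto simp: \<pi>'_def)

lemma basis_\<sigma>: "degree (\<sigma>' n) = n" "\<sigma>' n \<noteq> 0"
  using monic_\<sigma>[of n] csqrt_h[of n] by (auto simp: \<sigma>'_def)

lemmas \<pi>_induct = poly_basis_induct[where b = \<pi>', OF basis_\<pi> _ _ order.refl]
lemmas \<sigma>_induct = poly_basis_induct[where b = \<sigma>', OF basis_\<sigma> _ _ order.refl]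

section \<open>Transforms of arbitrary polynomials\<close>

definition weight :: "nat \<Rightarrow> complex \<Rightarrow> complex" where
  "weight k y = (if k = 1 then 1 else exp (- poly (V k) y))"

primrec transform :: "nat \<Rightarrow> complex poly \<Rightarrow> complex \<Rightarrow> complex" where
  "transform 0 p x = 0"
| "transform (Suc k) p x = (if k = 0 then poly p x * exp (- poly (V 1) x)
     else cint (\<Gamma> k) (\<lambda>y. transform k p y * exp (x * y) * weight k y))"

lemma psi_eq_transform: "psi \<Gamma> V \<pi> h k n x = transform k (\<pi>' n) x"
  by (induction k arbitrary: x) (simp_all add: \<pi>'_def weight_def)

lemma psi_converge:
  assumes "k \<in> {1..<m}"
  shows "cconverges (\<Gamma> k) (\<lambda>y. psi \<Gamma> V \<pi> h k n y * exp (x * y) * weight k y)"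
  using converge assms unfolding all_integrals_converge_def weight_def by blast

text \<open>The two claims need each other: linearity at \<open>k + 1\<close> requires convergent
  integrals at \<open>k\<close>, and convergence, assumed for basis polynomials alone, passes to all
  polynomials by linearity at the same level.\<close>

lemma transform_linear:
  assumes "k \<in> {1..m}"
  shows "transform k (p + smult a q) x = transform k p x + a * transform k q x"
    and "k < m \<Longrightarrow> cconverges (\<Gamma> k) (\<lambda>y. transform k p y * exp (x * y) * weight k y)"
proof -
  have "(\<forall>p q a x. transform k (p + smult a q) x = transform k p x + a * transform k q x) \<and>
        (k < m \<longrightarrow> (\<forall>p x. cconverges (\<Gamma> k) (\<lambda>y. transform k p y * exp (x * y) * weight k y)))"
    using assms
  proof (induction k)
    case (Suc k)
    have lin: "transform (Suc k) (p + smult a q) x = transform (Suc k) p x + a * transform (Suc k) q x" for p q a x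
    proof (cases "k = 0")
      case False
      with Suc have IH: "\<And>p q a x. transform k (p + smult a q) x = transform k p x + a * transform k q x"
          "\<And>p x. cconverges (\<Gamma> k) (\<lambda>y. transform k p y * exp (x * y) * weight k y)"
        by auto
      have "cint (\<Gamma> k) (\<lambda>y. transform k p y * exp (x * y) * weight k y
              + a * (transform k q y * exp (x * y) * weight k y))
          = transform (Suc k) p x + a * transform (Suc k) q x"
        using cint_linear(2)[OF IH(2)[of p x] cint_linear(3)[OF IH(2)[of q x] IH(2)[of q x]]]
          cint_linear(4)[OF IH(2)[of q x] IH(2)[of q x]] False by simp
      then show ?thesis using False by (simp add: IH(1) algebra_simps)
    qed (simp add: algebra_simps)
    moreover have "cconverges (\<Gamma> (Suc k)) (\<lambda>y. transform (Suc k) p y * exp (x * y) * weight (Suc k) y)"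
      if "Suc k < m" for p x
    proof (induction p arbitrary: x rule: \<pi>_induct)
      case 1
      have "transform (Suc k) 0 y = 0" for y using lin[of 0 1 0 y] by simp
      then show ?case by (simp add: cint_zero del: transform.simps)
    next
      case (2 p a n)
      have b: "cconverges (\<Gamma> (Suc k)) (\<lambda>y. transform (Suc k) (\<pi>' n) y * exp (x * y) * weight (Suc k) y)"
        using psi_converge[of "Suc k" n x] that by (simp only: psi_eq_transform) auto
      have "cconverges (\<Gamma> (Suc k)) (\<lambda>y. transform (Suc k) p y * exp (x * y) * weight (Suc k) y
           + a * (transform (Suc k) (\<pi>' n) y * exp (x * y) * weight (Suc k) y))"
        by (intro cint_linear(1)[OF 2(1)] cint_linear(3)[OF b b])
      then show ?case by (simp add: lin algebra_simps del: transform.simps)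
    qed
    ultimately show ?case by blast
  qed simp
  then show "transform k (p + smult a q) x = transform k p x + a * transform k q x"
    and "k < m \<Longrightarrow> cconverges (\<Gamma> k) (\<lambda>y. transform k p y * exp (x * y) * weight k y)"
    by blast+
qed

lemma transform_simps:
  assumes "k \<in> {1..m}"
  shows "transform k 0 x = 0" "transform k (p + q) x = transform k p x + transform k q x"
    "transform k (smult a p) x = a * transform k p x" "transform k (p - q) x = transform k p x - transform k q x"
proof -
  note lin = transform_linear(1)[OF assms]
  show 0: "transform k 0 x = 0" using lin[of 0 1 0 x] by simp
  show "transform k (p + q) x = transform k p x + transform k q x" using lin[of p 1 q x] by simp
  show "transform k (smult a p) x = a * transform k p x" using lin[of 0 a p x] 0 by simp
  show "transform k (p - q) x = transform k p x - transform k q x" using lin[of p "-1" q x] by simp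
qed

lemma transform_sum:
  "k \<in> {1..m} \<Longrightarrow> transform k (\<Sum>i\<in>I. f i) x = (\<Sum>i\<in>I. transform k (f i) x)"
  by (induction I rule: infinite_finite_induct) (auto simp: transform_simps)

lemma transform_no_boundary:
  assumes "k \<in> {1..<m}"
  shows "no_boundary_term (\<Gamma> k) (\<lambda>y. transform k p y * exp (x * y) * weight k y)"
proof (induction p rule: \<pi>_induct)
  case 1
  then show ?case using assms by (simp add: transform_simps no_boundary_term_zero)
next
  case (2 p a n)
  have b: "no_boundary_term (\<Gamma> k) (\<lambda>y. transform k (\<pi>' n) y * exp (x * y) * weight k y)"
    using no_boundary assms unfolding no_boundary_terms_def weight_def psi_eq_transform[symmetric] by blast
  have "no_boundary_term (\<Gamma> k) (\<lambda>y. transform k p y * exp (x * y) * weight k y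
       + a * (transform k (\<pi>' n) y * exp (x * y) * weight k y))"
    by (intro no_boundary_term_linear(1)[OF 2(1)] no_boundary_term_linear(2)[OF b b])
  then show ?case using assms by (simp add: transform_linear algebra_simps)
qed

abbreviation "X \<equiv> mult_op V"

lemma transform_funpow:
  assumes "k \<in> {1..m}" "\<And>p x. x * transform k p x = transform k (X k p) x"
  shows "transform k ((X k ^^ i) p) x = x ^ i * transform k p x"
  by (induction i) (simp_all add: assms(2)[symmetric])

lemma transform_poly_op:
  assumes "k \<in> {1..m}" "\<And>p x. x * transform k p x = transform k (X k p) x"
  shows "transform k (poly_op q (X k) p) x = poly q x * transform k p x"
  by (simp add: poly_op_def transform_sum[OF assms(1)] transform_simps[OF assms(1)]
      transform_funpow[OF assms] poly_altdef sum_distrib_right mult.assoc)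

text \<open>The factor \<open>y\<close> produced by differentiating the exponential is absorbed into
  \<open>X k p\<close>, so the differentiated integral converges without any hypothesis on
  polynomial factors.\<close>

lemma transform_Suc_deriv:
  assumes k: "k \<in> {1..<m}" and mult: "\<And>p x. x * transform k p x = transform k (X k p) x"
  shows "(transform (Suc k) p has_field_derivative transform (Suc k) (X k p) x) (at x)"
proof -
  let ?g = "\<lambda>y. transform k p y * weight k y"
  have eq: "transform (Suc k) p = (\<lambda>x. cint (\<Gamma> k) (\<lambda>y. ?g y * exp (x * y)))"
       "transform (Suc k) (X k p) x = cint (\<Gamma> k) (\<lambda>y. y * ?g y * exp (x * y))"
    using k by (auto simp: fun_eq_iff mult[symmetric] mult_ac)
  have "cconverges (\<Gamma> k) (\<lambda>y. ?g y * exp (x * y))"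
       "cconverges (\<Gamma> k) (\<lambda>y. y * ?g y * exp (x * y))" for x
    using transform_linear(2)[of k p x] transform_linear(2)[of k "X k p" x] k
    by (simp_all add: mult[symmetric] mult_ac)
  then show ?thesis
    unfolding eq by (rule has_field_derivative_cint_exp)
qed

text \<open>For \<open>k \<ge> 2\<close> the potential comes from the weight and X_{k-1} from
  differentiating the transform. For \<open>k = 1\<close> both come from differentiating
  \<open>p exp (- V\<^sub>1)\<close>, where X_0 is the derivative.\<close>

lemma transform_weight_deriv:
  assumes k: "k \<in> {1..<m}" and mult: "\<And>p x. x * transform k p x = transform k (X k p) x"
    and der: "\<And>p x. 2 \<le> k \<Longrightarrow> (transform k p has_field_derivative transform k (X (k - 1) p) x) (at x)"
  shows "((\<lambda>y. transform k p y * weight k y) has_field_derivative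
            - (transform k (X (Suc k) p) y * weight k y)) (at y)"
proof -
  have k1: "k \<in> {1..m}" using k by auto
  obtain j where j: "k = Suc j" using k by (cases k) auto
  have "transform k (X (Suc k) p) y = poly (pderiv (V k)) y * transform k p y - transform k (X j p) y"
    by (simp only: j mult_op.simps transform_simps[OF k1[unfolded j]] transform_poly_op[OF k1[unfolded j] mult[unfolded j]])
  note Y = this
  show ?thesis
  proof (cases "k = 1")
    case True
    then have "j = 0" using j by simp
    show ?thesis
      unfolding Y using True \<open>j = 0\<close>
      by (auto simp: weight_def j intro!: derivative_eq_intros)
  next
    case False
    then have "2 \<le> k" using k by auto
    from der[OF this, of p y] have d: "(transform k p has_field_derivative transform k (X j p) y) (at y)"
      by (simp add: j)
    show ?thesis
      unfolding Y using False
      by (auto simp: weight_def intro!: derivative_eq_intros d) (simp add: algebra_simps)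
  qed
qed

text \<open>The claims advance together: multiplication at \<open>k + 1\<close> is integration by
  parts and uses both claims at \<open>k\<close>, while the derivative at \<open>k + 1\<close> uses
  multiplication at \<open>k\<close>.\<close>

lemma transform_mult_op:
  assumes "k \<in> {1..m}"
  shows "x * transform k p x = transform k (X k p) x"
    and "2 \<le> k \<Longrightarrow> (transform k p has_field_derivative transform k (X (k - 1) p) x) (at x)"
proof -
  have "(\<forall>p x. x * transform k p x = transform k (X k p) x) \<and>
     (\<forall>p x. 2 \<le> k \<longrightarrow> (transform k p has_field_derivative transform k (X (k - 1) p) x) (at x))"
    using assms
  proof (induction k)
    case (Suc k)
    show ?case
    proof (cases "k = 0")
      case False
      then have k: "k \<in> {1..<m}" using Suc.prems by auto
      with Suc.IH have IH: "\<And>p x. x * transform k p x = transform k (X k p) x"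
        "\<And>p x. 2 \<le> k \<Longrightarrow> (transform k p has_field_derivative transform k (X (k - 1) p) x) (at x)"
        by auto
      have "x * transform (Suc k) p x = transform (Suc k) (X (Suc k) p) x" for p x
      proof -
        let ?F = "\<lambda>y. transform k p y * exp (x * y) * weight k y"
        let ?G = "\<lambda>y. transform k (X (Suc k) p) y * exp (x * y) * weight k y"
        have k1: "k \<in> {1..m}" and km: "k < m" using k by auto
        note F = transform_linear(2)[OF k1 km, of p x] and G = transform_linear(2)[OF k1 km, of "X (Suc k) p" x]
        have conv: "cconverges (\<Gamma> k) (\<lambda>y. x * ?F y + (-1) * ?G y)"
          by (intro cint_linear(1)[OF cint_linear(3)[OF F F] cint_linear(3)[OF G G]])
        have "(?F has_field_derivative x * ?F y + (-1) * ?G y) (at y)" for y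
        proof -
          have "((\<lambda>y. exp (x * y)) has_field_derivative exp (x * y) * x) (at y)"
            by (auto intro!: derivative_eq_intros)
          from DERIV_mult[OF transform_weight_deriv[OF k IH] this]
          show ?thesis by (simp add: mult_ac)
        qed
        from cint_derivative_eq_0[OF contours[OF k1] this conv transform_no_boundary[OF k]]
        have "cint (\<Gamma> k) (\<lambda>y. x * ?F y + (-1) * ?G y) = 0" .
        moreover have "cint (\<Gamma> k) (\<lambda>y. x * ?F y + (-1) * ?G y) = x * cint (\<Gamma> k) ?F + (-1) * cint (\<Gamma> k) ?G"
          using cint_linear(2)[OF cint_linear(3)[OF F F] cint_linear(3)[OF G G]]
            cint_linear(4)[OF F F] cint_linear(4)[OF G G] by metis
        ultimately show ?thesis using False by simp
      qed
      moreover have "(transform (Suc k) p has_field_derivative transform (Suc k) (X k p) x) (at x)" for p x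
        by (rule transform_Suc_deriv[OF k IH(1)])
      ultimately show ?thesis by (simp del: transform.simps)
    qed simp
  qed simp
  then show "x * transform k p x = transform k (X k p) x"
    and "2 \<le> k \<Longrightarrow> (transform k p has_field_derivative transform k (X (k - 1) p) x) (at x)"
    by blast+
qed

subsection \<open>Iterated integrals\<close>

interpretation P: product_sigma_finite "\<lambda>k. contour_param (\<Gamma> k)"
  by (simp add: product_sigma_finite_def sigma_finite_contour_param)

text \<open>The integrand left when all nested integrals are stripped from
  \<open>transform k\<close>: \<open>x\<close> is the free last variable and \<open>\<tau>\<close>
  holds the parameters of the inner ones.\<close>

primrec iter_density :: "nat \<Rightarrow> complex poly \<Rightarrow> complex \<Rightarrow> (nat \<Rightarrow> nat \<times> real) \<Rightarrow> complex" where
  "iter_density 0 p x \<tau> = 0"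
| "iter_density (Suc k) p x \<tau> = (if k = 0 then poly p x * exp (- poly (V 1) x)
     else iter_density k p (contour_point (\<Gamma> k) (\<tau> k)) \<tau>
       * (exp (x * contour_point (\<Gamma> k) (\<tau> k)) * weight k (contour_point (\<Gamma> k) (\<tau> k))
          * contour_speed (\<Gamma> k) (\<tau> k)))"

lemma iter_density_upd: "k \<le> i \<Longrightarrow> iter_density k p x (\<tau>(i := y)) = iter_density k p x \<tau>"
  by (induction k arbitrary: x) auto

text \<open>Where the factor \<open>c\<close> vanishes, the inner integrals need not converge, but do not matter.\<close>

lemma integral_iter_density_step:
  assumes k: "1 \<le> k"
    and IH: "\<And>x. integrable (\<Pi>\<^sub>M k\<in>{1..<k}. contour_param (\<Gamma> k)) (iter_density k p x) \<Longrightarrow>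
        integral\<^sup>L (\<Pi>\<^sub>M k\<in>{1..<k}. contour_param (\<Gamma> k)) (iter_density k p x) = transform k p x"
    and int: "integrable (\<Pi>\<^sub>M k\<in>{1..k}. contour_param (\<Gamma> k))
        (\<lambda>\<tau>. iter_density k p (contour_point (\<Gamma> k) (\<tau> k)) \<tau> * c (\<tau> k))"
    and meas: "(\<lambda>y. transform k p (contour_point (\<Gamma> k) y) * c y) \<in> borel_measurable (contour_param (\<Gamma> k))"
  shows "integral\<^sup>L (\<Pi>\<^sub>M k\<in>{1..k}. contour_param (\<Gamma> k))
        (\<lambda>\<tau>. iter_density k p (contour_point (\<Gamma> k) (\<tau> k)) \<tau> * c (\<tau> k))
     = (\<integral>y. transform k p (contour_point (\<Gamma> k) y) * c y \<partial>contour_param (\<Gamma> k))"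
proof -
  let ?M = "\<lambda>k. contour_param (\<Gamma> k)"
  let ?f = "\<lambda>\<tau>. iter_density k p (contour_point (\<Gamma> k) (\<tau> k)) \<tau> * c (\<tau> k)"
  have ins: "{1..k} = insert k {1..<k}" using k by auto
  note I = P.integral_PiM_insert_outer[OF _ _ int[unfolded ins], simplified]
  have upd: "?f (\<tau>(k := y)) = iter_density k p (contour_point (\<Gamma> k) y) \<tau> * c y" for \<tau> y
    by (simp add: iter_density_upd)
  have ae: "AE y in ?M k. (\<integral>\<tau>. iter_density k p (contour_point (\<Gamma> k) y) \<tau> * c y \<partial>Pi\<^sub>M {1..<k} ?M)
      = transform k p (contour_point (\<Gamma> k) y) * c y"
    using I(1)
  proof eventually_elim
    case (elim y)
    show ?case
    proof (cases "c y = 0")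
      case False
      have int': "integrable (Pi\<^sub>M {1..<k} ?M) (\<lambda>\<tau>. iter_density k p (contour_point (\<Gamma> k) y) \<tau> * c y)"
        using elim by (simp add: iter_density_upd)
      have "integrable (Pi\<^sub>M {1..<k} ?M) (\<lambda>\<tau>. iter_density k p (contour_point (\<Gamma> k) y) \<tau> * c y * inverse (c y))"
        by (rule integrable_mult_left) (rule int')
      moreover have "(\<lambda>\<tau>. iter_density k p (contour_point (\<Gamma> k) y) \<tau> * c y * inverse (c y))
          = iter_density k p (contour_point (\<Gamma> k) y)"
        using False by (simp add: fun_eq_iff)
      ultimately have "integrable (Pi\<^sub>M {1..<k} ?M) (iter_density k p (contour_point (\<Gamma> k) y))"
        by (simp only:)
      from IH[OF this] show ?thesis by simp
    qed simp
  qed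
  have "integral\<^sup>L (Pi\<^sub>M {1..k} ?M) ?f
      = (\<integral>y. (\<integral>\<tau>. iter_density k p (contour_point (\<Gamma> k) y) \<tau> * c y \<partial>Pi\<^sub>M {1..<k} ?M) \<partial>?M k)"
    unfolding ins using I(3) by (simp add: iter_density_upd)
  also have "\<dots> = (\<integral>y. transform k p (contour_point (\<Gamma> k) y) * c y \<partial>?M k)"
    using I(2) by (intro integral_cong_AE meas ae) (simp add: iter_density_upd)
  finally show ?thesis .
qed

text \<open>Integrability at the given \<open>x\<close> remains a hypothesis, since Fubini grants it
  for the inner integrals only almost everywhere.\<close>

lemma integral_iter_density:
  assumes "k \<in> {1..m}" "integrable (\<Pi>\<^sub>M k\<in>{1..<k}. contour_param (\<Gamma> k)) (iter_density k p x)"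
  shows "integral\<^sup>L (\<Pi>\<^sub>M k\<in>{1..<k}. contour_param (\<Gamma> k)) (iter_density k p x) = transform k p x"
  using assms
proof (induction k arbitrary: x)
  case (Suc k)
  show ?case
  proof (cases "k = 0")
    case True
    then show ?thesis by (simp add: PiM_empty lebesgue_integral_count_space_finite)
  next
    case False
    have k: "1 \<le> k" "k \<in> {1..m}" "k < m" using False Suc.prems by auto
    have ins: "{1..<Suc k} = {1..k}" by auto
    let ?c = "\<lambda>y. exp (x * contour_point (\<Gamma> k) y) * weight k (contour_point (\<Gamma> k) y) * contour_speed (\<Gamma> k) y"
    have eq: "iter_density (Suc k) p x = (\<lambda>\<tau>. iter_density k p (contour_point (\<Gamma> k) (\<tau> k)) \<tau> * ?c (\<tau> k))"
      using False by (simp add: fun_eq_iff)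
    have meas: "(\<lambda>y. transform k p (contour_point (\<Gamma> k) y) * ?c y) \<in> borel_measurable (contour_param (\<Gamma> k))"
      using transform_linear(2)[OF k(2,3), of p x] by (auto simp: cconverges_def mult_ac dest!: borel_measurable_integrable)
    note int = Suc.prems(2)[unfolded ins eq]
    have "integral\<^sup>L (\<Pi>\<^sub>M k\<in>{1..<Suc k}. contour_param (\<Gamma> k)) (iter_density (Suc k) p x)
        = (\<integral>y. transform k p (contour_point (\<Gamma> k) y) * ?c y \<partial>contour_param (\<Gamma> k))"
      unfolding ins eq by (rule integral_iter_density_step[OF k(1) Suc.IH[OF k(2)] int meas])
    also have "\<dots> = transform (Suc k) p x"
      using False by (simp add: cint_def mult_ac)
    finally show ?thesis .
  qed
qed simp

lemma iter_density_closed: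
  assumes "1 \<le> k"
  shows "iter_density (Suc k) p x \<tau> =
     poly p (contour_point (\<Gamma> 1) (\<tau> 1)) * (\<Prod>i=1..k. exp (- poly (V i) (contour_point (\<Gamma> i) (\<tau> i))))
     * (\<Prod>i=1..<k. exp (contour_point (\<Gamma> i) (\<tau> i) * contour_point (\<Gamma> (i + 1)) (\<tau> (i + 1))))
     * exp (contour_point (\<Gamma> k) (\<tau> k) * x) * (\<Prod>i=1..k. contour_speed (\<Gamma> i) (\<tau> i))"
  using assms
proof (induction k arbitrary: x rule: dec_induct)
  case (step k)
  then show ?case
    by (subst iter_density.simps(2)) (simp add: weight_def atLeastLessThanSuc mult_ac del: iter_density.simps)
qed (simp add: weight_def mult_ac)

section \<open>The pairing of polynomials and its dual bases\<close>

definition pairing :: "complex poly \<Rightarrow> complex poly \<Rightarrow> complex" where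
  "pairing p q = cint (\<Gamma> m) (\<lambda>y. transform m p y * (poly q y * exp (- poly (V m) y)))"

abbreviation "pair_fun p q \<equiv> (\<lambda>y. transform m p y * (poly q y * exp (- poly (V m) y)))"

lemma m_in: "m \<in> {1..m}" using m_ge by auto

lemma phi_m: "phi m \<Gamma> V \<sigma> h m l y = poly (\<sigma>' l) y * exp (- poly (V m) y)"
  by (simp add: phi.simps \<sigma>'_def)

lemma pair_fun_linear:
  "pair_fun (p + smult a p') q = (\<lambda>y. pair_fun p q y + a * pair_fun p' q y)"
  "pair_fun p (q + smult a q') = (\<lambda>y. pair_fun p q y + a * pair_fun p q' y)"
  by (simp_all add: transform_linear(1)[OF m_in] algebra_simps fun_eq_iff)

lemma pair_fun_zero: "pair_fun 0 q = (\<lambda>y. 0)" "pair_fun p 0 = (\<lambda>y. 0)"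
  by (simp_all add: transform_simps[OF m_in])

lemma pairing_regular:
  "cconverges (\<Gamma> m) (pair_fun p q) \<and> no_boundary_term (\<Gamma> m) (pair_fun p q)"
proof (induction p rule: \<pi>_induct)
  case 1
  then show ?case unfolding pair_fun_zero by (simp add: cint_zero no_boundary_term_zero)
next
  case (2 p a n)
  have "cconverges (\<Gamma> m) (pair_fun (\<pi>' n) q) \<and> no_boundary_term (\<Gamma> m) (pair_fun (\<pi>' n) q)"
  proof (induction q rule: \<sigma>_induct)
    case 1
    then show ?case unfolding pair_fun_zero by (simp add: cint_zero no_boundary_term_zero)
  next
    case (2 q b l)
    have "cconverges (\<Gamma> m) (\<lambda>y. psi \<Gamma> V \<pi> h m n y * phi m \<Gamma> V \<sigma> h m l y)"
      using converge m_in unfolding all_integrals_converge_def by blast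
    then have *: "cconverges (\<Gamma> m) (pair_fun (\<pi>' n) (\<sigma>' l))"
      by (simp only: psi_eq_transform phi_m)
    have "no_boundary_term (\<Gamma> m) (\<lambda>y. psi \<Gamma> V \<pi> h m n y * phi m \<Gamma> V \<sigma> h m l y)"
      using no_boundary m_in unfolding no_boundary_terms_def by blast
    then have **: "no_boundary_term (\<Gamma> m) (pair_fun (\<pi>' n) (\<sigma>' l))"
      by (simp only: psi_eq_transform phi_m)
    show ?case
      unfolding pair_fun_linear
      using 2(1) cint_linear(1)[OF _ cint_linear(3)[OF * *]]
        no_boundary_term_linear(1)[OF _ no_boundary_term_linear(2)[OF ** **]] by blast
  qed
  then show ?case
    unfolding pair_fun_linear
    using 2(1) cint_linear(1)[OF _ cint_linear(3)] no_boundary_term_linear(1)[OF _ no_boundary_term_linear(2)]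
    by blast
qed

lemma pairing_linear:
  "pairing (p + smult a p') q = pairing p q + a * pairing p' q"
  "pairing p (q + smult a q') = pairing p q + a * pairing p q'"
proof -
  note reg = conjunct1[OF pairing_regular]
  show "pairing (p + smult a p') q = pairing p q + a * pairing p' q"
    unfolding pairing_def pair_fun_linear
    by (simp only: cint_linear(2)[OF reg cint_linear(3)[OF reg reg]] cint_linear(4)[OF reg reg])
  show "pairing p (q + smult a q') = pairing p q + a * pairing p q'"
    unfolding pairing_def pair_fun_linear
    by (simp only: cint_linear(2)[OF reg cint_linear(3)[OF reg reg]] cint_linear(4)[OF reg reg])
qed

lemma pairing_simps:
  "pairing 0 q = 0" "pairing (p + p') q = pairing p q + pairing p' q"
  "pairing (smult a p) q = a * pairing p q" "pairing (p - p') q = pairing p q - pairing p' q"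
  "pairing p 0 = 0" "pairing p (q + q') = pairing p q + pairing p q'"
  "pairing p (smult a q) = a * pairing p q" "pairing p (q - q') = pairing p q - pairing p q'"
proof -
  show 0: "pairing 0 q = 0" "pairing p 0 = 0" for p q
    unfolding pairing_def pair_fun_zero by (rule cint_zero)+
  show "pairing (p + p') q = pairing p q + pairing p' q" using pairing_linear(1)[of p 1 p' q] by simp
  show "pairing (smult a p) q = a * pairing p q" using pairing_linear(1)[of 0 a p q] by (simp add: 0)
  show "pairing (p - p') q = pairing p q - pairing p' q" using pairing_linear(1)[of p "-1" p' q] by simp
  show "pairing p (q + q') = pairing p q + pairing p q'" using pairing_linear(2)[of p q 1 q'] by simp
  show "pairing p (smult a q) = a * pairing p q" using pairing_linear(2)[of p 0 a q] by (simp add: 0)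
  show "pairing p (q - q') = pairing p q - pairing p q'" using pairing_linear(2)[of p q "-1" q'] by simp
qed

lemma pairing_sum:
  "pairing (\<Sum>i\<in>I. f i) q = (\<Sum>i\<in>I. pairing (f i) q)"
  "pairing p (\<Sum>i\<in>I. f i) = (\<Sum>i\<in>I. pairing p (f i))"
  by (induction I rule: infinite_finite_induct) (auto simp: pairing_simps)

text \<open>Up to the factors of the last variable the m-fold density is
  \<open>iter_density m\<close> at the last contour point, so integrating the last variable
  outermost turns it into \<open>transform m\<close>.\<close>

lemma pairing_monic: "pairing (\<pi> n) (\<sigma> l) = (if n = l then h n else 0)"
proof -
  obtain k where k: "m = Suc k" "1 \<le> k" using m_ge by (cases m) auto
  let ?c = "\<lambda>y. poly (\<sigma> l) (contour_point (\<Gamma> m) y) * exp (- poly (V m) (contour_point (\<Gamma> m) y))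
              * contour_speed (\<Gamma> m) y"
  have eq: "multi_density m \<Gamma> (biorth_integrand m V (\<pi> n) (\<sigma> l))
      = (\<lambda>\<tau>. iter_density m (\<pi> n) (contour_point (\<Gamma> m) (\<tau> m)) \<tau> * ?c (\<tau> m))"
  proof
    fix \<tau>
    have "{1..m - 1} = insert k {1..<k}" using k by auto
    then show "multi_density m \<Gamma> (biorth_integrand m V (\<pi> n) (\<sigma> l)) \<tau>
      = iter_density m (\<pi> n) (contour_point (\<Gamma> m) (\<tau> m)) \<tau> * ?c (\<tau> m)"
      using k by (simp add: multi_density_def biorth_integrand_def iter_density_closed mult_ac del: iter_density.simps)
  qed
  have "pairing (\<pi> n) (\<sigma> l) = (\<integral>y. transform m (\<pi> n) (contour_point (\<Gamma> m) y) * ?c y \<partial>contour_param (\<Gamma> m))"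
    by (simp add: pairing_def cint_def mult_ac)
  also have "\<dots> = multi_int m \<Gamma> (biorth_integrand m V (\<pi> n) (\<sigma> l))"
    unfolding multi_int_def eq
  proof (rule integral_iter_density_step[symmetric])
    show "integrable (\<Pi>\<^sub>M k\<in>{1..m}. contour_param (\<Gamma> k))
        (\<lambda>\<tau>. iter_density m (\<pi> n) (contour_point (\<Gamma> m) (\<tau> m)) \<tau> * ?c (\<tau> m))"
      using converge unfolding all_integrals_converge_def multi_converges_def eq[symmetric] by blast
    show "(\<lambda>y. transform m (\<pi> n) (contour_point (\<Gamma> m) y) * ?c y) \<in> borel_measurable (contour_param (\<Gamma> m))"
      using pairing_regular[of "\<pi> n" "\<sigma> l"]
      by (auto simp: cconverges_def mult_ac dest!: borel_measurable_integrable)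
  qed (use m_ge integral_iter_density[OF m_in] in auto)
  finally show ?thesis using biorthogonal by simp
qed

lemma pairing_basis: "pairing (\<pi>' n) (\<sigma>' l) = (if n = l then 1 else 0)"
  using h_nonzero[of n] csqrt_h[of n] power2_csqrt[of "h n"]
  by (auto simp: \<pi>'_def \<sigma>'_def pairing_simps pairing_monic power2_eq_square divide_simps)

lemma expand_\<pi>:
  assumes "degree p \<le> d"
  shows "p = (\<Sum>i\<le>d. smult (pairing p (\<sigma>' i)) (\<pi>' i))"
proof (rule poly_basis_induct[where b = \<pi>' and d = d, OF basis_\<pi> _ _ assms])
  fix p a n assume IH: "p = (\<Sum>i\<le>d. smult (pairing p (\<sigma>' i)) (\<pi>' i))" and n: "n \<le> d"
  have "(\<Sum>i\<le>d. smult (pairing (p + smult a (\<pi>' n)) (\<sigma>' i)) (\<pi>' i))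
      = (\<Sum>i\<le>d. smult (pairing p (\<sigma>' i)) (\<pi>' i)) + (\<Sum>i\<le>d. if i = n then smult a (\<pi>' n) else 0)"
    unfolding sum.distrib[symmetric]
    by (intro sum.cong refl) (auto simp: pairing_simps pairing_basis smult_add_left)
  also have "\<dots> = p + smult a (\<pi>' n)"
    using n IH[symmetric] by simp
  finally show "p + smult a (\<pi>' n) = (\<Sum>i\<le>d. smult (pairing (p + smult a (\<pi>' n)) (\<sigma>' i)) (\<pi>' i))" ..
qed (simp add: pairing_simps)

lemma pairing_\<sigma>_eq_0: "degree p < l \<Longrightarrow> pairing p (\<sigma>' l) = 0"
  by (subst expand_\<pi>[OF order.refl]) (auto simp: pairing_sum pairing_simps pairing_basis intro!: sum.neutral)

lemma pairing_\<pi>_eq_0: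
  assumes "degree q < n"
  shows "pairing (\<pi>' n) q = 0"
proof -
  obtain d where d: "degree q \<le> d" "d < n" using assms by blast
  show ?thesis
    by (rule poly_basis_induct[where b = \<sigma>' and d = d, OF basis_\<sigma> _ _ d(1)])
       (use d(2) in \<open>auto simp: pairing_simps pairing_basis\<close>)
qed

text \<open>A vanishing transform makes all later ones up to level \<open>m\<close> vanish, so the
  polynomial pairs to zero with everything; but its pairings with \<open>\<sigma>'\<close> are its
  coefficients in the basis \<open>\<pi>'\<close>.\<close>

lemma transform_eq_0_iff:
  assumes "k \<in> {1..m}" "\<And>x. transform k p x = 0"
  shows "p = 0"
proof -
  have "transform j p x = 0" if "k \<le> j" "j \<le> m" for j x
    using that
  proof (induction j arbitrary: x rule: dec_induct)
    case (step j)
    then show ?case using assms(1) by (simp add: cint_zero)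
  qed (use assms in auto)
  then have "transform m p x = 0" for x using assms(1) by auto
  then have "pairing p q = 0" for q by (simp add: pairing_def cint_zero)
  then show ?thesis using expand_\<pi>[of p, OF order.refl] by simp
qed


subsection \<open>The adjoint operators\<close>

text \<open>The same chain run from the other end, with the potentials in reverse order:
  \<open>Y m\<close> is multiplication by the variable, and the derivative sits at
  \<open>m + 1\<close>.\<close>

definition Y :: "nat \<Rightarrow> complex poly \<Rightarrow> complex poly" where
  "Y k = mult_op (\<lambda>l. V (m + 1 - l)) (m + 1 - k)"

lemma poly_pCons_funpow:
  fixes q :: "complex poly"
  shows "poly ((pCons 0 ^^ i) q) y = y ^ i * poly q y"
  by (induction i) auto

lemma pairing_funpow:
  assumes "\<And>p q. pairing (T p) q = pairing p (S q)"
  shows "pairing ((T ^^ i) p) q = pairing p ((S ^^ i) q)"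
  by (induction i arbitrary: p q) (simp_all add: assms funpow_swap1)

lemma pairing_poly_op:
  assumes "\<And>p q. pairing (T p) q = pairing p (S q)"
  shows "pairing (poly_op r T p) q = pairing p (poly_op r S q)"
  by (simp add: poly_op_def pairing_sum pairing_simps pairing_funpow[of T S, OF assms])

text \<open>Multiplication moves across the integrand at level \<open>m\<close>, and integration by
  parts settles level \<open>m - 1\<close>. Both chains obey the same recursion, which read
  downwards determines each operator from the two above it.\<close>

lemma pairing_X_Y:
  assumes "k \<in> {1..m}"
  shows "pairing (X k p) q = pairing p (Y k q)"
proof -
  have top: "pairing (X m p) q = pairing p (Y m q)" for p q
    by (simp add: Y_def pairing_def transform_mult_op(1)[OF m_in, symmetric] mult_ac)
  obtain k' where k': "m = Suc k'" "1 \<le> k'" using m_ge by (cases m) auto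
  have below: "pairing (X k' p) q = pairing p (Y k' q)" for p q
  proof -
    let ?q = "Y k' q"
    have Yq: "poly ?q y = poly (pderiv (V m)) y * poly q y - poly (pderiv q) y" for y
    proof -
      have "Y k' q = poly_op (pderiv (V m)) (pCons 0) q - pderiv q"
      proof -
        have "m + 1 - k' = Suc (Suc 0)" "m + 1 - Suc 0 = m" using k' by auto
        moreover have "mult_op W (Suc 0) = pCons 0" for W by (simp add: fun_eq_iff)
        ultimately show ?thesis by (simp only: Y_def mult_op.simps)
      qed
      moreover have "poly (poly_op (pderiv (V m)) (pCons 0) q) y = poly (pderiv (V m)) y * poly q y"
        by (simp add: poly_op_def poly_sum poly_pCons_funpow poly_altdef[of "pderiv (V m)"] sum_distrib_right mult.assoc)
      ultimately show ?thesis by simp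
    qed
    have der: "(pair_fun p q has_field_derivative pair_fun (X k' p) q y + (-1) * pair_fun p ?q y) (at y)" for y
    proof -
      have 1: "(transform m p has_field_derivative transform m (X k' p) y) (at y)"
        using transform_mult_op(2)[OF m_in m_ge] k' by simp
      have 2: "((\<lambda>y. poly q y * exp (- poly (V m) y)) has_field_derivative
           - (poly ?q y * exp (- poly (V m) y))) (at y)"
        unfolding Yq by (auto intro!: derivative_eq_intros simp: algebra_simps)
      show ?thesis using DERIV_mult[OF 1 2] by (simp add: algebra_simps)
    qed
    note reg = conjunct1[OF pairing_regular]
    note * = cint_derivative_eq_0[OF contours[OF m_in] der
        cint_linear(1)[OF reg cint_linear(3)[OF reg reg]] conjunct2[OF pairing_regular]]
    show ?thesis
      using * cint_linear(2)[OF reg cint_linear(3)[OF reg reg], of "X k' p" q "-1" p ?q]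
        cint_linear(4)[OF reg reg, of "-1" p ?q]
      by (simp add: pairing_def)
  qed
  have "\<forall>p q. pairing (X (m - i) p) q = pairing p (Y (m - i) q)" if "i < m" for i
    using that
  proof (induction i rule: less_induct)
    case (less i)
    consider "i = 0" | "i = 1" | j where "i = Suc (Suc j)"
      by (metis One_nat_def old.nat.exhaust)
    then show ?case
    proof cases
      case 1
      then show ?thesis using top by simp
    next
      case 2
      then show ?thesis using below k' by simp
    next
      case 3
      define k where "k = m - i"
      have k: "1 \<le> k" "m - Suc j = Suc k" "m - j = Suc (Suc k)" using less.prems 3 by (auto simp: k_def)
      have IH: "pairing (X (Suc k) p) q = pairing p (Y (Suc k) q)"
        "pairing (X (Suc (Suc k)) p) q = pairing p (Y (Suc (Suc k)) q)" for p q
        using less.IH[of "Suc j"] less.IH[of j] less.prems 3 k by auto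
      have X: "X k p = poly_op (pderiv (V (Suc k))) (X (Suc k)) p - X (Suc (Suc k)) p" for p
        by simp
      have Y: "Y k q = poly_op (pderiv (V (Suc k))) (Y (Suc k)) q - Y (Suc (Suc k)) q" for q
      proof -
        have "m + 1 - k = Suc (Suc (m - 1 - k))" "m + 1 - Suc k = Suc (m - 1 - k)"
          "m + 1 - Suc (Suc k) = m - 1 - k" "m + 1 - Suc (m - 1 - k) = Suc k"
          using k by linarith+
        then show ?thesis unfolding Y_def by simp
      qed
      show ?thesis
        unfolding k_def[symmetric] X Y pairing_simps
        using IH pairing_poly_op[of "X (Suc k)" "Y (Suc k)", OF IH(1)] by simp
    qed
  qed
  from this[of "m - k"] assms show ?thesis by auto
qed

lemma degree_Y:
  assumes "k \<in> {1..m}"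
  shows "degree (Y k q) \<le> degree q + down_width m V k"
proof -
  have "up_width (\<lambda>l. V (m + 1 - l)) (m + 1 - k) = down_width m V k"
    unfolding up_width_def down_width_def
    by (rule prod.reindex_bij_witness[of _ "\<lambda>l. m + 1 - l" "\<lambda>l. m + 1 - l"]) (use assms in auto)
  moreover have "degree (Y k q) \<le> degree q + up_width (\<lambda>l. V (m + 1 - l)) (m + 1 - k)"
    unfolding Y_def using assms by (intro degree_mult_op) (auto intro!: degree_V)
  ultimately show ?thesis by simp
qed

end

section \<open>The recursion coefficients\<close>

context multi_matrix_model
begin

definition Q_entry :: "nat \<Rightarrow> nat \<Rightarrow> nat \<Rightarrow> complex" where
  "Q_entry k n l = pairing (X k (\<pi>' n)) (\<sigma>' l)"

text \<open>\<open>A\<close> is given only through its action on functions; injectivity of the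
  transform lifts that equation to polynomials, where coefficients are unique.\<close>

lemma multiplication_matrix_entry:
  assumes k: "k \<in> {1..m}" and A: "multiplication_matrix (psi \<Gamma> V \<pi> h k) A"
  shows "A n l = Q_entry k n l"
proof -
  let ?S = "{l. A n l \<noteq> 0}"
  have fin: "finite ?S" and eq: "\<And>x. x * transform k (\<pi>' n) x = (\<Sum>l\<in>?S. A n l * transform k (\<pi>' l) x)"
    using A by (auto simp: multiplication_matrix_def psi_eq_transform)
  have "transform k (X k (\<pi>' n) - (\<Sum>l\<in>?S. smult (A n l) (\<pi>' l))) x = 0" for x
    using eq[of x] by (simp add: transform_simps[OF k] transform_sum[OF k] transform_mult_op(1)[OF k])
  from transform_eq_0_iff[OF k this] have "X k (\<pi>' n) = (\<Sum>l\<in>?S. smult (A n l) (\<pi>' l))" by simp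
  then have "Q_entry k n l = (\<Sum>l'\<in>?S. A n l' * (if l' = l then 1 else 0))"
    by (simp add: Q_entry_def pairing_sum pairing_simps pairing_basis)
  also have "\<dots> = A n l"
    using fin by (simp add: if_distrib[of "\<lambda>t. _ * t"] cong: if_cong)
  finally show ?thesis ..
qed

lemma Q_entry_band:
  assumes "k \<in> {1..m}" "Q_entry k n l \<noteq> 0"
  shows "l \<le> n + up_width V k" "n \<le> l + down_width m V k"
proof -
  have "degree (X k (\<pi>' n)) \<le> n + up_width V k"
    using degree_mult_op[of k V "\<pi>' n"] assms(1) degree_V basis_\<pi>(1)[of n] by auto
  with assms(2) show "l \<le> n + up_width V k"
    using pairing_\<sigma>_eq_0 unfolding Q_entry_def by (meson le_trans linorder_not_less)
  have "degree (Y k (\<sigma>' l)) \<le> l + down_width m V k"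
    using degree_Y[OF assms(1), of "\<sigma>' l"] basis_\<sigma>(1)[of l] by simp
  with assms(2) show "n \<le> l + down_width m V k"
    using pairing_\<pi>_eq_0 unfolding Q_entry_def pairing_X_Y[OF assms(1)] by (meson le_trans linorder_not_less)
qed

lemma expand_\<pi>_support:
  assumes "finite B" "\<And>b. pairing p (\<sigma>' b) \<noteq> 0 \<Longrightarrow> b \<in> B"
  shows "p = (\<Sum>b\<in>B. smult (pairing p (\<sigma>' b)) (\<pi>' b))"
proof -
  have "p = (\<Sum>b\<in>{..degree p}. smult (pairing p (\<sigma>' b)) (\<pi>' b))"
    by (rule expand_\<pi>) simp
  also have "\<dots> = (\<Sum>b\<in>{..degree p} \<union> B. smult (pairing p (\<sigma>' b)) (\<pi>' b))"
    using assms(1) pairing_\<sigma>_eq_0[of p] by (intro sum.mono_neutral_left) (auto simp: linorder_not_le)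
  also have "\<dots> = (\<Sum>b\<in>B. smult (pairing p (\<sigma>' b)) (\<pi>' b))"
    using assms by (intro sum.mono_neutral_right) auto
  finally show ?thesis .
qed

text \<open>Rows expand the images of basis elements, so composing operators multiplies their
  matrices in the opposite order.\<close>

lemma pairing_X_X:
  assumes "finite B" "\<And>b. Q_entry k n b \<noteq> 0 \<Longrightarrow> b \<in> B"
  shows "pairing (X j (X k (\<pi>' n))) (\<sigma>' l) = (\<Sum>b\<in>B. Q_entry k n b * Q_entry j b l)"
proof -
  have "X k (\<pi>' n) = (\<Sum>b\<in>B. smult (Q_entry k n b) (\<pi>' b))"
    using expand_\<pi>_support[of B "X k (\<pi>' n)"] assms by (simp add: Q_entry_def)
  then show ?thesis
    by (simp add: linear_op_sum[OF linear_op_mult_op] linear_opD[OF linear_op_mult_op]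
        pairing_sum pairing_simps Q_entry_def[of j])
qed

lemma Q_entry_commute:
  assumes "k \<in> {2..m}" "n \<noteq> l" "finite B"
    and "\<And>b. Q_entry k n b \<noteq> 0 \<Longrightarrow> b \<in> B" "\<And>b. Q_entry (k - 1) n b \<noteq> 0 \<Longrightarrow> b \<in> B"
  shows "(\<Sum>b\<in>B. Q_entry k n b * Q_entry (k - 1) b l) = (\<Sum>b\<in>B. Q_entry (k - 1) n b * Q_entry k b l)"
proof -
  have k: "Suc (k - 1) = k" using assms(1) by auto
  have "pairing (X (k - 1) (X k (\<pi>' n)) - X k (X (k - 1) (\<pi>' n))) (\<sigma>' l) = 0"
    using mult_op_commutator[of V "k - 1" "\<pi>' n", unfolded k] assms(2) by (simp add: pairing_basis)
  then show ?thesis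
    using assms by (simp add: pairing_simps pairing_X_X)
qed

lemma pairing_X_funpow_support:
  assumes k: "k \<in> {1..m}" and nz: "pairing ((X k ^^ i) (\<pi>' n)) (\<sigma>' c) \<noteq> 0"
  shows "c \<le> n + i * up_width V k" "n \<le> c + i * down_width m V k"
proof -
  have X: "degree (X k p) \<le> degree p + up_width V k" for p
    using degree_mult_op[of k V] k degree_V by auto
  have "degree ((X k ^^ i) (\<pi>' n)) \<le> n + i * up_width V k"
    using degree_funpow_le[OF X, of i "\<pi>' n"] basis_\<pi>(1)[of n] by simp
  with nz show "c \<le> n + i * up_width V k"
    using pairing_\<sigma>_eq_0 by (meson le_trans linorder_not_less)
  have "degree ((Y k ^^ i) (\<sigma>' c)) \<le> c + i * down_width m V k"
    using degree_funpow_le[OF degree_Y[OF k], of i "\<sigma>' c"] basis_\<sigma>(1)[of c] by simp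
  with nz show "n \<le> c + i * down_width m V k"
    using pairing_\<pi>_eq_0 unfolding pairing_funpow[of "X k" "Y k", OF pairing_X_Y[OF k]]
    by (meson le_trans linorder_not_less)
qed

text \<open>The functional \<open>L\<close> with \<open>L (\<pi>' c) = f c\<close> turns the recursion of the operators into one of the
  matrices.\<close>

lemma Q_entry_recursion:
  assumes k: "k \<in> {2..<m}" and d: "d = degree (V k) - 1"
    and sol: "\<And>c. c \<le> n + (d - 1) * up_width V k \<Longrightarrow> n \<le> c + (d - 1) * down_width m V k \<Longrightarrow>
       (\<Sum>b\<le>D. Q_entry k c b * f b) = x * f c"
    and D: "n + d * up_width V k \<le> D"
  shows "(\<Sum>b\<le>D. Q_entry (k + 1) n b * f b)
     = poly (pderiv (V k)) x * f n - (\<Sum>b\<le>D. Q_entry (k - 1) n b * f b)"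
proof -
  have k1: "k \<in> {1..m}" using k by auto
  define L where "L p = (\<Sum>b\<le>D. pairing p (\<sigma>' b) * f b)" for p
  have L_sum: "L (\<Sum>i\<in>I. smult (a i) (g i)) = (\<Sum>i\<in>I. a i * L (g i))" for I :: "nat set" and a g
    unfolding L_def
    by (simp add: pairing_sum pairing_simps sum_distrib_right sum_distrib_left mult.assoc sum.swap[of _ _ I])
  have L_diff: "L (p - q) = L p - L q" for p q
    by (simp add: L_def pairing_simps left_diff_distrib sum_subtractf)
  have L_basis: "L (\<pi>' c) = f c" if "c \<le> D" for c
    using that by (simp add: L_def pairing_basis if_distrib[of "\<lambda>t. t * _"] cong: if_cong)
  have pow: "L ((X k ^^ i) (\<pi>' n)) = x ^ i * f n" if "i \<le> d" for i
    using that
  proof (induction i)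
    case 0
    then show ?case using D by (simp add: L_basis)
  next
    case (Suc i)
    let ?p = "(X k ^^ i) (\<pi>' n)"
    \<comment> \<open>After \<open>i\<close> steps only these indices have been reached. As
      \<open>i < d\<close>, they lie within \<open>d - 1\<close> steps of \<open>n\<close>, which is
      why \<open>sol\<close> is asked no further out.\<close>
    let ?B = "{c. c \<le> n + i * up_width V k \<and> n \<le> c + i * down_width m V k}"
    have i: "i * up_width V k \<le> (d - 1) * up_width V k" "i * down_width m V k \<le> (d - 1) * down_width m V k"
      "(d - 1) * up_width V k \<le> d * up_width V k"
      using Suc.prems by (auto intro!: mult_le_mono1)
    have "finite ?B" by (rule finite_subset[of _ "{..n + i * up_width V k}"]) auto
    then have p: "?p = (\<Sum>c\<in>?B. smult (pairing ?p (\<sigma>' c)) (\<pi>' c))"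
      by (rule expand_\<pi>_support) (use pairing_X_funpow_support[OF k1] in auto)
    have "X k ?p = (\<Sum>c\<in>?B. smult (pairing ?p (\<sigma>' c)) (X k (\<pi>' c)))"
      by (subst p) (simp add: linear_op_sum[OF linear_op_mult_op] linear_opD[OF linear_op_mult_op])
    then have "L (X k ?p) = (\<Sum>c\<in>?B. pairing ?p (\<sigma>' c) * L (X k (\<pi>' c)))"
      by (simp add: L_sum)
    also have "\<dots> = (\<Sum>c\<in>?B. pairing ?p (\<sigma>' c) * (x * L (\<pi>' c)))"
    proof (intro sum.cong refl arg_cong2[where f = "(*)"])
      fix c assume "c \<in> ?B"
      then have "c \<le> n + i * up_width V k" "n \<le> c + i * down_width m V k" by auto
      with i have c: "c \<le> n + (d - 1) * up_width V k" "n \<le> c + (d - 1) * down_width m V k"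
        by linarith+
      then have "L (X k (\<pi>' c)) = x * f c"
        using sol[OF c] by (simp add: L_def Q_entry_def)
      moreover have "c \<le> D" using c i D by linarith
      ultimately show "L (X k (\<pi>' c)) = x * L (\<pi>' c)" by (simp add: L_basis)
    qed
    also have "\<dots> = x * (\<Sum>c\<in>?B. pairing ?p (\<sigma>' c) * L (\<pi>' c))"
      by (simp add: sum_distrib_left mult_ac)
    also have "(\<Sum>c\<in>?B. pairing ?p (\<sigma>' c) * L (\<pi>' c)) = L ?p"
      using arg_cong[OF p, of L] unfolding L_sum by (rule sym)
    finally show ?case using Suc by simp
  qed
  obtain j where j: "k = Suc j" using k by (cases k) auto
  have "X (k + 1) (\<pi>' n) = poly_op (pderiv (V k)) (X k) (\<pi>' n) - X (k - 1) (\<pi>' n)"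
    by (simp add: j)
  then have "L (X (k + 1) (\<pi>' n)) = L (poly_op (pderiv (V k)) (X k) (\<pi>' n)) - L (X (k - 1) (\<pi>' n))"
    by (simp only: L_diff)
  also have "L (poly_op (pderiv (V k)) (X k) (\<pi>' n)) = (\<Sum>i\<le>d. coeff (pderiv (V k)) i * (x ^ i * f n))"
    unfolding poly_op_def L_sum using d by (intro sum.cong) (auto simp: degree_pderiv pow)
  also have "\<dots> = poly (pderiv (V k)) x * f n"
    using d by (simp add: poly_altdef degree_pderiv sum_distrib_right mult.assoc)
  finally show ?thesis by (simp add: L_def Q_entry_def)
qed

end

locale multi_matrix_recursion = multi_matrix_model +
  fixes Q :: "nat \<Rightarrow> nat \<Rightarrow> nat \<Rightarrow> complex"
  assumes multiplication: "\<And>k. k \<in> {1..m} \<Longrightarrow> multiplication_matrix (psi \<Gamma> V \<pi> h k) (Q k)"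
    and upper_nonzero: "\<And>k n. k \<in> {1..m} \<Longrightarrow> 0 \<le> n \<Longrightarrow> band_coeff Q k (int (up_width V k)) n \<noteq> 0"
    and lower_nonzero: "\<And>k n. k \<in> {1..m} \<Longrightarrow> int (down_width m V k) \<le> n \<Longrightarrow>
          band_coeff Q k (- int (down_width m V k)) n \<noteq> 0"
begin

abbreviation "r \<equiv> up_width V"
abbreviation "s \<equiv> down_width m V"
abbreviation "\<alpha> \<equiv> band_coeff Q"

section \<open>The given matrices as band matrices over the integers\<close>

lemma r_pos: "k \<in> {1..m} \<Longrightarrow> 0 < r k"
  unfolding up_width_def
proof (rule prod_pos)
  fix l assume "k \<in> {1..m}" "l \<in> {1..<k}"
  then show "0 < degree (V l) - 1" using degree_V[of l] by auto
qed

lemma s_pos: "k \<in> {1..m} \<Longrightarrow> 0 < s k"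
  unfolding down_width_def
proof (rule prod_pos)
  fix l assume "k \<in> {1..m}" "l \<in> {k<..m}"
  then show "0 < degree (V l) - 1" using degree_V[of l] by auto
qed

lemma r_Suc: "1 \<le> k \<Longrightarrow> r (k + 1) = (degree (V k) - 1) * r k"
  by (simp add: up_width_Suc)

lemma s_pred:
  assumes "k \<in> {2..m}"
  shows "s (k - 1) = (degree (V k) - 1) * s k"
proof -
  have "{k - 1<..m} = insert k {k<..m}" using assms by auto
  then show ?thesis by (simp add: down_width_def)
qed

text \<open>Cutting off to the band loses nothing, as degrees and adjoints make the operator matrix
  vanish outside it.\<close>

lemma band_entry_Q:
  assumes "k \<in> {1..m}"
  shows "band_entry r s \<alpha> k a b = (if 0 \<le> a \<and> 0 \<le> b then Q_entry k (nat a) (nat b) else 0)"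
proof (cases "0 \<le> a \<and> 0 \<le> b")
  case True
  have "Q_entry k (nat a) (nat b) = 0" if "\<not> (- int (s k) \<le> b - a \<and> b - a \<le> int (r k))"
    using Q_entry_band[OF assms, of "nat a" "nat b"] that True by (cases "Q_entry k (nat a) (nat b) = 0") auto
  then show ?thesis
    using True multiplication_matrix_entry[OF assms multiplication[OF assms]]
    by (auto simp: band_entry_def band_coeff_def)
qed (auto simp: band_entry_def band_coeff_def)

lemma band_mult_Q:
  assumes k: "k \<in> {1..m}" and D: "n + r k \<le> D"
  shows "band_mult r s \<alpha> k f (int n) = (\<Sum>b\<le>D. Q_entry k n b * f (int b))"
proof -
  let ?C = "{int n - int (s k)..int n + int (r k)} \<union> int ` {..D}"
  have "band_mult r s \<alpha> k f (int n) = (\<Sum>c\<in>?C. band_entry r s \<alpha> k (int n) c * f c)"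
    by (rule sum_band_entry[symmetric]) auto
  also have "\<dots> = (\<Sum>c\<in>int ` {..D}. band_entry r s \<alpha> k (int n) c * f c)"
  proof (rule sum.mono_neutral_right)
    have "c \<in> int ` {..D}" if "0 \<le> c" "c \<le> int n + int (r k)" for c
      using that D by (intro image_eqI[of _ _ "nat c"]) auto
    then show "\<forall>c\<in>?C - int ` {..D}. band_entry r s \<alpha> k (int n) c * f c = 0"
      by (auto simp: band_entry_Q[OF k])
  qed auto
  also have "\<dots> = (\<Sum>b\<le>D. Q_entry k n b * f (int b))"
    by (subst sum.reindex) (auto simp: band_entry_Q[OF k])
  finally show ?thesis .
qed

lemma band_entry_commute:
  assumes k: "k \<in> {2..m}" and ab: "a \<noteq> b" and J: "finite J"
    and sub: "{a - int (r k + s k + (r (k - 1) + s (k - 1)))..a + int (r k + s k + (r (k - 1) + s (k - 1)))} \<subseteq> J"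
  shows "(\<Sum>p\<in>J. band_entry r s \<alpha> (k - 1) a p * band_entry r s \<alpha> k p b)
       = (\<Sum>p\<in>J. band_entry r s \<alpha> k a p * band_entry r s \<alpha> (k - 1) p b)"
proof (cases "0 \<le> a \<and> 0 \<le> b")
  case True
  have k': "k \<in> {1..m}" "k - 1 \<in> {1..m}" using k by auto
  let ?B = "nat ` (J \<inter> {0..})"
  have sum: "(\<Sum>p\<in>J. band_entry r s \<alpha> i a p * band_entry r s \<alpha> j p b)
      = (\<Sum>c\<in>?B. Q_entry i (nat a) c * Q_entry j c (nat b))"
    if "i \<in> {1..m}" "j \<in> {1..m}" for i j
  proof -
    have "(\<Sum>p\<in>J. band_entry r s \<alpha> i a p * band_entry r s \<alpha> j p b)
        = (\<Sum>p\<in>J \<inter> {0..}. band_entry r s \<alpha> i a p * band_entry r s \<alpha> j p b)"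
      using J by (intro sum.mono_neutral_right) (auto simp: band_entry_Q[OF that(1)])
    also have "\<dots> = (\<Sum>c\<in>?B. Q_entry i (nat a) c * Q_entry j c (nat b))"
      using True by (subst sum.reindex) (auto simp: inj_on_def band_entry_Q[OF that(1)] band_entry_Q[OF that(2)] intro!: sum.cong)
    finally show ?thesis .
  qed
  have supp: "c \<in> ?B" if "i = k \<or> i = k - 1" "Q_entry i (nat a) c \<noteq> 0" for i c
  proof -
    have "i \<in> {1..m}" using that(1) k' by auto
    from Q_entry_band[OF this that(2)] have "int c \<in> J"
      using sub that(1) True by (auto intro!: subsetD[OF sub])
    then show ?thesis by (intro image_eqI[of _ _ "int c"]) auto
  qed
  have "nat a \<noteq> nat b" using ab True by auto
  then show ?thesis
    unfolding sum[OF k'] sum[OF k'(2,1)]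
    by (intro Q_entry_commute[OF k, symmetric]) (use J supp in blast)+
next
  case False
  have "k \<in> {1..m}" "k - 1 \<in> {1..m}" using k by auto
  with False show ?thesis
    by (auto simp: band_entry_Q intro!: sum.neutral)
qed

text \<open>Strictness accounts for the 1 in N_0. The bounds keep rows from
  \<open>N - s (k - 1)\<close> on at or above \<open>s k\<close>, columns from
  \<open>N - r (k - 1)\<close> on at or above \<open>r k\<close>, and likewise with \<open>k\<close>
  and \<open>k - 1\<close> exchanged, so every continuation stays where the extreme coefficients are
  nonzero.\<close>

definition in_range :: "int \<Rightarrow> bool" where
  "in_range N \<longleftrightarrow> (\<forall>k\<in>{2..m}. int (s k + s (k - 1)) < N \<and> int (r k + r (k - 1)) < N)"

lemma regular_Q:
  assumes "k \<in> {1..m}" "I \<subseteq> {int (s k)..}"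
  shows "regular r s \<alpha> k I"
  unfolding regular_def
proof (intro conjI ballI)
  fix n assume "n \<in> I"
  then have n: "int (s k) \<le> n" using assms(2) by auto
  then have "0 \<le> n" by simp
  with n show "\<alpha> k (int (r k)) n \<noteq> 0" "\<alpha> k (- int (s k)) n \<noteq> 0"
    using upper_nonzero lower_nonzero assms(1) by auto
qed (use r_pos s_pos assms in auto)

lemma coregular_Q:
  assumes "k \<in> {1..m}" "I \<subseteq> {int (r k)..}"
  shows "coregular r s \<alpha> k I"
  unfolding coregular_def
proof (intro conjI ballI)
  fix n assume "n \<in> I"
  then have n: "int (r k) \<le> n" using assms(2) by auto
  then show "\<alpha> k (int (r k)) (n - int (r k)) \<noteq> 0" "\<alpha> k (- int (s k)) (n + int (s k)) \<noteq> 0"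
    using upper_nonzero[of k "n - int (r k)"] lower_nonzero[of k "n + int (s k)"] assms(1) by auto
qed (use r_pos s_pos assms in auto)

section \<open>Duality and equal spectra in the model: part (a)\<close>

lemma dual_D_mat_CD_mat:
  assumes N: "in_range N" and k: "k \<in> {1..m}"
  shows "dual_D_mat r s \<alpha> k N x * CD_mat r s \<alpha> k N = CD_mat r s \<alpha> k N * D_mat r s \<alpha> k N x"
proof (cases "k = 1")
  case True
  have 2: "2 \<in> {2..m}" using m_ge by auto
  note comm = band_entry_commute[OF 2]
  have "dual_E_mat r s \<alpha> 1 2 N x * CD_mat r s \<alpha> 1 N = CD_mat r s \<alpha> 1 N * E_mat r s \<alpha> 1 2 N x"
  proof (rule dual_E_mat_CD_mat)
    show "regular r s \<alpha> 1 {N - int (s 2)..<N + int (r 2)}"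
      using N 2 m_ge by (intro regular_Q) (force simp: in_range_def)+
    show "coregular r s \<alpha> 1 {N - int (r 2)..<N + int (s 2)}"
      using N 2 m_ge by (intro coregular_Q) (force simp: in_range_def)+
    show "(\<Sum>p\<in>J. band_entry r s \<alpha> 2 a p * band_entry r s \<alpha> 1 p b)
        = (\<Sum>p\<in>J. band_entry r s \<alpha> 1 a p * band_entry r s \<alpha> 2 p b)"
      if "a \<noteq> b" "finite J" "{a - int (r 1 + s 1 + (r 2 + s 2))..a + int (r 1 + s 1 + (r 2 + s 2))} \<subseteq> J" for a b J
      using comm[OF that(1,2)] that(3) by (simp add: add_ac)
  qed
  then show ?thesis
    using True uminus_mult_left_mat uminus_mult_right_mat
    by (simp add: dual_D_mat_def D_mat_def)
next
  case False
  then have k2: "k \<in> {2..m}" using k by auto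
  have "dual_E_mat r s \<alpha> k (k - 1) N x * CD_mat r s \<alpha> k N = CD_mat r s \<alpha> k N * E_mat r s \<alpha> k (k - 1) N x"
  proof (rule dual_E_mat_CD_mat)
    show "regular r s \<alpha> k {N - int (s (k - 1))..<N + int (r (k - 1))}"
      using N k2 k by (intro regular_Q) (force simp: in_range_def)+
    show "coregular r s \<alpha> k {N - int (r (k - 1))..<N + int (s (k - 1))}"
      using N k2 k by (intro coregular_Q) (force simp: in_range_def)+
  qed (rule band_entry_commute[OF k2])
  then show ?thesis
    using False by (simp add: dual_D_mat_def D_mat_def)
qed

lemma in_range_ge:
  assumes "in_range N" "k \<in> {1..m}"
  shows "int (r k) \<le> N" "int (s k) \<le> N"
proof -
  have "int (r k) \<le> N \<and> int (s k) \<le> N"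
  proof (cases "k = 1")
    case True
    have "2 \<in> {2..m}" using m_ge by auto
    with assms(1) True show ?thesis unfolding in_range_def by fastforce
  next
    case False
    then have "k \<in> {2..m}" using assms(2) by auto
    with assms(1) show ?thesis unfolding in_range_def by fastforce
  qed
  then show "int (r k) \<le> N" "int (s k) \<le> N" by auto
qed

lemma D_mat_carrier: "D_mat r s \<alpha> k N x \<in> carrier_mat (r k + s k) (r k + s k)"
  and dual_D_mat_carrier: "dual_D_mat r s \<alpha> k N x \<in> carrier_mat (r k + s k) (r k + s k)"
  by (simp_all add: D_mat_def dual_D_mat_def)

lemma det_D_mat_eq_dual:
  assumes N: "in_range N" and k: "k \<in> {1..m}"
  shows "det (y \<cdot>\<^sub>m 1\<^sub>m (r k + s k) - D_mat r s \<alpha> k N x)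
       = det (y \<cdot>\<^sub>m 1\<^sub>m (r k + s k) - dual_D_mat r s \<alpha> k N x)"
proof (rule det_eq_of_intertwined[where C = "CD_mat r s \<alpha> k N",
      OF D_mat_carrier[of k N x] dual_D_mat_carrier[of k N x] CD_mat_carrier])
  show "det (CD_mat r s \<alpha> k N) \<noteq> 0"
    using in_range_ge[OF N k] upper_nonzero[OF k] lower_nonzero[OF k] by (intro det_CD_mat) auto
qed (rule dual_D_mat_CD_mat[OF N k])

section \<open>Spectral curves of neighbouring indices: part (b)\<close>

lemma det_D_mat_proportional_first:
  assumes N: "in_range N"
  shows "\<exists>c. c \<noteq> 0 \<and> (\<forall>x y. det (x \<cdot>\<^sub>m 1\<^sub>m (r 2 + s 2) - D_mat r s \<alpha> 2 N y)
              = c * det (y \<cdot>\<^sub>m 1\<^sub>m (r 1 + s 1) + D_mat r s \<alpha> 1 N x))"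
proof -
  have 2: "2 \<in> {2..m}" "1 \<in> {1..m}" "2 \<in> {1..m}" using m_ge by auto
  have "regular r s \<alpha> 1 {N - int (s 2)..<N + int (r 2)}"
    using N 2 by (intro regular_Q) (force simp: in_range_def)+
  moreover have "regular r s \<alpha> 2 {N - int (s 1)..<N + int (r 1)}"
    using N 2 by (intro regular_Q) (force simp: in_range_def)+
  ultimately obtain c where "c \<noteq> 0" "\<And>x y. det (x \<cdot>\<^sub>m 1\<^sub>m (r 2 + s 2) - E_mat r s \<alpha> 2 1 N y)
           = c * det (y \<cdot>\<^sub>m 1\<^sub>m (r 1 + s 1) - E_mat r s \<alpha> 1 2 N x)"
    using det_E_mat_proportional[of 1 2 r s \<alpha> N] by auto
  moreover have "y \<cdot>\<^sub>m 1\<^sub>m (r 1 + s 1) + - E_mat r s \<alpha> 1 2 N x = y \<cdot>\<^sub>m 1\<^sub>m (r 1 + s 1) - E_mat r s \<alpha> 1 2 N x" for x y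
    by (intro eq_matI) auto
  ultimately show ?thesis by (intro exI[of _ c]) (simp add: D_mat_def)
qed

text \<open>\<open>D_mat\<close> at \<open>k\<close> involves Q_{k-1}, whereas the joint determinant
  needs Q_{k+1}. On a solution of Q_k the potential term acts as the number V_k'(x), so the operator
  recursion converts one \<open>E_mat\<close> into the other.\<close>

lemma E_mat_recursion:
  assumes N: "in_range N" and k: "k \<in> {2..<m}"
  shows "y \<cdot>\<^sub>m 1\<^sub>m (r k + s k) - poly (pderiv (V k)) x \<cdot>\<^sub>m 1\<^sub>m (r k + s k) + E_mat r s \<alpha> k (k - 1) N x
       = y \<cdot>\<^sub>m 1\<^sub>m (r k + s k) - E_mat r s \<alpha> k (k + 1) N x" (is "?A = ?B")
proof (rule eq_matI)
  let ?n = "r k + s k" and ?d = "degree (V k) - 1"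
  have k': "k \<in> {1..m}" "k - 1 \<in> {1..m}" "k + 1 \<in> {1..m}" "k \<in> {2..m}" "k + 1 \<in> {2..m}" using k by auto
  have d: "1 \<le> ?d" using degree_V[OF k'(1)] by simp
  have rk: "r (k + 1) = ?d * r k" and sk: "s (k - 1) = ?d * s k"
    using r_Suc[of k] s_pred[OF k'(4)] k by auto
  have rk': "r k = (degree (V (k - 1)) - 1) * r (k - 1)" and sk': "s k = (degree (V (k + 1)) - 1) * s (k + 1)"
    using r_Suc[of "k - 1"] s_pred[OF k'(5)] k by auto
  have le: "r (k - 1) \<le> r (k + 1)" "s (k + 1) \<le> s (k - 1)"
    using d degree_V[OF k'(2)] degree_V[OF k'(3)] unfolding rk sk rk' sk' by (simp_all add: Suc_leI mult_le_mono)
  have Nk: "int (s k) + int (s (k - 1)) < N" using N k'(4) by (auto simp: in_range_def)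
  \<comment> \<open>One solution has to serve both neighbours of \<open>k\<close>;
    \<open>s (k - 1)\<close> and \<open>r (k + 1)\<close> are the larger of their lower and upper
    widths.\<close>
  let ?I = "{N - int (s (k - 1))..<N + int (r (k + 1))}"
  have reg: "regular r s \<alpha> k ?I"
    using Nk k' by (intro regular_Q) auto
  fix i e assume "i < dim_row ?B" "e < dim_col ?B"
  then have i: "i < ?n" and e: "e < ?n" by auto
  obtain f where f: "window r s k N f = unit_vec ?n e" "solves r s \<alpha> k x ?I f"
    using local_solution_exists[OF unit_vec_carrier reg] by blast
  have E: "band_mult r s \<alpha> j f (N - int (s k) + int i) = E_mat r s \<alpha> k j N x $$ (i, e)"
    if "s j \<le> s (k - 1)" "r j \<le> r (k + 1)" for j
  proof -
    have "regular r s \<alpha> k {N - int (s j)..<N + int (r j)}" "solves r s \<alpha> k x {N - int (s j)..<N + int (r j)} f"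
      using reg f(2) that by (auto simp: regular_def solves_def)
    note EW = E_mat_window[OF this]
    have "band_mult r s \<alpha> j f (N - int (s k) + int i) = window r s k N (band_mult r s \<alpha> j f) $ i"
      using i by (simp add: window_def)
    also have "\<dots> = (E_mat r s \<alpha> k j N x *\<^sub>v unit_vec ?n e) $ i"
      by (simp only: EW f(1)[symmetric])
    also have "\<dots> = E_mat r s \<alpha> k j N x $$ (i, e)"
      using i e by (subst mult_mat_vec_nth[OF E_mat_carrier])
        (auto simp: if_distrib[of "\<lambda>t. _ * t"] cong: if_cong)
    finally show ?thesis .
  qed
  define n where "n = nat (N - int (s k) + int i)"
  have n: "int n = N - int (s k) + int i" using Nk by (simp add: n_def)
  \<comment> \<open>A common bound for all column indices reached, so that every sum up to
    \<open>D\<close> contains the whole band.\<close>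
  define D where "D = n + ?d * r k + r (k + 1) + r (k - 1) + r k"
  have "f (int n) = window r s k N f $ i" using i by (simp add: window_def n)
  then have fn: "f (int n) = (if i = e then 1 else 0)" using i e by (simp add: f(1))
  have "(\<Sum>b\<le>D. Q_entry (k + 1) n b * f (int b))
     = poly (pderiv (V k)) x * f (int n) - (\<Sum>b\<le>D. Q_entry (k - 1) n b * f (int b))"
  proof (rule Q_entry_recursion[OF k refl])
    fix c assume c: "c \<le> n + (?d - 1) * r k" "n \<le> c + (?d - 1) * s k"
    \<comment> \<open>A window row is less than \<open>r k\<close> above \<open>N\<close> or at most
      \<open>s k\<close> below it; \<open>?d - 1\<close> further steps of the band of
      \<open>k\<close> end exactly within \<open>?I\<close>.\<close>
    have 1: "(?d - 1) * r k + r k = r (k + 1)" "(?d - 1) * s k + s k = s (k - 1)"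
      using d unfolding rk sk by (metis add.commute le_add_diff_inverse2 mult_Suc plus_1_eq_Suc add_mult_distrib mult_1)+
    have "int c \<in> ?I"
      using c 1 n i by auto
    then have "band_mult r s \<alpha> k f (int c) = x * f (int c)"
      using f(2) by (simp add: solves_def)
    moreover have "c + r k \<le> D" using c 1 by (simp add: D_def rk)
    ultimately show "(\<Sum>b\<le>D. Q_entry k c b * f (int b)) = x * f (int c)"
      using band_mult_Q[OF k'(1)] by simp
  qed (simp add: D_def)
  moreover have "n + r (k + 1) \<le> D" "n + r (k - 1) \<le> D" by (simp_all add: D_def)
  ultimately have "band_mult r s \<alpha> (k + 1) f (int n)
      = poly (pderiv (V k)) x * f (int n) - band_mult r s \<alpha> (k - 1) f (int n)"
    using band_mult_Q[OF k'(3)] band_mult_Q[OF k'(2)] by simp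
  then have "E_mat r s \<alpha> k (k + 1) N x $$ (i, e)
      = poly (pderiv (V k)) x * (if i = e then 1 else 0) - E_mat r s \<alpha> k (k - 1) N x $$ (i, e)"
    using E[of "k + 1"] E[of "k - 1"] le by (simp only: n fn[unfolded n])
  then show "?A $$ (i, e) = ?B $$ (i, e)" using i e by simp
qed auto

lemma det_D_mat_proportional:
  assumes N: "in_range N" and k: "k \<in> {2..<m}"
  shows "\<exists>c. c \<noteq> 0 \<and> (\<forall>x y. det (x \<cdot>\<^sub>m 1\<^sub>m (r (k + 1) + s (k + 1)) - D_mat r s \<alpha> (k + 1) N y)
              = c * det (y \<cdot>\<^sub>m 1\<^sub>m (r k + s k) - poly (pderiv (V k)) x \<cdot>\<^sub>m 1\<^sub>m (r k + s k)
                           + D_mat r s \<alpha> k N x))"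
proof -
  have k': "k \<in> {1..m}" "k + 1 \<in> {1..m}" "k + 1 \<in> {2..m}" using k by auto
  have "int (s (k + 1) + s (k + 1 - 1)) < N" using N k'(3) unfolding in_range_def by blast
  then have "int (s (k + 1)) + int (s k) < N" by simp
  then have "regular r s \<alpha> k {N - int (s (k + 1))..<N + int (r (k + 1))}"
     "regular r s \<alpha> (k + 1) {N - int (s k)..<N + int (r k)}"
    using k' by (auto intro!: regular_Q simp del: of_nat_add)
  then obtain c where "c \<noteq> 0" "\<And>x y. det (x \<cdot>\<^sub>m 1\<^sub>m (r (k + 1) + s (k + 1)) - E_mat r s \<alpha> (k + 1) k N y)
           = c * det (y \<cdot>\<^sub>m 1\<^sub>m (r k + s k) - E_mat r s \<alpha> k (k + 1) N x)"
    using det_E_mat_proportional[of k "k + 1" r s \<alpha> N] by auto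
  then show ?thesis
    using E_mat_recursion[OF N k] k by (intro exI[of _ c]) (simp add: D_mat_def)
qed

end

theorem mainTheorem13:
  fixes m N :: nat
    and V \<pi> \<sigma> :: "nat \<Rightarrow> complex poly"
    and \<Gamma> :: "nat \<Rightarrow> contour"
    and h :: "nat \<Rightarrow> complex"
    and Q :: "nat \<Rightarrow> nat \<Rightarrow> nat \<Rightarrow> complex"
  defines "r \<equiv> up_width V"
    and "s \<equiv> down_width m V"
    and "\<alpha> \<equiv> band_coeff Q"
  assumes "2 \<le> m"
    and "\<forall>k\<in>{1..m}. 2 \<le> degree (V k)"
    and "\<forall>k\<in>{1..m}. contour (\<Gamma> k)"
    and "\<forall>n. degree (\<pi> n) = n \<and> lead_coeff (\<pi> n) = 1"
    and "\<forall>n. degree (\<sigma> n) = n \<and> lead_coeff (\<sigma> n) = 1"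
    and "\<forall>n. h n \<noteq> 0"
    and "all_integrals_converge m \<Gamma> V \<pi> \<sigma> h"
    and "no_boundary_terms m \<Gamma> V \<pi> \<sigma> h"
    and "\<forall>n l. multi_int m \<Gamma> (biorth_integrand m V (\<pi> n) (\<sigma> l)) = (if n = l then h n else 0)"
    and "\<forall>k\<in>{1..m}. multiplication_matrix (psi \<Gamma> V \<pi> h k) (Q k)"
    and "\<forall>k\<in>{1..m}. \<forall>n\<ge>0. \<alpha> k (int (r k)) n \<noteq> 0"
    and "\<forall>k\<in>{1..m}. \<forall>n\<ge>int (s k). \<alpha> k (- int (s k)) n \<noteq> 0"
    and "N \<ge> 1 + (MAX k\<in>{2..m}. max (s k + s (k - 1)) (r k + r (k - 1)))"
  shows "(\<forall>k\<in>{1..m}.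
            (\<forall>x. dual_D_mat r s \<alpha> k N x * CD_mat r s \<alpha> k N = CD_mat r s \<alpha> k N * D_mat r s \<alpha> k N x) \<and>
            (\<forall>x y. det (y \<cdot>\<^sub>m 1\<^sub>m (r k + s k) - D_mat r s \<alpha> k N x)
                 = det (y \<cdot>\<^sub>m 1\<^sub>m (r k + s k) - dual_D_mat r s \<alpha> k N x)))
       \<and> (\<exists>c. c \<noteq> 0 \<and> (\<forall>x y.
            det (x \<cdot>\<^sub>m 1\<^sub>m (r 2 + s 2) - D_mat r s \<alpha> 2 N y)
              = c * det (y \<cdot>\<^sub>m 1\<^sub>m (r 1 + s 1) + D_mat r s \<alpha> 1 N x)))
       \<and> (\<forall>k. 1 < k \<and> k \<le> m - 1 \<longrightarrow> (\<exists>c. c \<noteq> 0 \<and> (\<forall>x y.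
            det (x \<cdot>\<^sub>m 1\<^sub>m (r (k + 1) + s (k + 1)) - D_mat r s \<alpha> (k + 1) N y)
              = c * det (y \<cdot>\<^sub>m 1\<^sub>m (r k + s k) - poly (pderiv (V k)) x \<cdot>\<^sub>m 1\<^sub>m (r k + s k)
                           + D_mat r s \<alpha> k N x))))"
proof -
  interpret multi_matrix_recursion m \<Gamma> V \<pi> \<sigma> h Q
    by unfold_locales (use assms(4-15)[unfolded r_def s_def \<alpha>_def] in blast)+
  have "in_range (int N)"
    unfolding in_range_def
  proof
    fix k assume k: "k \<in> {2..m}"
    have "max (s k + s (k - 1)) (r k + r (k - 1)) \<le> (MAX k\<in>{2..m}. max (s k + s (k - 1)) (r k + r (k - 1)))"
      using k by (intro Max_ge) auto
    then show "int (down_width m V k + down_width m V (k - 1)) < int N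
        \<and> int (up_width V k + up_width V (k - 1)) < int N"
      using assms(16) by (auto simp: r_def s_def)
  qed
  note range = this
  show ?thesis
    unfolding r_def s_def \<alpha>_def
    using dual_D_mat_CD_mat[OF range] det_D_mat_eq_dual[OF range] det_D_mat_proportional_first[OF range]
      det_D_mat_proportional[OF range] by auto
qed

end
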